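(* Fix $\alpha\in(0,1)$. Under the regime $\log d=o(n^{1/3})$ as $n$ grows, $$\mathrm{pr}(T_\alpha^\ell=1\mid H_0)=\alpha+o(1)\qquad\text{for each }\ell\in\{\rho,\tau,\widehat\rho,\widehat\tau\},$$ where $$T_\alpha^\rho=I\{(n-1)\max_{j<k}\rho_{jk}^2-4\log d+\log\log d\ge q_\alpha\},$$ $$T_\alpha^\tau=I\Big\{\frac{9n(n-1)}{2(2n+5)}\max_{j<k}\tau_{jk}^2-4\log d+\log\log d\ge q_\alpha\Big\},$$ $$T_\alpha^{\widehat\rho}=I\Big\{\frac{n(n-1)(n-2)}{n^2-3}\max_{j<k}\widehat\rho_{jk}^2-4\log d+\log\log d\ge q_\alpha\Big\},$$ $$T_\alpha^{\widehat\tau}=I\Big\{\frac{9n^2(n-1)}{4(n+1)^2}\max_{j<k}\widehat\tau_{jk}^2-4\log d+\log\log d\ge q_\alpha\Big\}.$$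
   Context: Setting: $X=(X_1,\ldots,X_d)^{\mathrm T}$ is a continuous random vector in $\mathbb{R}^d$, and $X_{1,\cdot},\ldots,X_{n,\cdot}$, $X_{i,\cdot}=(X_{i,1},\ldots,X_{i,d})^{\mathrm T}$, are $n$ independent copies of $X$. The dimension $d=d_n$ may depend on $n$; both $n$ and $d$ tend to infinity. $H_0$: $X_1,\ldots,X_d$ are mutually independent. Relative ranks: $Q_{ni}^j$ is the rank of $X_{i,j}$ in $\{X_{1,j},\ldots,X_{n,j}\}$, and $R_{ni}^{jk}=Q_{ni'}^k$ where $i'$ is the index with $Q_{ni'}^j=i$. With $\mathrm{sign}(x)=x/|x|$ and $\mathrm{sign}(0)=0$, for $j\ne k$ define Spearman's rho: $\rho_{jk}=\frac{12}{n(n^2-1)}\sum_{i=1}^n\big(i-\frac{n+1}2\big)\big(R_{ni}^{jk}-\frac{n+1}2\big)$; Kendall's tau: $\tau_{jk}=\frac{2}{n(n-1)}\sum_{i<i'}\mathrm{sign}(X_{i',j}-X_{i,j})\,\mathrm{sign}(X_{i',k}-X_{i,k})$; major part of Spearman's rho: $\widehat\rho_{jk}=\frac{3}{n(n-1)(n-2)}\sum_{i\ne i'\ne i''}\mathrm{sign}(X_{i,j}-X_{i',j})\,\mathrm{sign}(X_{i,k}-X_{i'',k})$ (sum over pairwise distinct indices); projection of Kendall's tau: $\widehat\tau_{jk}=\frac{8}{n^2(n-1)}\sum_{i=1}^n\big(i-\frac{n+1}2\big)\big(R_{ni}^{jk}-\frac{n+1}2\big)$. $I(\cdot)$ is the indicator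 and $q_\alpha=-\log(8\pi)-2\log\log(1-\alpha)^{-1}$. *)

theory Defs
  imports "HOL-Probability.Probability" "HOL-Library.Landau_Symbols"
begin

text \<open>
  A data matrix is a function \<open>x\<close> with \<open>x i j\<close> the \<open>j\<close>-th coordinate of the \<open>i\<close>-th observation,
  for \<open>i \<in> {1..n}\<close> and \<open>j \<in> {1..d}\<close>; other entries are never inspected.
\<close>

definition samp_rank :: "nat \<Rightarrow> (nat \<Rightarrow> nat \<Rightarrow> real) \<Rightarrow> nat \<Rightarrow> nat \<Rightarrow> nat" where
  "samp_rank n x j i = card {m \<in> {1..n}. x m j \<le> x i j}"

text \<open>
  The description below is of the rank rather than of the index \<open>i'\<close>. The two agree when column
  \<open>j\<close> has no ties; with ties (a null event for continuous data) the value still depends only on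
  the ranks of the \<open>n\<close> observations, so every statistic is measurable everywhere.
\<close>

definition rel_rank :: "nat \<Rightarrow> (nat \<Rightarrow> nat \<Rightarrow> real) \<Rightarrow> nat \<Rightarrow> nat \<Rightarrow> nat \<Rightarrow> nat" where
  "rel_rank n x j k i = (THE r. \<exists>i'\<in>{1..n}. samp_rank n x j i' = i \<and> r = samp_rank n x k i')"

definition spearman_rho :: "nat \<Rightarrow> (nat \<Rightarrow> nat \<Rightarrow> real) \<Rightarrow> nat \<Rightarrow> nat \<Rightarrow> real" where
  "spearman_rho n x j k = 12 / (real n * ((real n)\<^sup>2 - 1)) *
     (\<Sum>i=1..n. (real i - (real n + 1) / 2) * (real (rel_rank n x j k i) - (real n + 1) / 2))"

definition kendall_tau :: "nat \<Rightarrow> (nat \<Rightarrow> nat \<Rightarrow> real) \<Rightarrow> nat \<Rightarrow> nat \<Rightarrow> real" where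
  "kendall_tau n x j k = 2 / (real n * (real n - 1)) *
     (\<Sum>(i, i') \<in> {(i, i'). 1 \<le> i \<and> i < i' \<and> i' \<le> n}.
        sgn (x i' j - x i j) * sgn (x i' k - x i k))"

definition spearman_rho_major :: "nat \<Rightarrow> (nat \<Rightarrow> nat \<Rightarrow> real) \<Rightarrow> nat \<Rightarrow> nat \<Rightarrow> real" where
  "spearman_rho_major n x j k = 3 / (real n * (real n - 1) * (real n - 2)) *
     (\<Sum>(i, i', i'') \<in> {(i, i', i''). i \<in> {1..n} \<and> i' \<in> {1..n} \<and> i'' \<in> {1..n} \<and>
                           i \<noteq> i' \<and> i \<noteq> i'' \<and> i' \<noteq> i''}.
        sgn (x i j - x i' j) * sgn (x i k - x i'' k))"

definition kendall_tau_proj :: "nat \<Rightarrow> (nat \<Rightarrow> nat \<Rightarrow> real) \<Rightarrow> nat \<Rightarrow> nat \<Rightarrow> real" where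
  "kendall_tau_proj n x j k = 8 / ((real n)\<^sup>2 * (real n - 1)) *
     (\<Sum>i=1..n. (real i - (real n + 1) / 2) * (real (rel_rank n x j k i) - (real n + 1) / 2))"

definition max_sq :: "nat \<Rightarrow> (nat \<Rightarrow> nat \<Rightarrow> real) \<Rightarrow> real" where
  "max_sq d r = Max {(r j k)\<^sup>2 | j k. 1 \<le> j \<and> j < k \<and> k \<le> d}"

definition q_level :: "real \<Rightarrow> real" where
  "q_level \<alpha> = - ln (8 * pi) - 2 * ln (ln (inverse (1 - \<alpha>)))"

definition T_rho :: "real \<Rightarrow> nat \<Rightarrow> nat \<Rightarrow> (nat \<Rightarrow> nat \<Rightarrow> real) \<Rightarrow> real" where
  "T_rho \<alpha> n d x = of_bool (
     (real n - 1) * max_sq d (spearman_rho n x)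
       - 4 * ln (real d) + ln (ln (real d)) \<ge> q_level \<alpha>)"

definition T_tau :: "real \<Rightarrow> nat \<Rightarrow> nat \<Rightarrow> (nat \<Rightarrow> nat \<Rightarrow> real) \<Rightarrow> real" where
  "T_tau \<alpha> n d x = of_bool (
     9 * real n * (real n - 1) / (2 * (2 * real n + 5)) * max_sq d (kendall_tau n x)
       - 4 * ln (real d) + ln (ln (real d)) \<ge> q_level \<alpha>)"

definition T_rho_major :: "real \<Rightarrow> nat \<Rightarrow> nat \<Rightarrow> (nat \<Rightarrow> nat \<Rightarrow> real) \<Rightarrow> real" where
  "T_rho_major \<alpha> n d x = of_bool (
     real n * (real n - 1) * (real n - 2) / ((real n)\<^sup>2 - 3) * max_sq d (spearman_rho_major n x)
       - 4 * ln (real d) + ln (ln (real d)) \<ge> q_level \<alpha>)"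

definition T_tau_proj :: "real \<Rightarrow> nat \<Rightarrow> nat \<Rightarrow> (nat \<Rightarrow> nat \<Rightarrow> real) \<Rightarrow> real" where
  "T_tau_proj \<alpha> n d x = of_bool (
     9 * (real n)\<^sup>2 * (real n - 1) / (4 * (real n + 1)\<^sup>2) * max_sq d (kendall_tau_proj n x)
       - 4 * ln (real d) + ln (ln (real d)) \<ge> q_level \<alpha>)"

abbreviation vec_space :: "nat \<Rightarrow> (nat \<Rightarrow> real) measure" where
  "vec_space d \<equiv> \<Pi>\<^sub>M j\<in>{1..d}. borel"

text \<open>
  Continuity means continuous marginal distribution functions, which is equivalent to continuity
  of the joint distribution function and implied by the existence of a density.
\<close>

definition continuous_random_vector ::
    "'a measure \<Rightarrow> nat \<Rightarrow> ('a \<Rightarrow> nat \<Rightarrow> real) \<Rightarrow> bool" where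
  "continuous_random_vector M d X \<longleftrightarrow>
     X \<in> measurable M (vec_space d) \<and>
     (\<forall>j\<in>{1..d}. continuous_on UNIV (cdf (distr M borel (\<lambda>\<omega>. X \<omega> j))))"

definition mutually_indep_components ::
    "'a measure \<Rightarrow> nat \<Rightarrow> ('a \<Rightarrow> nat \<Rightarrow> real) \<Rightarrow> bool" where
  "mutually_indep_components M d X \<longleftrightarrow>
     prob_space.indep_vars M (\<lambda>_. borel) (\<lambda>j \<omega>. X \<omega> j) {1..d}"

definition independent_copies ::
    "'a measure \<Rightarrow> nat \<Rightarrow> nat \<Rightarrow> (nat \<Rightarrow> 'a \<Rightarrow> nat \<Rightarrow> real) \<Rightarrow> ('a \<Rightarrow> nat \<Rightarrow> real) \<Rightarrow> bool" where
  "independent_copies M d n Y X \<longleftrightarrow>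
     prob_space.indep_vars M (\<lambda>_. vec_space d) Y {1..n} \<and>
     (\<forall>i\<in>{1..n}. distr M (vec_space d) (Y i) = distr M (vec_space d) X)"

end

theory Submission imports Defs "HOL-Real_Asymp.Real_Asymp" begin

text \<open>Under independence the rank columns of the data are independent, uniformly distributed random
permutations, and each of the four statistics sees the data only through these columns. The
question is thus about the largest of the values \<open>\<bar>s (Q j) (Q k)\<bar>\<close> over all pairs \<open>j < k\<close> of \<open>d\<close>
random permutations, where \<open>s\<close> is a standardized rank statistic. Relabelling the observations
changes both columns by the same permutation and leaves \<open>s\<close> unchanged, so the conditional law of
\<open>s (Q j) (Q k)\<close> given \<open>Q j\<close> is always the same. Exceedances of a level \<open>x\<close> by two pairs with a
common column are therefore still independent, pairs without a common column are independent
anyway, and the number of exceedances is nearly a Poisson variable. Its mean is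
\<open>d (d - 1) p / 2\<close> with \<open>p\<close> the exceedance probability of one pair, and the error is
of order \<open>d\<^sup>3 p\<^sup>2\<close> (\<open>poisson_dissociated_bound\<close>, \<open>no_pair_probability\<close>). It tends to zero as soon
as \<open>d\<^sup>2 p\<close> stays bounded.

It remains to see that \<open>p\<close> behaves like the two-sided Gaussian tail \<open>2 \<phi>(x) / x\<close> at
\<open>x\<^sup>2 = 4 ln d - ln (ln d) + q\<close>. The condition on \<open>d\<close> says exactly that \<open>x\<close> is of smaller order than
\<open>n\<close> to the power \<open>1/6\<close>, the range of Cramer's moderate deviations. For sums of independent bounded
variables these are obtained in \<open>moderate_deviation\<close> from Lindeberg's replacement argument: the
logistic function dominates its own derivatives, so exchanging one summand for a Gaussian variable
changes the expectation of a logistic function by a small relative error, and relative errors are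
harmless however small the tail is. A logistic function whose slope is a large multiple of \<open>x\<close>
separates levels at distance \<open>1/x\<close>, which is the scale on which the Gaussian tail changes by a
constant factor.

The statistics are reduced to such sums in three ways. Kendall's tau of a random
permutation is a sum of independent variables by the Lehmer code (\<open>sgn_sum_law\<close>). Spearman's rho is
not, but a random permutation arises as the ranks of independent uniform variables, and
replacing the ranks by the variables themselves gives a sum of independent variables. The price is
the difference of the two sums. Given the set of values, it is a weighted sum along a random
permutation with summands that are small because the empirical distribution function is close to
the identity (\<open>spearman_uniform_comparison\<close>). The projection of Kendall's tau is a multiple of
Spearman's rho, and the major part of Spearman's rho differs from it by a combination with Kendall's
tau that is of order \<open>1 / sqrt n\<close> after standardization for every permutation
(\<open>moderately_gaussian_rho_major\<close>).

With these tails \<open>d\<^sup>2 p / 2\<close> converges to \<open>exp (- q / 2) / sqrt (8 \<pi>)\<close>, which the definition of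
\<open>q_level\<close> makes equal to \<open>ln (1 / (1 - \<alpha>))\<close>. The probability of no exceedance tends to \<open>1 - \<alpha>\<close>.\<close>

section \<open>The logistic function and its Gaussian averages\<close>

definition logistic :: "real \<Rightarrow> real" where
  "logistic u = 1 / (1 + exp (- u))"

text \<open>The derivatives of the logistic function up to the third order, written as polynomials in the
function itself. Orders above three repeat the third one.\<close>

definition logistic_diff :: "nat \<Rightarrow> real \<Rightarrow> real" where
  "logistic_diff m u = (let s = logistic u in
     if m = 0 then s else if m = 1 then s * (1 - s)
     else if m = 2 then s * (1 - s) * (1 - 2 * s)
     else s * (1 - s) * (1 - 6 * s + 6 * s\<^sup>2))"

lemma logistic_pos: "0 < logistic u" and logistic_less_1: "logistic u < 1"
  by (auto simp: logistic_def add_pos_pos intro!: divide_pos_pos)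

lemma logistic_measurable [measurable]: "logistic \<in> borel_measurable borel"
  unfolding logistic_def[abs_def] by measurable

lemma logistic_diff_measurable [measurable]: "logistic_diff m \<in> borel_measurable borel"
  unfolding logistic_diff_def[abs_def] Let_def by measurable

lemma DERIV_logistic: "(logistic has_real_derivative logistic u * (1 - logistic u)) (at u)"
proof -
  have "1 + exp (- u) > 0" by (simp add: add_pos_pos)
  then show ?thesis
    unfolding logistic_def[abs_def]
    by (auto intro!: derivative_eq_intros simp: field_simps power2_eq_square)
qed

lemma DERIV_logistic_diff:
  assumes "m < 3"
  shows "(logistic_diff m has_real_derivative logistic_diff (Suc m) u) (at u)"
proof -
  note D = DERIV_logistic
  consider "m = 0" | "m = 1" | "m = 2" using assms by linarith
  then show ?thesis
  proof cases
    case 1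
    then show ?thesis using D by (simp add: logistic_diff_def[abs_def] Let_def)
  next
    case 2
    have "((\<lambda>u. logistic u * (1 - logistic u)) has_real_derivative
        logistic u * (1 - logistic u) * (1 - 2 * logistic u)) (at u)"
      by (rule derivative_eq_intros D refl)+ (simp add: algebra_simps)
    then show ?thesis using 2 by (simp add: logistic_diff_def[abs_def] Let_def)
  next
    case 3
    have "((\<lambda>u. logistic u * (1 - logistic u) * (1 - 2 * logistic u)) has_real_derivative
        logistic u * (1 - logistic u) * (1 - 6 * logistic u + 6 * (logistic u)\<^sup>2)) (at u)"
      by (rule derivative_eq_intros D refl)+ (simp add: algebra_simps power2_eq_square)
    then show ?thesis using 3 by (simp add: logistic_diff_def[abs_def] Let_def)
  qed
qed

text \<open>All derivatives contain the factor \<open>s (1 - s)\<close>, and the remaining factor has modulus at most one on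
the unit interval. This domination by the function itself is what makes relative errors possible.\<close>

lemma logistic_diff_bound: "\<bar>logistic_diff m u\<bar> \<le> logistic u"
proof -
  define s where "s = logistic u"
  have s: "0 < s" "s < 1" using logistic_pos logistic_less_1 by (auto simp: s_def)
  have p: "s * (1 - s) \<le> s" "0 \<le> s * (1 - s)" using s by auto
  have q: "\<bar>1 - 2 * s\<bar> \<le> 1" using s by auto
  have "0 \<le> s * s" "s * s \<le> s" using s by (auto simp: mult_left_le)
  moreover have "0 \<le> (2 * s - 1)\<^sup>2" by simp
  ultimately have r: "\<bar>1 - 6 * s + 6 * s\<^sup>2\<bar> \<le> 1"
    by (simp add: abs_le_iff power2_eq_square algebra_simps)
  have "\<bar>s * (1 - s) * t\<bar> \<le> s" if "\<bar>t\<bar> \<le> 1" for t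
  proof -
    have "\<bar>s * (1 - s) * t\<bar> = s * (1 - s) * \<bar>t\<bar>" using p(2) s by (simp only: abs_mult abs_of_nonneg)
    also have "\<dots> \<le> s * (1 - s) * 1" using p that by (intro mult_left_mono) auto
    finally show ?thesis using p by linarith
  qed
  then show ?thesis using p q r s
    by (simp add: logistic_diff_def Let_def s_def[symmetric])
qed

text \<open>A Harnack type inequality: the values of the logistic function at a bounded distance are comparable
even in its left tail.\<close>

lemma logistic_add_le: "logistic (u + h) \<le> exp \<bar>h\<bar> * logistic u"
proof -
  have "exp (- u) \<le> exp \<bar>h\<bar> * exp (- (u + h))"
    by (simp flip: exp_add)
  moreover have "1 \<le> exp \<bar>h\<bar>" by simp
  ultimately have "1 + exp (- u) \<le> exp \<bar>h\<bar> * (1 + exp (- (u + h)))"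
    unfolding distrib_left by linarith
  moreover have "1 + exp (- u) > 0" "1 + exp (- (u+h)) > 0" by (simp_all add: add_pos_pos)
  ultimately show ?thesis unfolding logistic_def
    by (simp add: field_simps)
qed

text \<open>The remainder is measured relative to the value at the centre; the third derivative at the
intermediate point is transported back by \<open>logistic_add_le\<close>.\<close>

lemma logistic_Taylor:
  "\<bar>logistic (u + h) - (logistic u + logistic_diff 1 u * h + logistic_diff 2 u * h\<^sup>2 / 2)\<bar>
     \<le> \<bar>h\<bar> ^ 3 * exp \<bar>h\<bar> / 6 * logistic u"
proof -
  have "\<exists>t. \<bar>t\<bar> \<le> \<bar>h\<bar> \<and> logistic (u + h) =
     (\<Sum>m<3. logistic_diff m (u + 0) / fact m * h ^ m) + logistic_diff 3 (u + t) / fact 3 * h ^ 3"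
  proof (rule Maclaurin_bi_le[where diff = "\<lambda>m t. logistic_diff m (u + t)"])
    show "\<forall>m t. m < 3 \<and> \<bar>t\<bar> \<le> \<bar>h\<bar> \<longrightarrow>
        ((\<lambda>t. logistic_diff m (u + t)) has_real_derivative logistic_diff (Suc m) (u + t)) (at t)"
      by (auto intro!: derivative_eq_intros
           DERIV_chain2[OF DERIV_logistic_diff, where g="\<lambda>t. u + t", THEN DERIV_cong])
  qed (simp add: fun_eq_iff logistic_diff_def)
  then obtain t where t: "\<bar>t\<bar> \<le> \<bar>h\<bar>" and eq: "logistic (u + h) =
     (\<Sum>m<3. logistic_diff m u / fact m * h ^ m) + logistic_diff 3 (u + t) / fact 3 * h ^ 3"
    by auto
  have "logistic (u + h) - (logistic u + logistic_diff 1 u * h + logistic_diff 2 u * h\<^sup>2 / 2)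
      = logistic_diff 3 (u + t) * h ^ 3 / 6"
    unfolding eq by (simp add: numeral_3_eq_3 numeral_2_eq_2 logistic_diff_def[of 0])
  also have "\<bar>\<dots>\<bar> = \<bar>logistic_diff 3 (u + t)\<bar> * \<bar>h\<bar> ^ 3 / 6"
    by (simp add: abs_mult power_abs)
  also have "\<dots> \<le> (exp \<bar>h\<bar> * logistic u) * \<bar>h\<bar> ^ 3 / 6"
  proof -
    have "\<bar>logistic_diff 3 (u + t)\<bar> \<le> exp \<bar>t\<bar> * logistic u"
      using logistic_diff_bound logistic_add_le by (meson order_trans)
    also have "\<dots> \<le> exp \<bar>h\<bar> * logistic u"
      using t logistic_pos[of u] by (intro mult_right_mono) auto
    finally show ?thesis by (intro divide_right_mono mult_right_mono) auto
  qed
  finally show ?thesis by (simp add: mult_ac)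
qed

abbreviation std_normal :: "real measure" where
  "std_normal \<equiv> density lborel std_normal_density"

interpretation std_normal: prob_space std_normal
  by (rule prob_space_normal_density) simp

text \<open>The Gaussian variable inside has mean \<open>w\<close> and variance \<open>t\<close>. The variance is a parameter because it
grows in the course of the Lindeberg argument, by the variance of one summand at a time.\<close>

definition gauss_logistic :: "real \<Rightarrow> real \<Rightarrow> real" where
  "gauss_logistic t w = (\<integral>z. logistic (w + sqrt t * z) \<partial>std_normal)"

lemma logistic_integrable:
  assumes "finite_measure M" "f \<in> borel_measurable M"
  shows "integrable M (\<lambda>x. logistic (f x))" "integrable M (\<lambda>x. logistic_diff m (f x))"
proof -
  interpret finite_measure M by fact
  have *: "\<bar>logistic x\<bar> \<le> 1" for x using logistic_pos[of x] logistic_less_1[of x] by simp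
  have **: "\<bar>logistic_diff m x\<bar> \<le> 1" for x
    using logistic_diff_bound[of m x] logistic_less_1[of x] by simp
  note [measurable] = assms(2)
  show "integrable M (\<lambda>x. logistic (f x))" "integrable M (\<lambda>x. logistic_diff m (f x))"
    by (rule integrable_const_bound[where B=1]; use * ** in simp)+
qed

lemma gauss_logistic_pos: "0 < gauss_logistic t w"
proof -
  have "0 \<le> gauss_logistic t w"
    unfolding gauss_logistic_def using logistic_pos by (intro integral_nonneg_AE) (auto intro: less_imp_le)
  moreover have "gauss_logistic t w \<noteq> 0"
    unfolding gauss_logistic_def
  proof (subst integral_nonneg_eq_0_iff_AE)
    show "integrable std_normal (\<lambda>z. logistic (w + sqrt t * z))"
      by (intro logistic_integrable std_normal.finite_measure_axioms) measurable
    have "\<not> (AE z in std_normal. False)" using std_normal.AE_False by simp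
    then show "\<not> (AE z in std_normal. logistic (w + sqrt t * z) = 0)"
      using logistic_pos by (simp add: less_imp_neq[symmetric] less_imp_neq)
  qed (use logistic_pos in \<open>auto intro: less_imp_le\<close>)
  ultimately show ?thesis by simp
qed

lemma gauss_logistic_less_1: "gauss_logistic t w \<le> 1"
  unfolding gauss_logistic_def
  by (intro std_normal.integral_le_const logistic_integrable std_normal.finite_measure_axioms)
     (auto intro: less_imp_le logistic_less_1)

lemma gauss_logistic_measurable [measurable]: "gauss_logistic t \<in> borel_measurable borel"
  unfolding gauss_logistic_def[abs_def] by measurable

lemma gauss_logistic_add_le: "gauss_logistic t (w + h) \<le> exp \<bar>h\<bar> * gauss_logistic t w"
proof -
  have "gauss_logistic t (w + h) \<le> (\<integral>z. exp \<bar>h\<bar> * logistic (w + sqrt t * z) \<partial>std_normal)"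
    unfolding gauss_logistic_def
    using logistic_add_le[of "w + sqrt t * z" h for z]
    by (intro integral_mono integrable_mult_right logistic_integrable std_normal.finite_measure_axioms)
       (auto simp: algebra_simps)
  then show ?thesis by (simp add: gauss_logistic_def)
qed

text \<open>Averaging \<open>logistic_Taylor\<close> over the Gaussian variable preserves its relative form.
Only the existence of the coefficients matters: they cancel when two variables with the same first
two moments are compared.\<close>

lemma gauss_logistic_Taylor:
  obtains a b where "\<And>h. \<bar>gauss_logistic t (w + h) - (gauss_logistic t w + a * h + b * h\<^sup>2)\<bar>
     \<le> \<bar>h\<bar> ^ 3 * exp \<bar>h\<bar> / 6 * gauss_logistic t w"
proof
  fix h
  define f where "f z = w + sqrt t * z" for z
  let ?a = "\<lambda>m. \<integral>z. logistic_diff m (f z) \<partial>std_normal"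
  have [measurable]: "f \<in> borel_measurable borel" unfolding f_def[abs_def] by measurable
  have I [simp, intro]: "integrable std_normal (\<lambda>z. logistic (f z))"
      "integrable std_normal (\<lambda>z. logistic (f z + h))"
      "integrable std_normal (\<lambda>z. logistic_diff m (f z))" for m
    by (intro logistic_integrable std_normal.finite_measure_axioms; measurable)+
  define r where "r z = logistic (f z + h) - (logistic (f z)
      + logistic_diff 1 (f z) * h + logistic_diff 2 (f z) * (h\<^sup>2 / 2))" for z
  have r: "integrable std_normal r" unfolding r_def[abs_def]
    by (intro Bochner_Integration.integrable_add Bochner_Integration.integrable_diff
         integrable_mult_left I)
  have "gauss_logistic t (w + h) = (\<integral>z. logistic (f z + h) \<partial>std_normal)"
    unfolding gauss_logistic_def f_def by (intro arg_cong[where f="integral\<^sup>L std_normal"]) (simp add: fun_eq_iff add_ac)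
  moreover have "(\<integral>z. r z \<partial>std_normal) = (\<integral>z. logistic (f z + h) \<partial>std_normal) -
     ((\<integral>z. logistic (f z) \<partial>std_normal) + ?a 1 * h + ?a 2 * (h\<^sup>2 / 2))"
    unfolding r_def
    by (subst Bochner_Integration.integral_diff Bochner_Integration.integral_add integral_mult_left_zero;
        (intro Bochner_Integration.integrable_add Bochner_Integration.integrable_diff
         integrable_mult_left I refl)?)+
  ultimately have "gauss_logistic t (w + h) - (gauss_logistic t w + ?a 1 * h + ?a 2 / 2 * h\<^sup>2)
     = (\<integral>z. r z \<partial>std_normal)"
    unfolding gauss_logistic_def f_def by linarith
  also have "\<bar>\<dots>\<bar> \<le> (\<integral>z. \<bar>r z\<bar> \<partial>std_normal)" by (rule integral_abs_bound)
  also have "\<dots> \<le> (\<integral>z. \<bar>h\<bar> ^ 3 * exp \<bar>h\<bar> / 6 * logistic (f z) \<partial>std_normal)"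
  proof (rule integral_mono)
    fix z
    show "\<bar>r z\<bar> \<le> \<bar>h\<bar> ^ 3 * exp \<bar>h\<bar> / 6 * logistic (f z)"
      unfolding r_def using logistic_Taylor[of "f z" h] by simp
  qed (intro integrable_abs r integrable_mult_right I)+
  also have "\<dots> = \<bar>h\<bar> ^ 3 * exp \<bar>h\<bar> / 6 * gauss_logistic t w"
    unfolding gauss_logistic_def f_def by (rule integral_mult_right_zero)
  finally show "\<bar>gauss_logistic t (w + h) - (gauss_logistic t w + ?a 1 * h + ?a 2 / 2 * h\<^sup>2)\<bar>
     \<le> \<bar>h\<bar> ^ 3 * exp \<bar>h\<bar> / 6 * gauss_logistic t w" .
qed

section \<open>Lindeberg replacement with relative error\<close>

text \<open>Sums of independent Gaussian variables, including the degenerate variances, for which there is no density.\<close>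

lemma std_normal_convolution:
  assumes "0 \<le> t" "0 \<le> v"
  shows "distr (std_normal \<Otimes>\<^sub>M std_normal) borel (\<lambda>p. sqrt t * fst p + sqrt v * snd p)
     = distr std_normal borel (\<lambda>x. sqrt (t + v) * x)"
proof -
  interpret P: pair_prob_space std_normal std_normal ..
  have D: "distributed (std_normal \<Otimes>\<^sub>M std_normal) lborel fst std_normal_density"
    "distributed (std_normal \<Otimes>\<^sub>M std_normal) lborel snd std_normal_density"
  proof -
    have "distr (std_normal \<Otimes>\<^sub>M std_normal) std_normal fst = std_normal"
      by (rule std_normal.distr_pair_fst)
    moreover have "distr (std_normal \<Otimes>\<^sub>M std_normal) lborel fst = distr (std_normal \<Otimes>\<^sub>M std_normal) std_normal fst"
      by (intro distr_cong) simp_all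
    ultimately show "distributed (std_normal \<Otimes>\<^sub>M std_normal) lborel fst std_normal_density"
      by (simp add: distributed_def)
    have 1: "distr (std_normal \<Otimes>\<^sub>M std_normal) lborel snd = std_normal"
    proof (rule measure_eqI)
      fix A assume "A \<in> sets (distr (std_normal \<Otimes>\<^sub>M std_normal) lborel snd)"
      then have [measurable]: "A \<in> sets borel" by simp
      have "snd -` A \<inter> space (std_normal \<Otimes>\<^sub>M std_normal) = space std_normal \<times> A"
        by (auto simp: space_pair_measure)
      then show "emeasure (distr (std_normal \<Otimes>\<^sub>M std_normal) lborel snd) A = emeasure std_normal A"
        using std_normal.emeasure_pair_measure_Times[of "space std_normal" std_normal A]
          std_normal.emeasure_space_1
        by (simp add: emeasure_distr)
    qed simp
    then show "distributed (std_normal \<Otimes>\<^sub>M std_normal) lborel snd std_normal_density"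
      by (simp add: distributed_def)
  qed
  have ind: "P.indep_var borel fst borel snd"
    unfolding P.indep_var_distribution_eq
  proof (intro conjI)
    have "distr (std_normal \<Otimes>\<^sub>M std_normal) borel fst = std_normal"
      "distr (std_normal \<Otimes>\<^sub>M std_normal) borel snd = std_normal"
      using D distr_cong[of "std_normal \<Otimes>\<^sub>M std_normal" "std_normal \<Otimes>\<^sub>M std_normal" borel lborel fst fst]
        distr_cong[of "std_normal \<Otimes>\<^sub>M std_normal" "std_normal \<Otimes>\<^sub>M std_normal" borel lborel snd snd]
      by (auto simp: distributed_def)
    moreover have "distr (std_normal \<Otimes>\<^sub>M std_normal) (borel \<Otimes>\<^sub>M borel) (\<lambda>x. (fst x, snd x)) = std_normal \<Otimes>\<^sub>M std_normal"
      by (simp add: distr_id2 cong: sets_pair_measure_cong)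
    ultimately show "distr (std_normal \<Otimes>\<^sub>M std_normal) borel fst \<Otimes>\<^sub>M distr (std_normal \<Otimes>\<^sub>M std_normal) borel snd =
        distr (std_normal \<Otimes>\<^sub>M std_normal) (borel \<Otimes>\<^sub>M borel) (\<lambda>x. (fst x, snd x))" by simp
  qed simp_all
  show ?thesis
  proof (cases "t = 0 \<or> v = 0")
    case True
    have "distr (std_normal \<Otimes>\<^sub>M std_normal) borel (\<lambda>p. sqrt t * fst p + sqrt v * snd p) =
      (if t = 0 then distr (distr (std_normal \<Otimes>\<^sub>M std_normal) lborel snd) borel (\<lambda>x. sqrt (t + v) * x)
       else distr (distr (std_normal \<Otimes>\<^sub>M std_normal) lborel fst) borel (\<lambda>x. sqrt (t + v) * x))"
      using True by (auto simp: distr_distr comp_def)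
    then show ?thesis using D by (auto simp: distributed_def)
  next
    case False
    then have p: "0 < sqrt t" "0 < sqrt v" "0 < sqrt (t + v)" using assms by auto
    have ind': "P.indep_var borel (\<lambda>x. sqrt t * fst x) borel (\<lambda>x. sqrt v * snd x)"
      using P.indep_var_compose[OF ind, of "\<lambda>x. sqrt t * x" borel "\<lambda>x. sqrt v * x" borel]
      by (simp add: comp_def)
    have a: "distributed (std_normal \<Otimes>\<^sub>M std_normal) lborel (\<lambda>x. sqrt t * fst x) (normal_density 0 (sqrt t))"
      using P.normal_density_affine[OF D(1), of "sqrt t" 0] p by simp
    have b: "distributed (std_normal \<Otimes>\<^sub>M std_normal) lborel (\<lambda>x. sqrt v * snd x) (normal_density 0 (sqrt v))"
      using P.normal_density_affine[OF D(2), of "sqrt v" 0] p by simp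
    have "distributed (std_normal \<Otimes>\<^sub>M std_normal) lborel (\<lambda>x. sqrt t * fst x + sqrt v * snd x) (normal_density 0 (sqrt (t + v)))"
      using P.add_indep_normal[OF ind' p(1,2) a b] assms by simp
    moreover have "distributed std_normal lborel (\<lambda>x. sqrt (t+v) * x) (normal_density 0 (sqrt (t + v)))"
      using std_normal.normal_density_affine[of "\<lambda>x. x" 0 1 "sqrt (t + v)" 0] p
      by (simp add: distributed_def distr_id2)
    ultimately have "distr (std_normal \<Otimes>\<^sub>M std_normal) lborel (\<lambda>x. sqrt t * fst x + sqrt v * snd x) =
       distr std_normal lborel (\<lambda>x. sqrt (t+v) * x)" by (simp add: distributed_def)
    then have "distr (distr (std_normal \<Otimes>\<^sub>M std_normal) lborel (\<lambda>x. sqrt t * fst x + sqrt v * snd x)) borel id =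
       distr (distr std_normal lborel (\<lambda>x. sqrt (t+v) * x)) borel id" by simp
    then show ?thesis by (simp add: distr_distr comp_def)
  qed
qed

lemma gauss_logistic_convolution:
  assumes "0 \<le> t" "0 \<le> v"
  shows "gauss_logistic (t + v) w = (\<integral>z. gauss_logistic t (w + sqrt v * z) \<partial>std_normal)"
proof -
  interpret P: pair_prob_space std_normal std_normal ..
  have "gauss_logistic (t + v) w = (\<integral>x. logistic (w + x) \<partial>distr std_normal borel (\<lambda>x. sqrt (t + v) * x))"
    unfolding gauss_logistic_def by (simp add: integral_distr)
  also have "\<dots> = (\<integral>p. logistic (w + (sqrt v * fst p + sqrt t * snd p)) \<partial>(std_normal \<Otimes>\<^sub>M std_normal))"
    using assms std_normal_convolution[of v t, symmetric]
    by (simp add: integral_distr add_ac)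
  also have "\<dots> = (\<integral>z. gauss_logistic t (w + sqrt v * z) \<partial>std_normal)"
    unfolding gauss_logistic_def
    by (subst P.integral_fst'[symmetric]; (intro logistic_integrable P.finite_measure_axioms)?)
       (auto simp: add_ac)
  finally show ?thesis .
qed

lemma integrable_std_normal_exp_abs: "integrable std_normal (\<lambda>z. exp (c * \<bar>z\<bar>))"
proof -
  have I: "integrable std_normal (\<lambda>z. exp (a * z))" for a
  proof -
    have "integrable lborel (\<lambda>z. exp (a\<^sup>2 / 2) * normal_density a 1 z)"
      by (intro integrable_mult_right) simp
    moreover have "exp (a\<^sup>2 / 2) * normal_density a 1 z = std_normal_density z * exp (a * z)" for z
      by (simp add: normal_density_def mult_exp_exp field_simps power2_eq_square)
    ultimately show ?thesis by (simp add: integrable_density)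
  qed
  show ?thesis
  proof (rule Bochner_Integration.integrable_bound)
    show "integrable std_normal (\<lambda>z. exp (c * z) + exp (- c * z))"
      using I by (intro Bochner_Integration.integrable_add)
    have "0 < exp (c * z) + exp (- c * z)" for z by (simp add: add_pos_pos)
    then have "norm (exp (c * z) + exp (- c * z)) = exp (c * z) + exp (- c * z)" for z by simp
    then show "AE z in std_normal. norm (exp (c * \<bar>z\<bar>)) \<le> norm (exp (c * z) + exp (- c * z))"
      by (intro always_eventually allI) (auto simp: abs_if)
  qed measurable
qed

lemma integrable_std_normal_cube_exp: "integrable std_normal (\<lambda>z. \<bar>z\<bar> ^ 3 * exp \<bar>z\<bar>)"
proof (rule Bochner_Integration.integrable_bound)
  show "integrable std_normal (\<lambda>z. 27 * exp (2 * \<bar>z\<bar>))"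
    by (intro integrable_mult_right integrable_std_normal_exp_abs)
  have "\<bar>z\<bar> ^ 3 * exp \<bar>z\<bar> \<le> 27 * exp (2 * \<bar>z\<bar>)" for z :: real
  proof -
    have "(\<bar>z\<bar> / 3) ^ 3 \<le> (1 + \<bar>z\<bar> / 3) ^ 3" by (intro power_mono) auto
    also have "\<dots> \<le> exp \<bar>z\<bar>" using exp_ge_one_plus_x_over_n_power_n[of 3 "\<bar>z\<bar>"] by simp
    finally have "\<bar>z\<bar> ^ 3 \<le> 27 * exp \<bar>z\<bar>" by (simp add: power_divide)
    then have "\<bar>z\<bar> ^ 3 * exp \<bar>z\<bar> \<le> (27 * exp \<bar>z\<bar>) * exp \<bar>z\<bar>"
      by (intro mult_right_mono) auto
    also have "\<dots> = 27 * exp (2 * \<bar>z\<bar>)" by (simp add: mult_exp_exp)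
    finally show ?thesis .
  qed
  then show "AE z in std_normal. norm (\<bar>z\<bar> ^ 3 * exp \<bar>z\<bar>) \<le> norm (27 * exp (2 * \<bar>z\<bar>))"
    by (intro always_eventually allI) auto
qed measurable

text \<open>The numerator collects the third order errors of the original summand and of the Gaussian one
that replaces it. The denominator passes from an error relative to \<open>gauss_logistic t w\<close> to one
relative to \<open>gauss_logistic (t + v) w\<close>.\<close>

definition lindeberg_const :: real where
  "lindeberg_const = ((1 / 2 + (\<integral>z. \<bar>z\<bar> ^ 3 * exp \<bar>z\<bar> \<partial>std_normal) / 6)) / (\<integral>z. exp (- \<bar>z\<bar>) \<partial>std_normal)"

lemma integrable_std_normal_exp_neg_abs: "integrable std_normal (\<lambda>z. exp (- \<bar>z\<bar>))"
  using integrable_std_normal_exp_abs[of "-1"] by simp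

lemma std_normal_exp_neg_abs_pos: "0 < (\<integral>z. exp (- \<bar>z\<bar>) \<partial>std_normal)"
proof -
  have "(\<integral>z. exp (- \<bar>z\<bar>) \<partial>std_normal) \<noteq> 0"
  proof (subst integral_nonneg_eq_0_iff_AE)
    have "\<not> (AE z in std_normal. False)" using std_normal.AE_False by simp
    then show "\<not> (AE z in std_normal. exp (- \<bar>z\<bar>) = 0)" by simp
  qed (auto intro: integrable_std_normal_exp_neg_abs)
  moreover have "0 \<le> (\<integral>z. exp (- \<bar>z\<bar>) \<partial>std_normal)" by (intro integral_nonneg_AE) auto
  ultimately show ?thesis by (simp only: less_le) simp
qed

lemma lindeberg_const_pos: "0 < lindeberg_const"
  unfolding lindeberg_const_def using std_normal_exp_neg_abs_pos
  by (intro divide_pos_pos add_pos_nonneg) (auto intro!: integral_nonneg_AE)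

lemma std_normal_moments:
  "integrable std_normal (\<lambda>z. z)" "(\<integral>z. z \<partial>std_normal) = 0"
  "integrable std_normal (\<lambda>z. z\<^sup>2)" "(\<integral>z. z\<^sup>2 \<partial>std_normal) = 1"
  using std_normal_moment_odd[of 0] std_normal_moment_even[of 1]
  by (auto simp: integrable_density integral_density has_bochner_integral_iff)

text \<open>Both the summand and a Gaussian variable of the same variance produce the same second order
expansion around \<open>w\<close>, so their difference is of third order, and the expansion is
relative to the value at \<open>w\<close>.\<close>

lemma (in prob_space) lindeberg_step:
  assumes [measurable]: "X \<in> borel_measurable M" and X: "AE \<omega> in M. \<bar>X \<omega>\<bar> \<le> b" and b0: "0 \<le> b" and b: "b \<le> 1"
    and mean: "expectation X = 0" and var: "expectation (\<lambda>\<omega>. (X \<omega>)\<^sup>2) = v" and t: "0 \<le> t"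
  shows "\<bar>expectation (\<lambda>\<omega>. gauss_logistic t (w + X \<omega>)) - gauss_logistic (t + v) w\<bar>
     \<le> lindeberg_const * b ^ 3 * gauss_logistic (t + v) w"
proof -
  define G where "G = gauss_logistic t w"
  have G: "0 < G" unfolding G_def by (rule gauss_logistic_pos)
  obtain a c where T: "\<And>h. \<bar>gauss_logistic t (w + h) - (G + a * h + c * h\<^sup>2)\<bar>
     \<le> \<bar>h\<bar> ^ 3 * exp \<bar>h\<bar> / 6 * G" using gauss_logistic_Taylor unfolding G_def by blast
  have v0: "0 \<le> v" unfolding var[symmetric] by (intro integral_nonneg_AE) auto
  have X2: "AE \<omega> in M. (X \<omega>)\<^sup>2 \<le> b\<^sup>2"
    using X by eventually_elim (use b0 in \<open>auto simp: abs_le_square_iff[symmetric]\<close>)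
  have int: "integrable M X" "integrable M (\<lambda>\<omega>. (X \<omega>)\<^sup>2)"
    using X X2 by (auto intro!: integrable_const_bound)
  have vb: "v \<le> b\<^sup>2"
    unfolding var[symmetric] using X2 by (intro integral_le_const int) auto
  have GB: "\<bar>gauss_logistic t u\<bar> \<le> 1" for u
    using gauss_logistic_pos[of t u] gauss_logistic_less_1[of t u] by simp
  have intG: "integrable M (\<lambda>\<omega>. gauss_logistic t (w + X \<omega>))"
    using GB by (auto intro!: integrable_const_bound[where B=1])
  \<comment> \<open>The summand itself: the linear term has mean zero, the quadratic one gives \<open>c v\<close>.\<close>
  have 1: "\<bar>expectation (\<lambda>\<omega>. gauss_logistic t (w + X \<omega>)) - (G + c * v)\<bar> \<le> b ^ 3 / 2 * G"
  proof -
    have "has_bochner_integral M (\<lambda>\<omega>. gauss_logistic t (w + X \<omega>) - (G + a * X \<omega> + c * (X \<omega>)\<^sup>2))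
       (expectation (\<lambda>\<omega>. gauss_logistic t (w + X \<omega>)) - (expectation (\<lambda>_. G) + a * expectation X
          + c * expectation (\<lambda>\<omega>. (X \<omega>)\<^sup>2)))"
      by (intro has_bochner_integral_diff has_bochner_integral_add
          has_bochner_integral_mult_right has_bochner_integral_integrable int intG integrable_const)
    from has_bochner_integral_integral_eq[OF this]
    have "expectation (\<lambda>\<omega>. gauss_logistic t (w + X \<omega>)) - (G + c * v)
       = expectation (\<lambda>\<omega>. gauss_logistic t (w + X \<omega>) - (G + a * X \<omega> + c * (X \<omega>)\<^sup>2))"
      unfolding mean var lebesgue_integral_const prob_space real_scaleR_def by linarith
    also have "\<bar>\<dots>\<bar> \<le> expectation (\<lambda>\<omega>. \<bar>gauss_logistic t (w + X \<omega>) - (G + a * X \<omega> + c * (X \<omega>)\<^sup>2)\<bar>)"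
      by (rule integral_abs_bound)
    also have "\<dots> \<le> b ^ 3 / 2 * G"
    proof (rule integral_le_const)
      show "integrable M (\<lambda>\<omega>. \<bar>gauss_logistic t (w + X \<omega>) - (G + a * X \<omega> + c * (X \<omega>)\<^sup>2)\<bar>)"
        by (intro integrable_abs Bochner_Integration.integrable_diff Bochner_Integration.integrable_add
           integrable_mult_right int intG integrable_const)
      show "AE \<omega> in M. \<bar>gauss_logistic t (w + X \<omega>) - (G + a * X \<omega> + c * (X \<omega>)\<^sup>2)\<bar> \<le> b ^ 3 / 2 * G"
        using X
      proof eventually_elim
        case (elim \<omega>)
        have "exp \<bar>X \<omega>\<bar> \<le> exp 1" using elim b by simp
        also have "\<dots> \<le> 3" using exp_le by simp
        finally have "\<bar>X \<omega>\<bar> ^ 3 * exp \<bar>X \<omega>\<bar> \<le> b ^ 3 * 3"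
          using elim b0 by (intro mult_mono power_mono) auto
        then have "\<bar>X \<omega>\<bar> ^ 3 * exp \<bar>X \<omega>\<bar> / 6 * G \<le> b ^ 3 * 3 / 6 * G"
          using G by (intro mult_right_mono divide_right_mono) auto
        also have "b ^ 3 * 3 / 6 * G = b ^ 3 / 2 * G" by simp
        finally show ?case using T[of "X \<omega>"] by (rule order_trans[rotated])
      qed
    qed
    finally show ?thesis .
  qed
  define C0 where "C0 = (\<integral>z. \<bar>z\<bar> ^ 3 * exp \<bar>z\<bar> \<partial>std_normal)"
  define c0 where "c0 = (\<integral>z. exp (- \<bar>z\<bar>) \<partial>std_normal)"
  have c0: "0 < c0" unfolding c0_def by (rule std_normal_exp_neg_abs_pos)
  define s where "s = sqrt v"
  have s: "0 \<le> s" "s \<le> b" "s\<^sup>2 = v" using v0 vb b0 by (auto simp: s_def real_le_lsqrt)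
  have intG': "integrable std_normal (\<lambda>z. gauss_logistic t (w + s * z))"
    using GB by (intro std_normal.integrable_const_bound[where B=1]) auto
  have conv: "gauss_logistic (t + v) w = (\<integral>z. gauss_logistic t (w + s * z) \<partial>std_normal)"
    unfolding s_def using t v0 by (rule gauss_logistic_convolution)
  \<comment> \<open>The Gaussian replacement \<open>s z\<close> with \<open>s\<^sup>2 = v\<close> has the same second order expansion.\<close>
  have 2: "\<bar>gauss_logistic (t + v) w - (G + c * v)\<bar> \<le> b ^ 3 * C0 / 6 * G"
  proof -
    have hb: "has_bochner_integral std_normal
        (\<lambda>z. gauss_logistic t (w + s * z) - (G + (a * s) * z + (c * s\<^sup>2) * z\<^sup>2))
        ((\<integral>z. gauss_logistic t (w + s * z) \<partial>std_normal) - ((\<integral>z. G \<partial>std_normal) + (a * s) * (\<integral>z. z \<partial>std_normal)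
           + (c * s\<^sup>2) * (\<integral>z. z\<^sup>2 \<partial>std_normal)))"
      by (intro has_bochner_integral_diff has_bochner_integral_add has_bochner_integral_mult_right
          has_bochner_integral_integrable std_normal_moments(1,3) intG' std_normal.integrable_const)
    from has_bochner_integral_integral_eq[OF hb]
    have eq: "gauss_logistic (t + v) w - (G + c * v)
       = (\<integral>z. gauss_logistic t (w + s * z) - (G + (a * s) * z + (c * s\<^sup>2) * z\<^sup>2) \<partial>std_normal)"
      unfolding conv std_normal_moments s(3) lebesgue_integral_const std_normal.prob_space real_scaleR_def by linarith
    have "\<bar>gauss_logistic (t + v) w - (G + c * v)\<bar>
       \<le> (\<integral>z. \<bar>gauss_logistic t (w + s * z) - (G + (a * s) * z + (c * s\<^sup>2) * z\<^sup>2)\<bar> \<partial>std_normal)"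
      unfolding eq by (rule integral_abs_bound)
    also have "\<dots> \<le> (\<integral>z. b ^ 3 * (\<bar>z\<bar> ^ 3 * exp \<bar>z\<bar>) / 6 * G \<partial>std_normal)"
    proof (rule integral_mono)
      show "integrable std_normal (\<lambda>z. \<bar>gauss_logistic t (w + s * z) - (G + (a * s) * z + (c * s\<^sup>2) * z\<^sup>2)\<bar>)"
        by (intro integrable_abs integrable.intros[OF hb])
      show "integrable std_normal (\<lambda>z. b ^ 3 * (\<bar>z\<bar> ^ 3 * exp \<bar>z\<bar>) / 6 * G)"
        by (intro integrable_mult_left integrable_divide_zero integrable_mult_right integrable_std_normal_cube_exp)
      fix z :: real
      have "exp \<bar>s * z\<bar> \<le> exp \<bar>z\<bar>" using s b by (simp add: abs_mult mult_left_le_one_le)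
      moreover have "\<bar>s * z\<bar> ^ 3 \<le> b ^ 3 * \<bar>z\<bar> ^ 3"
        unfolding abs_mult power_mult_distrib using s by (intro mult_right_mono power_mono) auto
      ultimately have "\<bar>s * z\<bar> ^ 3 * exp \<bar>s * z\<bar> \<le> (b ^ 3 * \<bar>z\<bar> ^ 3) * exp \<bar>z\<bar>"
        using b0 by (intro mult_mono) auto
      then have "\<bar>s * z\<bar> ^ 3 * exp \<bar>s * z\<bar> / 6 * G \<le> (b ^ 3 * \<bar>z\<bar> ^ 3) * exp \<bar>z\<bar> / 6 * G"
        using G by (intro mult_right_mono divide_right_mono) auto
      then show "\<bar>gauss_logistic t (w + s * z) - (G + (a * s) * z + (c * s\<^sup>2) * z\<^sup>2)\<bar>
          \<le> b ^ 3 * (\<bar>z\<bar> ^ 3 * exp \<bar>z\<bar>) / 6 * G"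
        using T[of "s * z"] by (simp add: power_mult_distrib mult_ac)
    qed
    also have "\<dots> = b ^ 3 * C0 / 6 * G" by (simp add: C0_def)
    finally show ?thesis .
  qed
  \<comment> \<open>Comparability of \<open>G\<close> with the value after the replacement, so that the error is relative to the latter.\<close>
  have 3: "c0 * G \<le> gauss_logistic (t + v) w"
  proof -
    have "c0 * G = (\<integral>z. exp (- \<bar>z\<bar>) * G \<partial>std_normal)" by (simp add: c0_def)
    also have "\<dots> \<le> (\<integral>z. gauss_logistic t (w + s * z) \<partial>std_normal)"
    proof (intro integral_mono integrable_mult_left integrable_std_normal_exp_neg_abs intG')
      fix z
      have "G \<le> exp \<bar>- (s * z)\<bar> * gauss_logistic t (w + s * z)"
        using gauss_logistic_add_le[of t "w + s * z" "- (s * z)"] by (simp add: G_def)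
      also have "\<dots> \<le> exp \<bar>z\<bar> * gauss_logistic t (w + s * z)"
        using gauss_logistic_pos[of t "w + s * z"] s b
        by (intro mult_right_mono) (auto simp: abs_mult mult_left_le_one_le)
      finally show "exp (- \<bar>z\<bar>) * G \<le> gauss_logistic t (w + s * z)"
        by (simp add: exp_minus field_simps)
    qed
    finally show ?thesis by (simp add: conv)
  qed
  have C: "0 \<le> 1/2 + C0/6" unfolding C0_def by (intro add_nonneg_nonneg divide_nonneg_nonneg integral_nonneg_AE) auto
  have "\<bar>expectation (\<lambda>\<omega>. gauss_logistic t (w + X \<omega>)) - gauss_logistic (t + v) w\<bar> \<le> b ^ 3 * (1/2 + C0/6) * G"
  proof -
    have "\<bar>x - z\<bar> \<le> p + q" if "\<bar>x - y\<bar> \<le> p" "\<bar>z - y\<bar> \<le> q" for x y z p q :: real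
      using that by linarith
    from this[OF 1 2] show ?thesis by (simp add: algebra_simps)
  qed
  also have "\<dots> \<le> b ^ 3 * (1/2 + C0/6) * (gauss_logistic (t + v) w / c0)"
    using 3 c0 b0 C by (intro mult_left_mono mult_nonneg_nonneg) (auto simp: field_simps)
  also have "\<dots> = lindeberg_const * b ^ 3 * gauss_logistic (t + v) w"
    by (simp add: lindeberg_const_def C0_def c0_def)
  finally show ?thesis .
qed

section \<open>Moderate deviations of sums of bounded variables\<close>

text \<open>The relative errors of the single steps multiply. Conditioning on the remaining summands reduces the
step to a deterministic starting point.\<close>

lemma (in prob_space) lindeberg_sum:
  assumes "finite I" and "indep_vars (\<lambda>_. borel) X I"
    and bound: "\<And>i. i \<in> I \<Longrightarrow> AE \<omega> in M. \<bar>X i \<omega>\<bar> \<le> b" and b: "0 \<le> b" "b \<le> 1"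
    and small: "lindeberg_const * b ^ 3 \<le> 1"
    and mean: "\<And>i. i \<in> I \<Longrightarrow> expectation (X i) = 0"
    and var: "\<And>i. i \<in> I \<Longrightarrow> expectation (\<lambda>\<omega>. (X i \<omega>)\<^sup>2) = v i"
    and t: "0 \<le> t"
  shows "(1 - lindeberg_const * b ^ 3) ^ card I * gauss_logistic (t + sum v I) w
          \<le> expectation (\<lambda>\<omega>. gauss_logistic t (w + (\<Sum>i\<in>I. X i \<omega>)))"
    and "expectation (\<lambda>\<omega>. gauss_logistic t (w + (\<Sum>i\<in>I. X i \<omega>)))
          \<le> (1 + lindeberg_const * b ^ 3) ^ card I * gauss_logistic (t + sum v I) w"
proof -
  let ?\<delta> = "lindeberg_const * b ^ 3"
  have d: "0 \<le> ?\<delta>" "0 \<le> 1 - ?\<delta>" using lindeberg_const_pos b small by auto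
  have "(1 - ?\<delta>) ^ card I * gauss_logistic (t + sum v I) w
          \<le> expectation (\<lambda>\<omega>. gauss_logistic t (w + (\<Sum>i\<in>I. X i \<omega>))) \<and>
      expectation (\<lambda>\<omega>. gauss_logistic t (w + (\<Sum>i\<in>I. X i \<omega>)))
          \<le> (1 + ?\<delta>) ^ card I * gauss_logistic (t + sum v I) w"
    using assms(1,2) bound mean var t
  proof (induction I arbitrary: t rule: finite_induct)
    case empty
    then show ?case by (simp add: prob_space)
  next
    case (insert i I)
    define S where "S \<omega> = (\<Sum>i\<in>I. X i \<omega>)" for \<omega>
    have rv [measurable]: "X j \<in> borel_measurable M" if "j \<in> insert i I" for j
      using insert.prems(1) that by (auto simp: indep_vars_def2)
    have [measurable]: "S \<in> borel_measurable M" unfolding S_def[abs_def] by measurable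
    have ind: "indep_var borel (X i) borel S"
      unfolding S_def[abs_def] using insert by (intro indep_vars_sum) auto
    interpret P: prob_space "distr M borel (X i)" by (intro prob_space_distr) simp
    interpret Q: prob_space "distr M borel S" by (intro prob_space_distr) simp
    interpret PQ: pair_prob_space "distr M borel (X i)" "distr M borel S" ..
    have GB: "\<bar>gauss_logistic t u\<bar> \<le> 1" for t u
      using gauss_logistic_pos[of t u] gauss_logistic_less_1[of t u] by simp
    have eq: "expectation (\<lambda>\<omega>. gauss_logistic t (w + (\<Sum>i\<in>insert i I. X i \<omega>)))
       = expectation (\<lambda>\<omega>. expectation (\<lambda>\<omega>'. gauss_logistic t ((w + S \<omega>) + X i \<omega>')))"
    proof -
      have "expectation (\<lambda>\<omega>. gauss_logistic t (w + (\<Sum>i\<in>insert i I. X i \<omega>)))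
          = expectation (\<lambda>\<omega>. gauss_logistic t ((w + S \<omega>) + X i \<omega>))"
        using insert.hyps by (simp add: S_def add_ac)
      also have "\<dots> = (\<integral>(x, s). gauss_logistic t ((w + s) + x) \<partial>distr M (borel \<Otimes>\<^sub>M borel) (\<lambda>\<omega>. (X i \<omega>, S \<omega>)))"
        by (subst integral_distr) auto
      also have "distr M (borel \<Otimes>\<^sub>M borel) (\<lambda>\<omega>. (X i \<omega>, S \<omega>)) = distr M borel (X i) \<Otimes>\<^sub>M distr M borel S"
        using ind by (simp add: indep_var_distribution_eq)
      also have "(\<integral>(x, s). gauss_logistic t ((w + s) + x) \<partial>(distr M borel (X i) \<Otimes>\<^sub>M distr M borel S))
         = (\<integral>s. \<integral>x. gauss_logistic t ((w + s) + x) \<partial>distr M borel (X i) \<partial>distr M borel S)"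
        using GB by (subst PQ.integral_snd) (auto intro!: PQ.integrable_const_bound[where B=1])
      also have "\<dots> = (\<integral>s. expectation (\<lambda>\<omega>'. gauss_logistic t ((w + s) + X i \<omega>')) \<partial>distr M borel S)"
        by (intro Bochner_Integration.integral_cong) (auto simp: integral_distr)
      also have "\<dots> = expectation (\<lambda>\<omega>. expectation (\<lambda>\<omega>'. gauss_logistic t ((w + S \<omega>) + X i \<omega>')))"
        by (subst integral_distr) auto
      finally show ?thesis .
    qed
    have step: "\<bar>expectation (\<lambda>\<omega>'. gauss_logistic t (u + X i \<omega>')) - gauss_logistic (t + v i) u\<bar>
        \<le> ?\<delta> * gauss_logistic (t + v i) u" for u
      using insert.prems b by (intro lindeberg_step) auto
    have IH: "(1 - ?\<delta>) ^ card I * gauss_logistic (t + v i + sum v I) w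
          \<le> expectation (\<lambda>\<omega>. gauss_logistic (t + v i) (w + S \<omega>)) \<and>
        expectation (\<lambda>\<omega>. gauss_logistic (t + v i) (w + S \<omega>))
          \<le> (1 + ?\<delta>) ^ card I * gauss_logistic (t + v i + sum v I) w"
      unfolding S_def
    proof (rule insert.IH)
      show "indep_vars (\<lambda>_. borel) X I" using insert.prems(1) by (rule indep_vars_subset) auto
      have "0 \<le> v i" using insert.prems(4)[of i] by (metis insertI1 integral_nonneg_AE always_eventually zero_le_power2)
      then show "0 \<le> t + v i" using insert.prems(5) by simp
    qed (use insert.prems in auto)
    have int1: "integrable M (\<lambda>\<omega>. gauss_logistic (t + v i) (w + S \<omega>))"
      using GB by (auto intro!: integrable_const_bound[where B=1])
    have int2: "integrable M (\<lambda>\<omega>. expectation (\<lambda>\<omega>'. gauss_logistic t ((w + S \<omega>) + X i \<omega>')))"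
    proof (rule integrable_const_bound[where B=1])
      show "AE \<omega> in M. norm (expectation (\<lambda>\<omega>'. gauss_logistic t ((w + S \<omega>) + X i \<omega>'))) \<le> 1"
      proof (intro always_eventually allI)
        fix \<omega>
        have "\<bar>expectation (\<lambda>\<omega>'. gauss_logistic t ((w + S \<omega>) + X i \<omega>'))\<bar>
            \<le> expectation (\<lambda>\<omega>'. \<bar>gauss_logistic t ((w + S \<omega>) + X i \<omega>')\<bar>)" by (rule integral_abs_bound)
        also have "\<dots> \<le> 1" using GB
          by (intro integral_le_const integrable_const_bound[where B=1]) auto
        finally show "norm (expectation (\<lambda>\<omega>'. gauss_logistic t ((w + S \<omega>) + X i \<omega>'))) \<le> 1" by simp
      qed
    qed measurable
    have up: "expectation (\<lambda>\<omega>. expectation (\<lambda>\<omega>'. gauss_logistic t ((w + S \<omega>) + X i \<omega>')))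
        \<le> expectation (\<lambda>\<omega>. (1 + ?\<delta>) * gauss_logistic (t + v i) (w + S \<omega>))"
    proof (intro integral_mono int2 integrable_mult_right int1)
      fix \<omega> show "expectation (\<lambda>\<omega>'. gauss_logistic t ((w + S \<omega>) + X i \<omega>')) \<le> (1 + ?\<delta>) * gauss_logistic (t + v i) (w + S \<omega>)"
        using step[of "w + S \<omega>"] by (simp add: abs_le_iff algebra_simps)
    qed
    have lo: "expectation (\<lambda>\<omega>. (1 - ?\<delta>) * gauss_logistic (t + v i) (w + S \<omega>))
       \<le> expectation (\<lambda>\<omega>. expectation (\<lambda>\<omega>'. gauss_logistic t ((w + S \<omega>) + X i \<omega>')))"
    proof (intro integral_mono int2 integrable_mult_right int1)
      fix \<omega> show "(1 - ?\<delta>) * gauss_logistic (t + v i) (w + S \<omega>) \<le> expectation (\<lambda>\<omega>'. gauss_logistic t ((w + S \<omega>) + X i \<omega>'))"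
        using step[of "w + S \<omega>"] by (simp add: abs_le_iff algebra_simps)
    qed
    have c: "card (insert i I) = Suc (card I)" "t + sum v (insert i I) = t + v i + sum v I"
      using insert.hyps by auto
    have "(1 - ?\<delta>) * ((1 - ?\<delta>) ^ card I * gauss_logistic (t + v i + sum v I) w)
       \<le> (1 - ?\<delta>) * expectation (\<lambda>\<omega>. gauss_logistic (t + v i) (w + S \<omega>))"
      using IH d by (intro mult_left_mono) auto
    moreover have "(1 + ?\<delta>) * expectation (\<lambda>\<omega>. gauss_logistic (t + v i) (w + S \<omega>))
        \<le> (1 + ?\<delta>) * ((1 + ?\<delta>) ^ card I * gauss_logistic (t + v i + sum v I) w)"
      using IH d by (intro mult_left_mono) auto
    moreover note up lo
    ultimately show ?case unfolding eq c power_Suc mult.assoc integral_mult_right_zero by linarith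
  qed
  then show "(1 - ?\<delta>) ^ card I * gauss_logistic (t + sum v I) w
          \<le> expectation (\<lambda>\<omega>. gauss_logistic t (w + (\<Sum>i\<in>I. X i \<omega>)))"
      "expectation (\<lambda>\<omega>. gauss_logistic t (w + (\<Sum>i\<in>I. X i \<omega>)))
          \<le> (1 + ?\<delta>) ^ card I * gauss_logistic (t + sum v I) w" by auto
qed

lemma exponential_density_integral:
  assumes "0 < l"
  shows "has_bochner_integral lborel (exponential_density l) 1"
proof -
  have "(\<integral>\<^sup>+x. ennreal (exponential_density l x) \<partial>lborel) = ennreal 1"
    using prob_space.emeasure_space_1[OF prob_space_exponential_density[OF assms]]
    by (simp add: emeasure_density)
  then show ?thesis
    using assms by (intro has_bochner_integral_nn_integral) (auto simp: exponential_density_nonneg)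
qed

text \<open>The limit of the Gaussian average of a steep logistic function far in the tail, where the
Gaussian density on the scale \<open>1/x\<close> is the exponential density \<open>exp (- u)\<close>. For a step function
instead of the logistic one it would be \<open>exp (- \<eta>)\<close>.\<close>

definition tilted_logistic_integral :: "real \<Rightarrow> real \<Rightarrow> real" where
  "tilted_logistic_integral L \<eta> = (\<integral>u. logistic (L * (u - \<eta>)) * exp (- u) \<partial>lborel)"

lemma logistic_le_exp: "logistic u \<le> exp u"
  by (auto simp: logistic_def exp_minus field_simps add_pos_pos)

lemma one_minus_exp_le_logistic: "1 - exp (- u) \<le> logistic u"
proof -
  have "0 < 1 + exp (- u)" by (simp add: add_pos_pos)
  then show ?thesis by (simp add: logistic_def field_simps)
qed

text \<open>The logistic function of slope \<open>L\<close> lies within two exponentials of rate \<open>L\<close> of the step function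
at zero, which leaves only integrals of exponential densities.\<close>

lemma tilted_logistic_bounds:
  assumes "1 < L"
  shows "logistic (L * u) * exp (- u) \<le> exponential_density 1 u + 1 / (L - 1) * exponential_density (L - 1) (0 + (- 1) * u)"
    and "exponential_density 1 u - 1 / (L + 1) * exponential_density (L + 1) u \<le> logistic (L * u) * exp (- u)"
proof -
  show "logistic (L * u) * exp (- u) \<le> exponential_density 1 u + 1 / (L - 1) * exponential_density (L - 1) (0 + (- 1) * u)"
  proof (cases "u < 0")
    case True
    have "logistic (L * u) * exp (- u) \<le> exp (L * u) * exp (- u)"
      using logistic_le_exp by (intro mult_right_mono) auto
    also have "\<dots> = exp (- (- u * (L - 1)))" by (simp add: mult_exp_exp algebra_simps)
    also have "\<dots> = exponential_density 1 u + 1 / (L - 1) * exponential_density (L - 1) (0 + (- 1) * u)"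
      using True assms by (simp add: exponential_density_def)
    finally show ?thesis .
  next
    case False
    have "logistic (L * u) * exp (- u) \<le> 1 * exp (- u)"
      using logistic_less_1[of "L * u"] by (intro mult_right_mono) auto
    then show ?thesis using False assms logistic_less_1[of 0] by (auto simp: exponential_density_def)
  qed
  show "exponential_density 1 u - 1 / (L + 1) * exponential_density (L + 1) u \<le> logistic (L * u) * exp (- u)"
  proof (cases "u < 0")
    case True
    then show ?thesis using logistic_pos[of "L * u"] by (simp add: exponential_density_def)
  next
    case False
    have "(1 - exp (- (L * u))) * exp (- u) \<le> logistic (L * u) * exp (- u)"
      using one_minus_exp_le_logistic by (intro mult_right_mono) auto
    moreover have "(1 - exp (- (L * u))) * exp (- u) = exp (- u) - exp (- u * (L + 1))"
      by (simp add: mult_exp_exp algebra_simps)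
    ultimately show ?thesis using False assms by (simp add: exponential_density_def)
  qed
qed

lemma tilted_logistic_bounds_integrable:
  assumes "1 < L"
  shows "has_bochner_integral lborel (\<lambda>u. exponential_density 1 u + 1 / (L - 1) * exponential_density (L - 1) (0 + (- 1) * u)) (1 + 1 / (L - 1) * 1)"
    and "has_bochner_integral lborel (\<lambda>u. exponential_density 1 u - 1 / (L + 1) * exponential_density (L + 1) u) (1 - 1 / (L + 1) * 1)"
proof -
  have "has_bochner_integral lborel (\<lambda>u. exponential_density (L - 1) (0 + (- 1) * u)) (1 /\<^sub>R \<bar>- 1\<bar>)"
    using assms lborel_has_bochner_integral_real_affine_iff[of "-1" "exponential_density (L - 1)" 1 0]
      exponential_density_integral[of "L - 1"] by simp
  then show "has_bochner_integral lborel (\<lambda>u. exponential_density 1 u + 1 / (L - 1) * exponential_density (L - 1) (0 + (- 1) * u)) (1 + 1 / (L - 1) * 1)"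
    by (intro has_bochner_integral_add has_bochner_integral_mult_right exponential_density_integral) auto
  show "has_bochner_integral lborel (\<lambda>u. exponential_density 1 u - 1 / (L + 1) * exponential_density (L + 1) u) (1 - 1 / (L + 1) * 1)"
    using assms by (intro has_bochner_integral_diff has_bochner_integral_mult_right exponential_density_integral) auto
qed

lemma tilted_logistic_integrable_0:
  assumes "1 < L" shows "integrable lborel (\<lambda>u. logistic (L * u) * exp (- u))"
proof (rule Bochner_Integration.integrable_bound)
  show "integrable lborel (\<lambda>u. exponential_density 1 u + 1 / (L - 1) * exponential_density (L - 1) (0 + (- 1) * u))"
    using tilted_logistic_bounds_integrable(1)[OF assms] by (rule integrable.intros)
  show "AE u in lborel. norm (logistic (L * u) * exp (- u)) \<le> norm (exponential_density 1 u + 1 / (L - 1) * exponential_density (L - 1) (0 + (- 1) * u))"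
  proof (intro always_eventually allI)
    fix u
    have "0 < logistic (L * u) * exp (- u)" using logistic_pos by simp
    then show "norm (logistic (L * u) * exp (- u)) \<le> norm (exponential_density 1 u + 1 / (L - 1) * exponential_density (L - 1) (0 + (- 1) * u))"
      using tilted_logistic_bounds(1)[OF assms, of u] unfolding real_norm_def by linarith
  qed
qed measurable

lemma tilted_logistic_integral_0_bounds:
  assumes "1 < L"
  shows "1 - 1 / (L + 1) \<le> tilted_logistic_integral L 0" "tilted_logistic_integral L 0 \<le> 1 + 1 / (L - 1)"
proof -
  note B = tilted_logistic_bounds_integrable[OF assms]
  have "(\<integral>u. exponential_density 1 u - 1 / (L + 1) * exponential_density (L + 1) u \<partial>lborel) \<le> (\<integral>u. logistic (L * u) * exp (- u) \<partial>lborel)"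
    using tilted_logistic_bounds(2)[OF assms]
    by (intro integral_mono integrable.intros[OF B(2)] tilted_logistic_integrable_0 assms)
  then show "1 - 1 / (L + 1) \<le> tilted_logistic_integral L 0"
    unfolding has_bochner_integral_integral_eq[OF B(2)] by (simp add: tilted_logistic_integral_def)
  have "(\<integral>u. logistic (L * u) * exp (- u) \<partial>lborel) \<le> (\<integral>u. exponential_density 1 u + 1 / (L - 1) * exponential_density (L - 1) (0 + (- 1) * u) \<partial>lborel)"
    using tilted_logistic_bounds(1)[OF assms]
    by (intro integral_mono integrable.intros[OF B(1)] tilted_logistic_integrable_0 assms)
  then show "tilted_logistic_integral L 0 \<le> 1 + 1 / (L - 1)"
    unfolding has_bochner_integral_integral_eq[OF B(1)] by (simp add: tilted_logistic_integral_def)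
qed

lemma tilted_logistic_shift:
  assumes "1 < L"
  shows "integrable lborel (\<lambda>u. logistic (L * (u - \<eta>)) * exp (- u))"
    and "tilted_logistic_integral L \<eta> = exp (- \<eta>) * tilted_logistic_integral L 0"
proof -
  have eq: "(\<lambda>u. logistic (L * (u - \<eta>)) * exp (- u)) = (\<lambda>u. exp (- \<eta>) * (logistic (L * (- \<eta> + 1 * u)) * exp (- (- \<eta> + 1 * u))))"
    by (simp add: fun_eq_iff mult_exp_exp)
  have "has_bochner_integral lborel (\<lambda>u. logistic (L * (- \<eta> + 1 * u)) * exp (- (- \<eta> + 1 * u))) (tilted_logistic_integral L 0)"
    using lborel_has_bochner_integral_real_affine_iff[of 1 "\<lambda>u. logistic (L * u) * exp (- u)" "tilted_logistic_integral L 0" "- \<eta>"]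
      has_bochner_integral_integrable[OF tilted_logistic_integrable_0[OF assms]]
    by (simp add: tilted_logistic_integral_def)
  from has_bochner_integral_mult_right[OF this, of "exp (- \<eta>)"]
  have "has_bochner_integral lborel (\<lambda>u. logistic (L * (u - \<eta>)) * exp (- u)) (exp (- \<eta>) * tilted_logistic_integral L 0)"
    unfolding eq .
  then show "integrable lborel (\<lambda>u. logistic (L * (u - \<eta>)) * exp (- u))"
    "tilted_logistic_integral L \<eta> = exp (- \<eta>) * tilted_logistic_integral L 0"
    by (auto simp: has_bochner_integral_iff tilted_logistic_integral_def)
qed

text \<open>Substituting \<open>z = x + u / x\<close> turns the Gaussian density into \<open>exp (- u)\<close> times a
factor that increases to one, so dominated convergence applies. Variance and mean are those of
\<open>L x (Z - (x + \<eta> / x))\<close> with standard normal \<open>Z\<close>; as a function of \<open>Z\<close> its logistic rises from 0 to 1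
in a window of width of order \<open>1 / (L x)\<close> around the level \<open>x + \<eta> / x\<close>.\<close>

lemma gauss_logistic_asymptotics:
  fixes x :: "nat \<Rightarrow> real"
  assumes x: "filterlim x at_top sequentially" and L: "1 < L"
  shows "(\<lambda>n. x n / std_normal_density (x n) * gauss_logistic ((L * x n)\<^sup>2) (- (L * x n * (x n + \<eta> / x n))))
     \<longlonglongrightarrow> tilted_logistic_integral L \<eta>"
proof -
  have eq: "y / std_normal_density y * gauss_logistic ((L * y)\<^sup>2) (- (L * y * (y + \<eta> / y)))
     = (\<integral>u. logistic (L * (u - \<eta>)) * exp (- u) * exp (- (u\<^sup>2 / (2 * y\<^sup>2))) \<partial>lborel)" if y: "0 < y" for y
  proof -
    have "gauss_logistic ((L * y)\<^sup>2) (- (L * y * (y + \<eta> / y)))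
       = (\<integral>z. std_normal_density z * logistic (- (L * y * (y + \<eta> / y)) + L * y * z) \<partial>lborel)"
      unfolding gauss_logistic_def using L y by (subst integral_density) auto
    also have "\<dots> = (1 / y) * (\<integral>u. std_normal_density (y + (1 / y) * u) * logistic (- (L * y * (y + \<eta> / y)) + L * y * (y + (1 / y) * u)) \<partial>lborel)"
      using y by (subst lborel_integral_real_affine[of "1 / y" _ y]) auto
    also have "(\<lambda>u. std_normal_density (y + (1 / y) * u) * logistic (- (L * y * (y + \<eta> / y)) + L * y * (y + (1 / y) * u)))
       = (\<lambda>u. std_normal_density y * (logistic (L * (u - \<eta>)) * exp (- u) * exp (- (u\<^sup>2 / (2 * y\<^sup>2)))))"
    proof
      fix u
      have "- (L * y * (y + \<eta> / y)) + L * y * (y + (1 / y) * u) = L * (u - \<eta>)"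
        using y by (simp add: field_simps)
      moreover have "- (y + (1 / y) * u)\<^sup>2 / 2 = - y\<^sup>2 / 2 + (- u) + - (u\<^sup>2 / (2 * y\<^sup>2))"
        using y by (simp add: field_simps power2_eq_square)
      then have "std_normal_density (y + (1 / y) * u) = std_normal_density y * exp (- u) * exp (- (u\<^sup>2 / (2 * y\<^sup>2)))"
        unfolding std_normal_density_def by (simp only: exp_add mult.assoc)
      ultimately show "std_normal_density (y + (1 / y) * u) * logistic (- (L * y * (y + \<eta> / y)) + L * y * (y + (1 / y) * u))
         = std_normal_density y * (logistic (L * (u - \<eta>)) * exp (- u) * exp (- (u\<^sup>2 / (2 * y\<^sup>2))))"
        by (simp only: mult_ac)
    qed
    finally show ?thesis using y normal_density_pos[of 1 0 y] by simp
  qed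
  have "(\<lambda>n. \<integral>u. logistic (L * (u - \<eta>)) * exp (- u) * exp (- (u\<^sup>2 / (2 * (x n)\<^sup>2))) \<partial>lborel)
     \<longlonglongrightarrow> (\<integral>u. logistic (L * (u - \<eta>)) * exp (- u) \<partial>lborel)"
  proof (rule integral_dominated_convergence)
    show "integrable lborel (\<lambda>u. logistic (L * (u - \<eta>)) * exp (- u))" using L by (rule tilted_logistic_shift)
    show "AE u in lborel. (\<lambda>n. logistic (L * (u - \<eta>)) * exp (- u) * exp (- (u\<^sup>2 / (2 * (x n)\<^sup>2)))) \<longlonglongrightarrow> logistic (L * (u - \<eta>)) * exp (- u)"
    proof (intro always_eventually allI)
      fix u
      have "((\<lambda>y. exp (- (u\<^sup>2 / (2 * y\<^sup>2)))) \<longlongrightarrow> 1) at_top" for u :: real by real_asymp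
      from filterlim_compose[OF this x] have "(\<lambda>n. exp (- (u\<^sup>2 / (2 * (x n)\<^sup>2)))) \<longlonglongrightarrow> 1" .
      from tendsto_mult[OF tendsto_const this]
      show "(\<lambda>n. logistic (L * (u - \<eta>)) * exp (- u) * exp (- (u\<^sup>2 / (2 * (x n)\<^sup>2)))) \<longlonglongrightarrow> logistic (L * (u - \<eta>)) * exp (- u)"
        by simp
    qed
    fix n
    show "AE u in lborel. norm (logistic (L * (u - \<eta>)) * exp (- u) * exp (- (u\<^sup>2 / (2 * (x n)\<^sup>2)))) \<le> logistic (L * (u - \<eta>)) * exp (- u)"
    proof (intro always_eventually allI)
      fix u
      have "0 < logistic (L * (u - \<eta>)) * exp (- u)" using logistic_pos by simp
      moreover have "exp (- (u\<^sup>2 / (2 * (x n)\<^sup>2))) \<le> 1" by simp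
      ultimately show "norm (logistic (L * (u - \<eta>)) * exp (- u) * exp (- (u\<^sup>2 / (2 * (x n)\<^sup>2)))) \<le> logistic (L * (u - \<eta>)) * exp (- u)"
        unfolding norm_mult[of "logistic (L * (u - \<eta>)) * exp (- u)"] by (simp add: mult_left_le)
    qed
  qed measurable
  then show ?thesis
    unfolding tilted_logistic_integral_def
  proof (rule Lim_transform_eventually)
    show "\<forall>\<^sub>F n in sequentially. (\<integral>u. logistic (L * (u - \<eta>)) * exp (- u) * exp (- (u\<^sup>2 / (2 * (x n)\<^sup>2))) \<partial>lborel)
      = x n / std_normal_density (x n) * gauss_logistic ((L * x n)\<^sup>2) (- (L * x n * (x n + \<eta> / x n)))"
      using x[unfolded filterlim_at_top_dense, rule_format, of 0]
      by eventually_elim (use eq in simp)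
  qed
qed

lemma gauss_logistic_0: "gauss_logistic 0 w = logistic w"
  using std_normal.prob_space by (simp add: gauss_logistic_def)

lemma ge_indicator_le_logistic:
  assumes "0 \<le> u" shows "1 \<le> (1 + exp (- c)) * logistic (u + c)"
proof -
  have "exp (- (u + c)) \<le> exp (- c)" using assms by simp
  moreover have "0 < 1 + exp (- (u + c))" by (simp add: add_pos_pos)
  ultimately show ?thesis by (simp add: logistic_def field_simps)
qed

text \<open>The left tail of a logistic function is controlled by a small multiple of a logistic function of
half the slope. A bound by a constant would be useless, since the events of interest have
vanishing probability.\<close>

lemma logistic_neg_le:
  assumes "0 \<le> c" "u < 0" shows "logistic (u - c) \<le> 2 * exp (- c / 2) * logistic ((u - c) / 2)"
proof -
  let ?z = "(u - c) / 2"
  have "logistic (u - c) \<le> exp ?z * exp ?z" using logistic_le_exp[of "u - c"] by (simp add: mult_exp_exp)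
  also have "\<dots> \<le> exp (- c / 2) * (2 * logistic ?z)"
  proof (intro mult_mono)
    have "exp ?z \<le> 1" using assms by simp
    then have "exp ?z * (1 + exp (- ?z)) \<le> 2" by (simp add: distrib_left mult_exp_exp del: minus_diff_eq)
    moreover have "0 < 1 + exp (- ?z)" by (simp add: add_pos_pos)
    ultimately show "exp ?z \<le> 2 * logistic ?z" by (simp add: logistic_def pos_le_divide_eq del: minus_diff_eq)
  qed (use assms in auto)
  finally show ?thesis by simp
qed

text \<open>The indicator of a tail event is caught between expectations of shifted logistic functions. In the
lower bound the part of the logistic function that leaks to the left is subtracted by
\<open>logistic_neg_le\<close>.\<close>

lemma (in prob_space) tail_logistic_sandwich:
  assumes [measurable]: "W \<in> borel_measurable M" and "0 \<le> c" and k: "0 < k"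
  shows "prob {\<omega>\<in>space M. y \<le> W \<omega>} \<le> (1 + exp (- c)) * expectation (\<lambda>\<omega>. logistic (k * (W \<omega> - y) + c))"
    and "expectation (\<lambda>\<omega>. logistic (k * (W \<omega> - y) - c))
           - 2 * exp (- c / 2) * expectation (\<lambda>\<omega>. logistic ((k * (W \<omega> - y) - c) / 2))
         \<le> prob {\<omega>\<in>space M. y \<le> W \<omega>}"
proof -
  let ?A = "{\<omega>\<in>space M. y \<le> W \<omega>}"
  have P: "prob ?A = expectation (indicator ?A)" by simp
  have i: "integrable M (indicator ?A :: _ \<Rightarrow> real)" by (simp add: less_top[symmetric])
  note I = logistic_integrable(1)[OF finite_measure_axioms]
  show "prob ?A \<le> (1 + exp (- c)) * expectation (\<lambda>\<omega>. logistic (k * (W \<omega> - y) + c))"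
    unfolding P integral_mult_right_zero[symmetric]
  proof (intro integral_mono i integrable_mult_right I)
    fix \<omega> assume "\<omega> \<in> space M"
    show "indicator ?A \<omega> \<le> (1 + exp (- c)) * logistic (k * (W \<omega> - y) + c)"
    proof (cases "\<omega> \<in> ?A")
      case True
      then show ?thesis using ge_indicator_le_logistic[of "k * (W \<omega> - y)" c] k by simp
    next
      case False
      then show ?thesis using logistic_pos[of "k * (W \<omega> - y) + c"] by (simp add: add_nonneg_nonneg)
    qed
  qed measurable
  have "expectation (\<lambda>\<omega>. logistic (k * (W \<omega> - y) - c) - 2 * exp (- c / 2) * logistic ((k * (W \<omega> - y) - c) / 2)) \<le> prob ?A"
    unfolding P
  proof (intro integral_mono i integrable_mult_right I Bochner_Integration.integrable_diff)
    fix \<omega> assume "\<omega> \<in> space M"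
    let ?u = "k * (W \<omega> - y)"
    show "logistic (?u - c) - 2 * exp (- c / 2) * logistic ((?u - c) / 2) \<le> indicator ?A \<omega>"
    proof (cases "\<omega> \<in> ?A")
      case True
      have "0 \<le> 2 * exp (- c / 2) * logistic ((?u - c) / 2)" using logistic_pos[of "(?u - c) / 2"] by simp
      then show ?thesis using True logistic_less_1[of "?u - c"] by simp
    next
      case False
      then have "?u < 0" using k \<open>\<omega> \<in> space M\<close> by (simp add: mult_pos_neg)
      then show ?thesis using logistic_neg_le[of c ?u] assms False by simp
    qed
  qed measurable
  then show "expectation (\<lambda>\<omega>. logistic (k * (W \<omega> - y) - c))
           - 2 * exp (- c / 2) * expectation (\<lambda>\<omega>. logistic ((k * (W \<omega> - y) - c) / 2)) \<le> prob ?A"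
    by (subst (asm) Bochner_Integration.integral_diff;
       (intro integrable_mult_right I)?; measurable?)
qed

text \<open>For a fixed slope factor \<open>L\<close> the Lindeberg argument transfers the Gaussian asymptotics to the sum,
because \<open>card I\<close> relative errors of order \<open>(x b)\<^sup>3\<close> still add up to a vanishing one. The sandwich
between logistic functions is then closed by letting \<open>L\<close> grow.\<close>

theorem moderate_deviation:
  fixes M :: "nat \<Rightarrow> 'a measure" and I :: "nat \<Rightarrow> 'b set" and X :: "nat \<Rightarrow> 'b \<Rightarrow> 'a \<Rightarrow> real"
    and b x :: "nat \<Rightarrow> real"
  assumes ps: "\<And>n. prob_space (M n)" and fin: "\<And>n. finite (I n)"
    and ind: "\<And>n. prob_space.indep_vars (M n) (\<lambda>_. borel) (X n) (I n)"
    and bound: "\<And>n i. i \<in> I n \<Longrightarrow> AE \<omega> in M n. \<bar>X n i \<omega>\<bar> \<le> b n" and b: "\<And>n. 0 \<le> b n"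
    and mean: "\<And>n i. i \<in> I n \<Longrightarrow> (\<integral>\<omega>. X n i \<omega> \<partial>M n) = 0"
    and var: "\<forall>\<^sub>F n in sequentially. (\<Sum>i\<in>I n. \<integral>\<omega>. (X n i \<omega>)\<^sup>2 \<partial>M n) = 1"
    and x: "filterlim x at_top sequentially"
    and rate: "(\<lambda>n. real (card (I n)) * (x n * b n) ^ 3) \<longlonglongrightarrow> 0"
  shows "(\<lambda>n. x n / std_normal_density (x n) *
      measure (M n) {\<omega>\<in>space (M n). x n + \<eta> / x n \<le> (\<Sum>i\<in>I n. X n i \<omega>)}) \<longlonglongrightarrow> exp (- \<eta>)"
proof -
  define W where "W n \<omega> = (\<Sum>i\<in>I n. X n i \<omega>)" for n \<omega>
  have Xm: "X n i \<in> borel_measurable (M n)" if "i \<in> I n" for n i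
    using ind[of n] that ps[of n] by (simp add: prob_space.indep_vars_def2)
  have Wm: "W n \<in> borel_measurable (M n)" for n
    unfolding W_def[abs_def] using Xm by (intro borel_measurable_sum)
  have xpos: "\<forall>\<^sub>F n in sequentially. 0 < x n"
    using x by (simp add: filterlim_at_top_dense)
  define E where "E L \<eta> n = (\<integral>\<omega>. logistic (L * x n * (W n \<omega> - (x n + \<eta> / x n))) \<partial>M n)" for L \<eta> n
  have main: "(\<lambda>n. x n / std_normal_density (x n) * E L \<eta> n) \<longlonglongrightarrow> tilted_logistic_integral L \<eta>"
    if L: "1 < L" for L \<eta>
  proof -
    define \<delta> where "\<delta> n = lindeberg_const * (L * x n * b n) ^ 3" for n
    define G where "G n = x n / std_normal_density (x n) * gauss_logistic ((L * x n)\<^sup>2) (- (L * x n * (x n + \<eta> / x n)))" for n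
    have G: "G \<longlonglongrightarrow> tilted_logistic_integral L \<eta>"
      unfolding G_def[abs_def] using x L by (rule gauss_logistic_asymptotics)
    have cd: "(\<lambda>n. real (card (I n)) * \<delta> n) \<longlonglongrightarrow> 0"
      using tendsto_mult[OF tendsto_const[of "lindeberg_const * L ^ 3"] rate]
      by (simp add: \<delta>_def power_mult_distrib mult_ac)
    have card1: "\<forall>\<^sub>F n in sequentially. 1 \<le> card (I n)"
      using var by eventually_elim (use fin in \<open>auto simp: Suc_le_eq card_gt_0_iff\<close>)
    have \<delta>0: "\<forall>\<^sub>F n in sequentially. 0 \<le> \<delta> n"
      using xpos by eventually_elim (use b L lindeberg_const_pos in \<open>simp add: \<delta>_def\<close>)
    have \<delta>lim: "\<delta> \<longlonglongrightarrow> 0"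
    proof (rule tendsto_sandwich[OF _ _ tendsto_const cd])
      show "\<forall>\<^sub>F n in sequentially. \<delta> n \<le> real (card (I n)) * \<delta> n"
        using card1 \<delta>0 by eventually_elim (simp add: mult_le_cancel_right1)
    qed (use \<delta>0 in auto)
    have small: "\<forall>\<^sub>F n in sequentially. L * x n * b n \<le> 1 \<and> \<delta> n \<le> 1"
    proof -
      have "\<forall>\<^sub>F n in sequentially. \<delta> n < min lindeberg_const 1"
        using \<delta>lim lindeberg_const_pos by (intro order_tendstoD) auto
      then show ?thesis using xpos
      proof eventually_elim
        case (elim n)
        then have "(L * x n * b n) ^ 3 \<le> 1"
          using lindeberg_const_pos by (simp add: \<delta>_def)
        then have "L * x n * b n \<le> 1" using one_less_power[of "L * x n * b n" 3] by fastforce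
        then show ?case using elim by simp
      qed
    qed
    have bounds: "\<forall>\<^sub>F n in sequentially. (1 - real (card (I n)) * \<delta> n) * G n \<le> x n / std_normal_density (x n) * E L \<eta> n \<and>
         x n / std_normal_density (x n) * E L \<eta> n \<le> exp (real (card (I n)) * \<delta> n) * G n"
      using small xpos \<delta>0 var
    proof eventually_elim
      case (elim n)
      interpret prob_space "M n" by (rule ps)
      define v where "v i = expectation (\<lambda>\<omega>. (L * x n * X n i \<omega>)\<^sup>2)" for i
      have sv: "sum v (I n) = (L * x n)\<^sup>2"
        using elim by (simp add: v_def power_mult_distrib sum_distrib_left[symmetric])
      have iv: "indep_vars (\<lambda>_. borel) (\<lambda>i \<omega>. L * x n * X n i \<omega>) (I n)"
        using indep_vars_compose2[OF ind[of n], of "\<lambda>_ y. L * x n * y" "\<lambda>_. borel"] by simp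
      have bd: "AE \<omega> in M n. \<bar>L * x n * X n i \<omega>\<bar> \<le> L * x n * b n" if "i \<in> I n" for i
        using bound[OF that] by eventually_elim (use elim L in \<open>simp add: abs_mult\<close>)
      note LS = lindeberg_sum[OF fin iv bd _ _ _ _ v_def[symmetric] order_refl,
          of "- (L * x n * (x n + \<eta> / x n))"]
      have Eeq: "E L \<eta> n = expectation (\<lambda>\<omega>. gauss_logistic 0 (- (L * x n * (x n + \<eta> / x n)) + (\<Sum>i\<in>I n. L * x n * X n i \<omega>)))"
      proof -
        have "L * x n * (W n \<omega> - (x n + \<eta> / x n)) = - (L * x n * (x n + \<eta> / x n)) + (\<Sum>i\<in>I n. L * x n * X n i \<omega>)" for \<omega>
          unfolding W_def sum_distrib_left[symmetric] by (simp only: right_diff_distrib uminus_add_conv_diff)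
        then show ?thesis unfolding E_def gauss_logistic_0 by simp
      qed
      have "(1 - \<delta> n) ^ card (I n) * gauss_logistic ((L * x n)\<^sup>2) (- (L * x n * (x n + \<eta> / x n))) \<le> E L \<eta> n"
           "E L \<eta> n \<le> (1 + \<delta> n) ^ card (I n) * gauss_logistic ((L * x n)\<^sup>2) (- (L * x n * (x n + \<eta> / x n)))"
        unfolding Eeq \<delta>_def using LS elim L b[of n] mean sv by (auto simp: \<delta>_def)
      moreover have "1 - real (card (I n)) * \<delta> n \<le> (1 - \<delta> n) ^ card (I n)"
        using Bernoulli_inequality[of "- \<delta> n" "card (I n)"] elim by simp
      moreover have "(1 + \<delta> n) ^ card (I n) \<le> exp (real (card (I n)) * \<delta> n)"
        using elim power_mono[of "1 + \<delta> n" "exp (\<delta> n)" "card (I n)"]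
        by (simp add: exp_of_nat_mult)
      moreover note gauss_logistic_pos[of "(L * x n)\<^sup>2" "- (L * x n * (x n + \<eta> / x n))"]
      ultimately have a: "(1 - real (card (I n)) * \<delta> n) * gauss_logistic ((L * x n)\<^sup>2) (- (L * x n * (x n + \<eta> / x n))) \<le> E L \<eta> n"
         "E L \<eta> n \<le> exp (real (card (I n)) * \<delta> n) * gauss_logistic ((L * x n)\<^sup>2) (- (L * x n * (x n + \<eta> / x n)))"
        by (meson mult_right_mono order_trans less_imp_le)+
      have "0 \<le> x n / std_normal_density (x n)" using elim by simp
      from mult_left_mono[OF a(1) this] mult_left_mono[OF a(2) this]
      show ?case by (simp only: G_def mult_ac)
    qed
    show ?thesis
    proof (rule tendsto_sandwich)
      show "\<forall>\<^sub>F n in sequentially. (1 - real (card (I n)) * \<delta> n) * G n \<le> x n / std_normal_density (x n) * E L \<eta> n"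
        "\<forall>\<^sub>F n in sequentially. x n / std_normal_density (x n) * E L \<eta> n \<le> exp (real (card (I n)) * \<delta> n) * G n"
        using bounds by (auto elim: eventually_mono)
      show "(\<lambda>n. (1 - real (card (I n)) * \<delta> n) * G n) \<longlonglongrightarrow> tilted_logistic_integral L \<eta>"
        using tendsto_mult[OF tendsto_diff[OF tendsto_const[of 1] cd] G] by simp
      show "(\<lambda>n. exp (real (card (I n)) * \<delta> n) * G n) \<longlonglongrightarrow> tilted_logistic_integral L \<eta>"
        using tendsto_mult[OF tendsto_exp[OF cd] G] by simp
    qed
  qed
  define P where "P n = x n / std_normal_density (x n) * measure (M n) {\<omega>\<in>space (M n). x n + \<eta> / x n \<le> W n \<omega>}" for n
  \<comment> \<open>The limits of the two sides of the sandwich for slope factor \<open>L = 1 / \<theta>\<^sup>2\<close> and a level shifted by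
     \<open>\<theta> / x\<close>. As \<open>\<theta>\<close> tends to zero, the shift becomes negligible on the scale \<open>1/x\<close>, and yet the transition
     window, of width \<open>\<theta>\<^sup>2 / x\<close>, is small compared with the shift.\<close>
  define U where "U \<theta> = (1 + exp (- (1 / \<theta>))) * (exp (\<theta> - \<eta>) * (1 + 1 / (1 / \<theta>\<^sup>2 - 1)))" for \<theta>
  define D where "D \<theta> = exp (- \<theta> - \<eta>) * (1 - 1 / (1 / \<theta>\<^sup>2 + 1) - 2 * exp (- (1 / \<theta>) / 2) * (1 + 1 / (1 / \<theta>\<^sup>2 / 2 - 1)))" for \<theta>
  have Ulim: "(U \<longlongrightarrow> exp (- \<eta>)) (at_right 0)" unfolding U_def by real_asymp
  have Dlim: "(D \<longlongrightarrow> exp (- \<eta>)) (at_right 0)" unfolding D_def by real_asymp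
  have Ub: "\<forall>\<^sub>F n in sequentially. P n < a" if \<theta>: "0 < \<theta>" "\<theta> < 1 / 2" and a: "U \<theta> < a" for \<theta> a
  proof -
    define L where "L = 1 / \<theta>\<^sup>2"
    have "\<theta>\<^sup>2 < (1 / 2)\<^sup>2" using \<theta> by (intro power_strict_mono) auto
    then have L: "4 < L" using \<theta> by (simp add: L_def field_simps power2_eq_square)
    have Lt: "L * \<theta> = 1 / \<theta>" using \<theta> by (simp add: L_def power2_eq_square)
    have le: "\<forall>\<^sub>F n in sequentially. P n \<le> (1 + exp (- (1 / \<theta>))) * (x n / std_normal_density (x n) * E L (\<eta> - \<theta>) n)"
      using xpos
    proof eventually_elim
      case (elim n)
      have eq: "L * x n * (w - (x n + \<eta> / x n)) + L * \<theta> = L * x n * (w - (x n + (\<eta> - \<theta>) / x n))" for w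
        using elim by (simp add: field_simps)
      have "measure (M n) {\<omega>\<in>space (M n). x n + \<eta> / x n \<le> W n \<omega>} \<le> (1 + exp (- (1 / \<theta>))) * E L (\<eta> - \<theta>) n"
        using prob_space.tail_logistic_sandwich(1)[OF ps Wm, of "L * \<theta>" "L * x n" n "x n + \<eta> / x n"] \<theta> elim L
        unfolding eq unfolding E_def Lt by simp
      then have "x n / std_normal_density (x n) * measure (M n) {\<omega>\<in>space (M n). x n + \<eta> / x n \<le> W n \<omega>}
         \<le> x n / std_normal_density (x n) * ((1 + exp (- (1 / \<theta>))) * E L (\<eta> - \<theta>) n)"
        using elim by (intro mult_left_mono) auto
      then show ?case by (simp only: P_def mult_ac)
    qed
    have lim: "(\<lambda>n. (1 + exp (- (1 / \<theta>))) * (x n / std_normal_density (x n) * E L (\<eta> - \<theta>) n))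
       \<longlonglongrightarrow> (1 + exp (- (1 / \<theta>))) * tilted_logistic_integral L (\<eta> - \<theta>)"
      using L by (intro tendsto_mult tendsto_const main) auto
    have "(1 + exp (- (1 / \<theta>))) * tilted_logistic_integral L (\<eta> - \<theta>) \<le> U \<theta>"
    proof -
      have "tilted_logistic_integral L (\<eta> - \<theta>) \<le> exp (\<theta> - \<eta>) * (1 + 1 / (L - 1))"
        using tilted_logistic_integral_0_bounds(2)[of L] L tilted_logistic_shift(2)[of L "\<eta> - \<theta>"]
        by (simp add: mult_left_mono)
      then show ?thesis unfolding U_def L_def[symmetric] by (intro mult_left_mono) (auto simp: add_nonneg_nonneg)
    qed
    with a have "(1 + exp (- (1 / \<theta>))) * tilted_logistic_integral L (\<eta> - \<theta>) < a" by simp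
    from order_tendstoD(2)[OF lim this] le show ?thesis by eventually_elim simp
  qed
  have Db: "\<forall>\<^sub>F n in sequentially. a < P n" if \<theta>: "0 < \<theta>" "\<theta> < 1 / 2" and a: "a < D \<theta>" for \<theta> a
  proof -
    define L where "L = 1 / \<theta>\<^sup>2"
    have "\<theta>\<^sup>2 < (1 / 2)\<^sup>2" using \<theta> by (intro power_strict_mono) auto
    then have L: "4 < L" using \<theta> by (simp add: L_def field_simps power2_eq_square)
    have Lt: "L * \<theta> = 1 / \<theta>" using \<theta> by (simp add: L_def power2_eq_square)
    let ?q = "\<lambda>n. x n / std_normal_density (x n)"
    have le: "\<forall>\<^sub>F n in sequentially. ?q n * E L (\<eta> + \<theta>) n - 2 * exp (- (1 / \<theta>) / 2) * (?q n * E (L / 2) (\<eta> + \<theta>) n) \<le> P n"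
      using xpos
    proof eventually_elim
      case (elim n)
      have eq: "L * x n * (w - (x n + \<eta> / x n)) - L * \<theta> = L * x n * (w - (x n + (\<eta> + \<theta>) / x n))" for w
        using elim by (simp add: field_simps)
      have eq2: "L * x n * w / 2 = L / 2 * x n * w" for w by simp
      have "E L (\<eta> + \<theta>) n - 2 * exp (- (1 / \<theta>) / 2) * E (L / 2) (\<eta> + \<theta>) n \<le> measure (M n) {\<omega>\<in>space (M n). x n + \<eta> / x n \<le> W n \<omega>}"
        using prob_space.tail_logistic_sandwich(2)[OF ps Wm, of "L * \<theta>" "L * x n" n "x n + \<eta> / x n"] \<theta> elim L
        unfolding eq unfolding eq2 unfolding E_def Lt by simp
      then have "?q n * (E L (\<eta> + \<theta>) n - 2 * exp (- (1 / \<theta>) / 2) * E (L / 2) (\<eta> + \<theta>) n) \<le> P n"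
        unfolding P_def using elim by (intro mult_left_mono) auto
      then show ?case by (simp only: right_diff_distrib mult_ac)
    qed
    have lim: "(\<lambda>n. ?q n * E L (\<eta> + \<theta>) n - 2 * exp (- (1 / \<theta>) / 2) * (?q n * E (L / 2) (\<eta> + \<theta>) n))
       \<longlonglongrightarrow> tilted_logistic_integral L (\<eta> + \<theta>) - 2 * exp (- (1 / \<theta>) / 2) * tilted_logistic_integral (L / 2) (\<eta> + \<theta>)"
      using L by (intro tendsto_diff tendsto_mult[OF tendsto_const] main) auto
    have "D \<theta> \<le> tilted_logistic_integral L (\<eta> + \<theta>) - 2 * exp (- (1 / \<theta>) / 2) * tilted_logistic_integral (L / 2) (\<eta> + \<theta>)"
    proof -
      have e: "exp (- (\<eta> + \<theta>)) = exp (- \<theta> - \<eta>)" by simp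
      have "1 - 1 / (L + 1) \<le> tilted_logistic_integral L 0" using L by (intro tilted_logistic_integral_0_bounds) auto
      moreover have "2 * exp (- (1 / \<theta>) / 2) * tilted_logistic_integral (L / 2) 0 \<le> 2 * exp (- (1 / \<theta>) / 2) * (1 + 1 / (L / 2 - 1))"
        using L by (intro mult_left_mono tilted_logistic_integral_0_bounds) auto
      ultimately have "1 - 1 / (L + 1) - 2 * exp (- (1 / \<theta>) / 2) * (1 + 1 / (L / 2 - 1)) \<le>
          tilted_logistic_integral L 0 - 2 * exp (- (1 / \<theta>) / 2) * tilted_logistic_integral (L / 2) 0" by linarith
      then have "D \<theta> \<le> exp (- \<theta> - \<eta>) * (tilted_logistic_integral L 0 - 2 * exp (- (1 / \<theta>) / 2) * tilted_logistic_integral (L / 2) 0)"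
        unfolding D_def L_def[symmetric] by (intro mult_left_mono) auto
      also have "\<dots> = tilted_logistic_integral L (\<eta> + \<theta>) - 2 * exp (- (1 / \<theta>) / 2) * tilted_logistic_integral (L / 2) (\<eta> + \<theta>)"
        using L tilted_logistic_shift(2)[of L "\<eta> + \<theta>"] tilted_logistic_shift(2)[of "L / 2" "\<eta> + \<theta>"]
        unfolding e by (simp only: right_diff_distrib mult_ac)
      finally show ?thesis .
    qed
    with a have "a < tilted_logistic_integral L (\<eta> + \<theta>) - 2 * exp (- (1 / \<theta>) / 2) * tilted_logistic_integral (L / 2) (\<eta> + \<theta>)" by simp
    from order_tendstoD(1)[OF lim this] le show ?thesis by eventually_elim simp
  qed
  have near: "\<forall>\<^sub>F \<theta> in at_right 0. 0 < \<theta> \<and> \<theta> < (1 / 2 :: real)"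
    by (auto simp: eventually_at_right_field intro!: exI[of _ "1/2"])
  have "P \<longlonglongrightarrow> exp (- \<eta>)"
  proof (rule order_tendstoI)
    fix a assume "a < exp (- \<eta>)"
    from eventually_conj[OF near order_tendstoD(1)[OF Dlim this]]
    obtain \<theta> where "0 < \<theta>" "\<theta> < 1 / 2" "a < D \<theta>"
      using eventually_happens'[OF trivial_limit_at_right_real] by (metis (no_types, lifting))
    then show "\<forall>\<^sub>F n in sequentially. a < P n" by (rule Db)
  next
    fix a assume "exp (- \<eta>) < a"
    from eventually_conj[OF near order_tendstoD(2)[OF Ulim this]]
    obtain \<theta> where "0 < \<theta>" "\<theta> < 1 / 2" "U \<theta> < a"
      using eventually_happens'[OF trivial_limit_at_right_real] by (metis (no_types, lifting))
    then show "\<forall>\<^sub>F n in sequentially. P n < a" by (rule Ub)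
  qed
  then show ?thesis unfolding P_def W_def .
qed

section \<open>Kendall's tau of a random permutation\<close>

text \<open>The numerator of Kendall's tau of a column against a sorted one. The recursion on the head
matches the generation of a random permutation by drawing its first entry and then
permuting the rest.\<close>

fun sgn_sum :: "nat list \<Rightarrow> real" where
  "sgn_sum [] = 0"
| "sgn_sum (y # ys) = (\<Sum>z\<leftarrow>ys. sgn (real z - real y)) + sgn_sum ys"

abbreviation uniform_perm :: "'a set \<Rightarrow> 'a list pmf" where
  "uniform_perm A \<equiv> pmf_of_set (permutations_of_set A)"

lemma bij_betw_rank_below:
  fixes A :: "nat set" assumes "finite A"
  shows "bij_betw (\<lambda>x. card {z\<in>A. z < x}) A {..<card A}"
proof -
  have "strict_mono_on A (\<lambda>x. card {z\<in>A. z < x})"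
    using assms by (intro strict_mono_onI psubset_card_mono) auto
  then have inj: "inj_on (\<lambda>x. card {z\<in>A. z < x}) A" by (rule strict_mono_on_imp_inj_on)
  have sub: "(\<lambda>x. card {z\<in>A. z < x}) ` A \<subseteq> {..<card A}"
    using assms by (auto intro!: psubset_card_mono)
  show ?thesis unfolding bij_betw_def
    using inj card_subset_eq[OF _ sub] by (simp add: card_image)
qed

lemma sum_sgn_rank:
  fixes A :: "nat set" assumes "finite A" "x \<in> A"
  shows "(\<Sum>z\<in>A - {x}. sgn (real z - real x)) = real (card A) - 1 - 2 * real (card {z\<in>A. z < x})"
proof -
  let ?L = "{z\<in>A. z < x}" and ?U = "{z\<in>A. x < z}"
  have A: "A - {x} = ?L \<union> ?U" by auto
  have "card A = Suc (card (A - {x}))" using assms by (metis card_Suc_Diff1)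
  also have "card (A - {x}) = card ?L + card ?U"
    unfolding A using assms by (intro card_Un_disjoint) auto
  finally have c: "card A = Suc (card ?L + card ?U)" .
  have "(\<Sum>z\<in>A - {x}. sgn (real z - real x)) = (\<Sum>z\<in>?L. sgn (real z - real x)) + (\<Sum>z\<in>?U. sgn (real z - real x))"
    unfolding A using assms by (intro sum.union_disjoint) auto
  also have "(\<Sum>z\<in>?L. sgn (real z - real x)) = (\<Sum>z\<in>?L. - 1)" by (intro sum.cong) auto
  also have "(\<Sum>z\<in>?U. sgn (real z - real x)) = (\<Sum>z\<in>?U. 1)" by (intro sum.cong) auto
  finally show ?thesis using c by simp
qed

text \<open>Independent entries, the \<open>i\<close>-th one uniform on the numbers below \<open>i\<close>; the value outside the index
set is a default.\<close>

abbreviation lehmer_code_pmf :: "nat \<Rightarrow> (nat \<Rightarrow> nat) pmf" where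
  "lehmer_code_pmf n \<equiv> Pi_pmf {1..n} 0 (\<lambda>i. pmf_of_set {..<i})"

text \<open>When the first of \<open>i\<close> remaining elements is drawn, its rank among them is uniform and independent of
the order of the others, and this rank alone determines the contribution of the first entry.\<close>

lemma sgn_sum_law:
  assumes "finite A"
  shows "map_pmf sgn_sum (uniform_perm A) =
    map_pmf (\<lambda>\<omega>. \<Sum>i\<in>{1..card A}. real i - 1 - 2 * real (\<omega> i)) (lehmer_code_pmf (card A))"
  using assms
proof (induction "card A" arbitrary: A)
  case 0
  then show ?case by (simp add: pmf_of_set_singleton)
next
  case (Suc m A)
  note cA = Suc.hyps(2)[symmetric]
  define r where "r x = card {z\<in>A. z < x}" for x
  define N where "N = map_pmf (\<lambda>\<omega>. \<Sum>i\<in>{1..m}. real i - 1 - 2 * real (\<omega> i)) (lehmer_code_pmf m)"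
  have ne: "A \<noteq> {}" using cA by auto
  have "map_pmf sgn_sum (uniform_perm A) =
     pmf_of_set A \<bind> (\<lambda>x. map_pmf (\<lambda>xs. sgn_sum (x # xs)) (uniform_perm (A - {x})))"
    using ne Suc.prems by (simp add: random_permutation_of_set map_bind_pmf map_pmf_def[symmetric] pmf.map_comp comp_def)
  also have "\<dots> = pmf_of_set A \<bind> (\<lambda>x. map_pmf (\<lambda>s. (real m - 2 * real (r x)) + s) N)"
  proof (intro bind_pmf_cong refl)
    fix x assume "x \<in> set_pmf (pmf_of_set A)"
    then have x: "x \<in> A" using ne Suc.prems by simp
    have "map_pmf (\<lambda>xs. sgn_sum (x # xs)) (uniform_perm (A - {x}))
       = map_pmf (\<lambda>xs. (real m - 2 * real (r x)) + sgn_sum xs) (uniform_perm (A - {x}))"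
    proof (intro map_pmf_cong refl)
      fix xs assume "xs \<in> set_pmf (uniform_perm (A - {x}))"
      then have "set xs = A - {x}" "distinct xs"
        using Suc.prems by (auto dest: permutations_of_setD)
      then have "(\<Sum>z\<leftarrow>xs. sgn (real z - real x)) = (\<Sum>z\<in>A - {x}. sgn (real z - real x))"
        by (simp add: sum_list_distinct_conv_sum_set)
      then show "sgn_sum (x # xs) = (real m - 2 * real (r x)) + sgn_sum xs"
        using sum_sgn_rank[OF Suc.prems x] cA by (simp add: r_def)
    qed
    also have "\<dots> = map_pmf (\<lambda>s. (real m - 2 * real (r x)) + s) (map_pmf sgn_sum (uniform_perm (A - {x})))"
      by (simp add: pmf.map_comp comp_def)
    also have "map_pmf sgn_sum (uniform_perm (A - {x})) = N"
      using Suc.hyps(1)[of "A - {x}"] Suc.prems x cA by (simp add: N_def)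
    finally show "map_pmf (\<lambda>xs. sgn_sum (x # xs)) (uniform_perm (A - {x})) = map_pmf (\<lambda>s. (real m - 2 * real (r x)) + s) N" .
  qed
  also have "\<dots> = map_pmf r (pmf_of_set A) \<bind> (\<lambda>k. map_pmf (\<lambda>s. (real m - 2 * real k) + s) N)"
    by (simp add: bind_map_pmf)
  also have "map_pmf r (pmf_of_set A) = pmf_of_set {..<Suc m}"
    using map_pmf_of_set_bij_betw[OF bij_betw_rank_below[OF Suc.prems] ne Suc.prems] cA by (simp add: r_def[abs_def])
  also have "pmf_of_set {..<Suc m} \<bind> (\<lambda>k. map_pmf (\<lambda>s. (real m - 2 * real k) + s) N) =
    map_pmf (\<lambda>\<omega>. \<Sum>i\<in>{1..card A}. real i - 1 - 2 * real (\<omega> i)) (lehmer_code_pmf (card A))"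
  proof -
    have ins: "{1..Suc m} = insert (Suc m) {1..m}" by auto
    have "(\<Sum>i\<in>insert (Suc m) {1..m}. real i - 1 - 2 * real ((f(Suc m := k)) i)) = (real m - 2 * real k) + (\<Sum>i\<in>{1..m}. real i - 1 - 2 * real (f i))"
      for f k
    proof -
      have "(\<Sum>i\<in>{1..m}. real i - 1 - 2 * real ((f(Suc m := k)) i)) = (\<Sum>i\<in>{1..m}. real i - 1 - 2 * real (f i))"
        by (intro sum.cong) auto
      then show ?thesis by simp
    qed
    then show ?thesis unfolding cA ins
      by (subst Pi_pmf_insert') (simp_all add: N_def map_pmf_def bind_assoc_pmf bind_return_pmf)
  qed
  finally show ?case .
qed

text \<open>The upper tail agrees with the Gaussian one as long as \<open>x\<close> is of smaller order than the sixth root of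
\<open>n\<close>. The shift \<open>\<eta> / x\<close> is the one that multiplies the Gaussian tail by \<open>exp (- \<eta>)\<close>.
Having all of these shifts available makes the property stable under perturbations of
the statistic that are small compared with \<open>1/x\<close>.\<close>

definition moderately_gaussian :: "(nat \<Rightarrow> nat list \<Rightarrow> real) \<Rightarrow> bool" where
  "moderately_gaussian s \<longleftrightarrow> (\<forall>x \<eta>. filterlim x at_top sequentially \<longrightarrow> (\<lambda>n. x n ^ 3 / sqrt (real n)) \<longlonglongrightarrow> 0 \<longrightarrow>
     (\<lambda>n. x n / std_normal_density (x n) * measure_pmf.prob (uniform_perm {1..n}) {ys. x n + \<eta> / x n \<le> s n ys}) \<longlonglongrightarrow> exp (- \<eta>))"

text \<open>The standard deviation of \<open>sgn_sum\<close> under the uniform distribution on permutations of \<open>n\<close> elements.\<close>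

definition kendall_sd :: "nat \<Rightarrow> real" where
  "kendall_sd n = sqrt (real n * (real n - 1) * (2 * real n + 5) / 18)"

lemma sum_squares_real: "(\<Sum>i=1..n. (real i)\<^sup>2) = real n * (real n + 1) * (2 * real n + 1) / 6"
  by (induction n) (auto simp: field_simps power2_eq_square)

lemma sum_lessThan_real: "(\<Sum>k<n. real k) = real n * (real n - 1) / 2"
  by (induction n) (auto simp: field_simps)

lemma sum_lessThan_squares_real: "(\<Sum>k<n. (real k)\<^sup>2) = real n * (real n - 1) * (2 * real n - 1) / 6"
  by (induction n) (auto simp: field_simps power2_eq_square)

text \<open>The terms of the Lehmer sum are of order \<open>n\<close> and the standard deviation is of order \<open>n\<close> to the
power \<open>3/2\<close>, so the standardized terms are of order \<open>1 / sqrt n\<close> and \<open>moderate_deviation\<close> covers all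
\<open>x\<close> with \<open>x\<^sup>3 / sqrt n\<close> tending to zero.
The sign \<open>e\<close> provides the lower tail.\<close>

lemma moderately_gaussian_kendall:
  assumes e: "e = 1 \<or> e = - 1"
  shows "moderately_gaussian (\<lambda>n ys. e * (sgn_sum ys / kendall_sd n))"
  unfolding moderately_gaussian_def
proof (intro allI impI)
  fix x \<eta> assume x: "filterlim x at_top sequentially" and rate: "(\<lambda>n. x n ^ 3 / sqrt (real n)) \<longlonglongrightarrow> 0"
  define X where "X n i \<omega> = e * ((real i - 1 - 2 * real (\<omega> i)) / kendall_sd n)" for n i and \<omega> :: "nat \<Rightarrow> nat"
  define P where "P n = measure_pmf (lehmer_code_pmf n)" for n
  have e2: "e\<^sup>2 = 1" "\<bar>e\<bar> = 1" using e by auto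
  have E: "(\<integral>\<omega>. f (\<omega> i) \<partial>P n) = (\<Sum>k<i. f k) / real i" if "i \<in> {1..n}" for f :: "nat \<Rightarrow> real" and i n
  proof -
    have "(\<integral>\<omega>. f (\<omega> i) \<partial>P n) = measure_pmf.expectation (map_pmf (\<lambda>\<omega>. \<omega> i) (lehmer_code_pmf n)) f"
      unfolding P_def by simp
    also have "map_pmf (\<lambda>\<omega>. \<omega> i) (lehmer_code_pmf n) = pmf_of_set {..<i}"
      using that by (subst Pi_pmf_component) auto
    also have "measure_pmf.expectation (pmf_of_set {..<i}) f = (\<Sum>k<i. f k) / real i"
      using that by (subst integral_pmf_of_set) (auto simp: lessThan_empty_iff)
    finally show ?thesis .
  qed
  have "(\<lambda>n. x n / std_normal_density (x n) *
      measure (P n) {\<omega>\<in>space (P n). x n + \<eta> / x n \<le> (\<Sum>i\<in>{1..n}. X n i \<omega>)}) \<longlonglongrightarrow> exp (- \<eta>)"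
  proof (rule moderate_deviation[where b = "\<lambda>n. real n / kendall_sd n"])
    show "prob_space (P n)" for n unfolding P_def by (rule measure_pmf.prob_space_axioms)
    show "prob_space.indep_vars (P n) (\<lambda>_. borel) (X n) {1..n}" for n
      unfolding P_def X_def[abs_def]
      using prob_space.indep_vars_compose2[OF measure_pmf.prob_space_axioms indep_vars_Pi_pmf[of "{1..n}" 0 "\<lambda>i. pmf_of_set {..<i}"],
        of "\<lambda>i k. e * ((real i - 1 - 2 * real k) / kendall_sd n)" "\<lambda>_. borel"] by simp
    show "AE \<omega> in P n. \<bar>X n i \<omega>\<bar> \<le> real n / kendall_sd n" if "i \<in> {1..n}" for n i
      unfolding P_def AE_measure_pmf_iff
    proof
      fix \<omega> assume "\<omega> \<in> set_pmf (lehmer_code_pmf n)"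
      then have "\<omega> \<in> PiE_dflt {1..n} 0 (set_pmf \<circ> (\<lambda>i. pmf_of_set {..<i}))" by (subst (asm) set_Pi_pmf) auto
      then have "\<omega> i \<in> set_pmf (pmf_of_set {..<i})" using that by (auto simp: PiE_dflt_def)
      then have "\<omega> i < i" using that by (subst (asm) set_pmf_of_set) (auto simp: lessThan_empty_iff)
      then have "\<bar>real i - 1 - 2 * real (\<omega> i)\<bar> \<le> real n" using that by auto
      moreover have "0 \<le> kendall_sd n" unfolding kendall_sd_def by (cases n) auto
      ultimately show "\<bar>X n i \<omega>\<bar> \<le> real n / kendall_sd n"
        by (simp add: X_def abs_mult e2 divide_right_mono)
    qed
    show "0 \<le> real n / kendall_sd n" for n unfolding kendall_sd_def by (cases n) auto
    show "(\<integral>\<omega>. X n i \<omega> \<partial>P n) = 0" if "i \<in> {1..n}" for n i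
    proof -
      have "(\<Sum>k<i. real i - 1 - 2 * real k) = 0"
        by (simp add: sum_subtractf sum_distrib_left[symmetric] sum_lessThan_real)
      then show ?thesis unfolding X_def
        using E[OF that, of "\<lambda>k. e * ((real i - 1 - 2 * real k) / kendall_sd n)"]
        by (simp add: sum_divide_distrib[symmetric] sum_distrib_left[symmetric])
    qed
    have v: "(\<integral>\<omega>. (X n i \<omega>)\<^sup>2 \<partial>P n) = ((real i)\<^sup>2 - 1) / 3 / (kendall_sd n)\<^sup>2" if "i \<in> {1..n}" for n i
    proof -
      have "(\<Sum>k<i. (real i - 1 - 2 * real k)\<^sup>2) = (\<Sum>k<i. (real i - 1)\<^sup>2 - 4 * (real i - 1) * real k + 4 * (real k)\<^sup>2)"
        by (intro sum.cong) (auto simp: power2_eq_square algebra_simps)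
      also have "\<dots> = real i * (real i - 1)\<^sup>2 - 4 * (real i - 1) * (real i * (real i - 1) / 2)
          + 4 * (real i * (real i - 1) * (2 * real i - 1) / 6)"
        by (simp only: sum.distrib sum_subtractf sum_distrib_left[symmetric] sum_lessThan_real sum_lessThan_squares_real) simp
      also have "\<dots> = real i * (((real i)\<^sup>2 - 1) / 3)"
        by (simp add: power2_eq_square field_simps)
      finally have S: "(\<Sum>k<i. (real i - 1 - 2 * real k)\<^sup>2) = real i * (((real i)\<^sup>2 - 1) / 3)" .
      have "(\<integral>\<omega>. (X n i \<omega>)\<^sup>2 \<partial>P n) = (\<Sum>k<i. (real i - 1 - 2 * real k)\<^sup>2 / (kendall_sd n)\<^sup>2) / real i"
        unfolding X_def using E[OF that, of "\<lambda>k. (e * ((real i - 1 - 2 * real k) / kendall_sd n))\<^sup>2"]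
        by (simp add: power_mult_distrib e2 power_divide)
      also have "\<dots> = real i * (((real i)\<^sup>2 - 1) / 3) / (kendall_sd n)\<^sup>2 / real i"
        unfolding sum_divide_distrib[symmetric] S ..
      finally show ?thesis using that by simp
    qed
    show "\<forall>\<^sub>F n in sequentially. (\<Sum>i\<in>{1..n}. \<integral>\<omega>. (X n i \<omega>)\<^sup>2 \<partial>P n) = 1"
      using eventually_ge_at_top[of 2]
    proof eventually_elim
      case (elim n)
      have "(\<Sum>i\<in>{1..n}. \<integral>\<omega>. (X n i \<omega>)\<^sup>2 \<partial>P n) = (\<Sum>i\<in>{1..n}. ((real i)\<^sup>2 - 1) / 3 / (kendall_sd n)\<^sup>2)"
        by (intro sum.cong v) auto
      also have "\<dots> = (real n * (real n + 1) * (2 * real n + 1) / 6 - real n) / 3 / (kendall_sd n)\<^sup>2"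
        by (simp add: sum_divide_distrib[symmetric] sum_subtractf sum_squares_real[simplified])
      also have "(real n * (real n + 1) * (2 * real n + 1) / 6 - real n) / 3 = (kendall_sd n)\<^sup>2"
      proof -
        have "0 \<le> real n * (real n - 1) * (2 * real n + 5) / 18" using elim by simp
        then have "(kendall_sd n)\<^sup>2 = real n * (real n - 1) * (2 * real n + 5) / 18"
          unfolding kendall_sd_def by (rule real_sqrt_pow2)
        then show ?thesis by (simp add: field_simps)
      qed
      also have "(kendall_sd n)\<^sup>2 / (kendall_sd n)\<^sup>2 = 1" using elim by (simp add: kendall_sd_def)
      finally show ?case .
    qed
    show "(\<lambda>n. real (card {1..n}) * (x n * (real n / kendall_sd n)) ^ 3) \<longlonglongrightarrow> 0"
    proof -
      have "(\<lambda>n. real n * (real n / kendall_sd n) ^ 3 * sqrt (real n)) \<longlonglongrightarrow> 27"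
        unfolding kendall_sd_def by (real_asymp, simp add: powr_half_sqrt real_sqrt_divide)
      from tendsto_mult[OF rate this] have "(\<lambda>n. x n ^ 3 / sqrt (real n) * (real n * (real n / kendall_sd n) ^ 3 * sqrt (real n))) \<longlonglongrightarrow> 0" by simp
      moreover have "\<forall>\<^sub>F n in sequentially. x n ^ 3 / sqrt (real n) * (real n * (real n / kendall_sd n) ^ 3 * sqrt (real n))
         = real (card {1..n}) * (x n * (real n / kendall_sd n)) ^ 3"
        using eventually_gt_at_top[of 0] by eventually_elim (simp add: power_mult_distrib power_divide)
      ultimately show ?thesis by (rule Lim_transform_eventually)
    qed
  qed (use x in auto)
  moreover have "measure (P n) {\<omega>\<in>space (P n). x n + \<eta> / x n \<le> (\<Sum>i\<in>{1..n}. X n i \<omega>)}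
      = measure_pmf.prob (uniform_perm {1..n}) {ys. x n + \<eta> / x n \<le> e * (sgn_sum ys / kendall_sd n)}" for n
  proof -
    have "measure_pmf.prob (uniform_perm {1..n}) {ys. x n + \<eta> / x n \<le> e * (sgn_sum ys / kendall_sd n)}
      = measure_pmf.prob (map_pmf sgn_sum (uniform_perm {1..n})) {s. x n + \<eta> / x n \<le> e * (s / kendall_sd n)}"
      by (simp add: vimage_def)
    also have "\<dots> = measure_pmf.prob (lehmer_code_pmf n) {\<omega>. x n + \<eta> / x n \<le> e * ((\<Sum>i\<in>{1..n}. real i - 1 - 2 * real (\<omega> i)) / kendall_sd n)}"
      by (simp add: sgn_sum_law vimage_def)
    also have "\<dots> = measure (P n) {\<omega>\<in>space (P n). x n + \<eta> / x n \<le> (\<Sum>i\<in>{1..n}. X n i \<omega>)}"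
      by (simp add: P_def X_def sum_distrib_left[symmetric] sum_divide_distrib[symmetric])
    finally show ?thesis by simp
  qed
  ultimately show "(\<lambda>n. x n / std_normal_density (x n) *
      measure_pmf.prob (uniform_perm {1..n}) {ys. x n + \<eta> / x n \<le> e * (sgn_sum ys / kendall_sd n)}) \<longlonglongrightarrow> exp (- \<eta>)"
    by simp
qed

section \<open>Concentration for random permutations\<close>

lemma uniform_mgf_bound:
  fixes e :: "'a \<Rightarrow> real"
  assumes A: "finite A" "A \<noteq> {}" and e: "\<And>x. x \<in> A \<Longrightarrow> c \<le> e x \<and> e x \<le> c + R" and R: "0 \<le> R"
  shows "(\<Sum>x\<in>A. exp (l * e x)) / card A \<le> exp (l * ((\<Sum>x\<in>A. e x) / card A) + l\<^sup>2 * R\<^sup>2 / 8)"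
proof -
  let ?p = "measure_pmf (pmf_of_set A)"
  have E: "(\<integral>x. f x \<partial>?p) = (\<Sum>x\<in>A. f x) / card A" for f :: "'a \<Rightarrow> real"
    using A by (simp add: integral_pmf_of_set)
  have pos: "(\<Sum>x\<in>A. exp (k * f x)) / card A \<le> exp (k * ((\<Sum>x\<in>A. f x) / card A) + k\<^sup>2 * R\<^sup>2 / 8)"
    if k: "0 < k" and f: "\<And>x. x \<in> A \<Longrightarrow> c' \<le> f x \<and> f x \<le> c' + R" for k c' and f :: "'a \<Rightarrow> real"
  proof -
    interpret interval_bounded_random_variable ?p f c' "c' + R"
      using f A by unfold_locales (auto simp: AE_measure_pmf_iff)
    have "(\<integral>\<^sup>+x. ennreal (exp (k * (f x - (\<integral>x. f x \<partial>?p)))) \<partial>?p) \<le> ennreal (exp (k\<^sup>2 * (c' + R - c')\<^sup>2 / 8))"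
      using Hoeffdings_lemma_nn_integral[OF k] .
    also have "(\<integral>\<^sup>+x. ennreal (exp (k * (f x - (\<integral>x. f x \<partial>?p)))) \<partial>?p) =
        ennreal (\<integral>x. exp (k * (f x - (\<integral>x. f x \<partial>?p))) \<partial>?p)"
      using A by (intro nn_integral_eq_integral integrable_measure_pmf_finite) auto
    finally have "(\<integral>x. exp (k * (f x - (\<integral>x. f x \<partial>?p))) \<partial>?p) \<le> exp (k\<^sup>2 * R\<^sup>2 / 8)" by simp
    then have "(\<Sum>x\<in>A. exp (k * (f x - (\<Sum>x\<in>A. f x) / card A))) / card A \<le> exp (k\<^sup>2 * R\<^sup>2 / 8)"
      unfolding E .
    then have "exp (k * ((\<Sum>x\<in>A. f x) / card A)) * ((\<Sum>x\<in>A. exp (k * (f x - (\<Sum>x\<in>A. f x) / card A))) / card A)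
       \<le> exp (k * ((\<Sum>x\<in>A. f x) / card A)) * exp (k\<^sup>2 * R\<^sup>2 / 8)" by (intro mult_left_mono) auto
    moreover have "exp (k * ((\<Sum>x\<in>A. f x) / card A)) * (\<Sum>x\<in>A. exp (k * (f x - (\<Sum>x\<in>A. f x) / card A)))
        = (\<Sum>x\<in>A. exp (k * f x))"
      unfolding sum_distrib_left by (intro sum.cong) (auto simp: mult_exp_exp algebra_simps)
    ultimately show ?thesis by (simp add: mult_exp_exp)
  qed
  consider "0 < l" | "l = 0" | "l < 0" by linarith
  then show ?thesis
  proof cases
    case 1 then show ?thesis using pos[OF 1 e] by simp
  next
    case 2 then show ?thesis using A by simp
  next
    case 3
    have "(\<Sum>x\<in>A. exp ((- l) * (- e x))) / card A \<le> exp ((- l) * ((\<Sum>x\<in>A. - e x) / card A) + (- l)\<^sup>2 * R\<^sup>2 / 8)"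
      using 3 e by (intro pos[of "- l" "- c - R"]) force+
    then show ?thesis by (simp add: sum_negf)
  qed
qed

text \<open>Drawing the first entry and then permuting the rest, the induction hypothesis replaces the weights of
the rest by their mean, so the first entry enters through \<open>(w - wb) e x\<close> with \<open>wb\<close> this mean. Hoeffding's
lemma for one draw bounds the resulting moment generating function.\<close>

lemma uniform_perm_mgf_bound:
  fixes e :: "'a \<Rightarrow> real" and ws :: "real list" and D R :: real
  assumes "finite A" "card A = length ws" and ws: "\<And>w. w \<in> set ws \<Longrightarrow> lo \<le> w \<and> w \<le> lo + D"
    and e: "\<And>x. x \<in> A \<Longrightarrow> c \<le> e x \<and> e x \<le> c + R" and R: "0 \<le> R"
  shows "measure_pmf.expectation (uniform_perm A) (\<lambda>xs. exp (s * (\<Sum>(w, x)\<leftarrow>zip ws xs. w * e x)))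
     \<le> exp (s * (sum_list ws * ((\<Sum>x\<in>A. e x) / card A)) + real (card A) * (s\<^sup>2 * D\<^sup>2 * R\<^sup>2 / 8))"
  using assms(1,2) ws e
proof (induction ws arbitrary: A)
  case Nil
  then show ?case by (simp add: pmf_of_set_singleton)
next
  case (Cons w ws)
  define m where "m = length ws"
  have cA: "card A = Suc m" using Cons.prems by (simp add: m_def)
  have ne: "A \<noteq> {}" using cA by auto
  define q where "q = s\<^sup>2 * D\<^sup>2 * R\<^sup>2 / 8"
  define T where "T = (\<Sum>x\<in>A. e x)"
  define wb where "wb = sum_list ws / real m"
  have q0: "0 \<le> q" by (simp add: q_def)
  have "measure_pmf.expectation (uniform_perm A) (\<lambda>xs. exp (s * (\<Sum>(w, x)\<leftarrow>zip (w # ws) xs. w * e x)))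
    = (\<Sum>x\<in>A. measure_pmf.expectation (map_pmf ((#) x) (uniform_perm (A - {x}))) (\<lambda>xs. exp (s * (\<Sum>(w, x)\<leftarrow>zip (w # ws) xs. w * e x))) /\<^sub>R real (card A))"
    using Cons.prems(1) ne
    by (simp add: random_permutation_of_set map_pmf_def[symmetric]) (subst pmf_expectation_bind_pmf_of_set; simp)
  also have "\<dots> \<le> (\<Sum>x\<in>A. exp (s * (wb * T) + real m * q) * exp ((s * (w - wb)) * e x) /\<^sub>R real (card A))"
  proof (intro sum_mono scaleR_left_mono)
    fix x assume x: "x \<in> A"
    have cx: "card (A - {x}) = length ws" using x Cons.prems cA by (simp add: m_def)
    have "measure_pmf.expectation (map_pmf ((#) x) (uniform_perm (A - {x}))) (\<lambda>xs. exp (s * (\<Sum>(w, x)\<leftarrow>zip (w # ws) xs. w * e x)))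
      = exp (s * (w * e x)) * measure_pmf.expectation (uniform_perm (A - {x})) (\<lambda>xs. exp (s * (\<Sum>(w, x)\<leftarrow>zip ws xs. w * e x)))"
      by (simp add: distrib_left exp_add)
    also have "\<dots> \<le> exp (s * (w * e x)) * exp (s * (sum_list ws * ((\<Sum>x\<in>A - {x}. e x) / card (A - {x}))) + real (card (A - {x})) * q)"
      unfolding q_def using Cons.prems cx
      by (intro mult_left_mono Cons.IH) auto
    also have "(\<Sum>x\<in>A - {x}. e x) = T - e x" using x Cons.prems(1) by (simp add: T_def sum_diff1)
    also have "s * (sum_list ws * ((T - e x) / card (A - {x}))) + real (card (A - {x})) * q = s * (wb * (T - e x)) + real m * q"
      unfolding cx wb_def m_def by simp
    also have "exp (s * (w * e x)) * exp (s * (wb * (T - e x)) + real m * q) = exp (s * (wb * T) + real m * q) * exp ((s * (w - wb)) * e x)"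
      by (simp add: mult_exp_exp algebra_simps)
    finally show "measure_pmf.expectation (map_pmf ((#) x) (uniform_perm (A - {x}))) (\<lambda>xs. exp (s * (\<Sum>(w, x)\<leftarrow>zip (w # ws) xs. w * e x)))
       \<le> exp (s * (wb * T) + real m * q) * exp ((s * (w - wb)) * e x)" .
  qed auto
  also have "\<dots> = exp (s * (wb * T) + real m * q) * ((\<Sum>x\<in>A. exp ((s * (w - wb)) * e x)) / card A)"
    by (simp add: sum_distrib_left sum_divide_distrib divide_inverse_commute mult_ac)
  also have "\<dots> \<le> exp (s * (wb * T) + real m * q) * exp ((s * (w - wb)) * (T / card A) + q)"
  proof (intro mult_left_mono)
    show "(\<Sum>x\<in>A. exp ((s * (w - wb)) * e x)) / card A \<le> exp ((s * (w - wb)) * (T / card A) + q)"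
    proof (cases "m = 0")
      case True
      then obtain a where "A = {a}" using cA by (auto simp: card_1_singleton_iff)
      then show ?thesis using q0 by (simp add: T_def)
    next
      case False
      have "lo * m \<le> sum_list ws" "sum_list ws \<le> (lo + D) * m"
        using Cons.prems(3) sum_list_mono[of ws "\<lambda>_. lo" "\<lambda>w. w"] sum_list_mono[of ws "\<lambda>w. w" "\<lambda>_. lo + D"]
        by (auto simp: sum_list_triv m_def mult_ac)
      then have "lo \<le> wb" "wb \<le> lo + D" using False by (auto simp: wb_def field_simps)
      moreover have "lo \<le> w" "w \<le> lo + D" using Cons.prems(3)[of w] by auto
      ultimately have "\<bar>w - wb\<bar> \<le> D" by linarith
      then have "(w - wb)\<^sup>2 \<le> D\<^sup>2" by (metis abs_ge_zero power2_abs power_mono)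
      then have "(s * (w - wb))\<^sup>2 * R\<^sup>2 / 8 \<le> q"
        unfolding q_def power_mult_distrib by (intro divide_right_mono mult_right_mono mult_left_mono) auto
      moreover have "(\<Sum>x\<in>A. exp ((s * (w - wb)) * e x)) / card A \<le> exp ((s * (w - wb)) * (T / card A) + (s * (w - wb))\<^sup>2 * R\<^sup>2 / 8)"
        unfolding T_def using Cons.prems ne R by (intro uniform_mgf_bound) auto
      ultimately show ?thesis by (meson add_left_mono exp_le_cancel_iff order_trans)
    qed
  qed auto
  also have "\<dots> = exp (s * (sum_list (w # ws) * (T / card A)) + real (card A) * q)"
  proof -
    have "wb * T + (w - wb) * (T / card A) = sum_list (w # ws) * (T / card A)"
    proof (cases "m = 0")
      case True then show ?thesis by (simp add: wb_def m_def)
    next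
      case False
      define U where "U = T / card A"
      have T: "T = U * (1 + real m)" unfolding U_def cA by simp
      show ?thesis unfolding U_def[symmetric] using False by (simp add: T wb_def field_simps)
    qed
    then have "s * (wb * T) + s * (w - wb) * (T / card A) = s * (sum_list (w # ws) * (T / card A))"
      by (metis distrib_left mult.assoc)
    then show ?thesis unfolding cA by (simp add: mult_exp_exp algebra_simps)
  qed
  finally show ?case unfolding q_def T_def .
qed

text \<open>Chernoff's bound at the parameter that minimizes the exponent.\<close>

lemma uniform_perm_tail_bound:
  fixes e :: "'a \<Rightarrow> real" and ws :: "real list" and D R :: real
  assumes A: "finite A" "card A = length ws" "A \<noteq> {}" and ws: "\<And>w. w \<in> set ws \<Longrightarrow> lo \<le> w \<and> w \<le> lo + D"
    and e: "\<And>x. x \<in> A \<Longrightarrow> c \<le> e x \<and> e x \<le> c + R" and R: "0 < R" and D: "0 < D"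
    and s0: "sum_list ws = 0" and \<delta>: "0 \<le> \<delta>"
  shows "measure_pmf.prob (uniform_perm A) {xs. \<delta> \<le> \<bar>\<Sum>(w, x)\<leftarrow>zip ws xs. w * e x\<bar>}
     \<le> 2 * exp (- (2 * \<delta>\<^sup>2 / (card A * D\<^sup>2 * R\<^sup>2)))"
proof -
  let ?p = "measure_pmf (uniform_perm A)"
  define Y where "Y xs = (\<Sum>(w, x)\<leftarrow>zip ws xs. w * e x)" for xs
  define K where "K = real (card A) * D\<^sup>2 * R\<^sup>2"
  have "0 < card A" using A(1,3) card_gt_0_iff by blast
  then have K: "0 < K" unfolding K_def using R D by (intro mult_pos_pos) auto
  \<comment> \<open>the minimizer of \<open>- s \<delta> + s\<^sup>2 K / 8\<close>\<close>
  define s where "s = 4 * \<delta> / K"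
  have s: "0 \<le> s" using \<delta> K by (simp add: s_def)
  have fin: "finite (set_pmf (uniform_perm A))" using A by simp
  have one: "measure_pmf.prob (uniform_perm A) {xs. \<delta> \<le> t * Y xs} \<le> exp (- (2 * \<delta>\<^sup>2 / K))" if t: "t\<^sup>2 = 1" for t
  proof -
    have "measure_pmf.prob (uniform_perm A) {xs. \<delta> \<le> t * Y xs} = (\<integral>xs. indicator {xs. \<delta> \<le> t * Y xs} xs \<partial>?p)" by simp
    also have "\<dots> \<le> (\<integral>xs. exp (- (s * \<delta>)) * exp ((s * t) * Y xs) \<partial>?p)"
    proof (intro integral_mono integrable_measure_pmf_finite fin)
      fix xs
      show "indicator {xs. \<delta> \<le> t * Y xs} xs \<le> exp (- (s * \<delta>)) * exp ((s * t) * Y xs)"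
      proof (cases "\<delta> \<le> t * Y xs")
        case True
        then have "s * \<delta> \<le> s * (t * Y xs)" using s by (intro mult_left_mono)
        then show ?thesis using True by (simp add: mult_exp_exp)
      qed simp
    qed
    also have "\<dots> = exp (- (s * \<delta>)) * (\<integral>xs. exp ((s * t) * Y xs) \<partial>?p)" by simp
    also have "\<dots> \<le> exp (- (s * \<delta>)) * exp ((s * t) * (sum_list ws * ((\<Sum>x\<in>A. e x) / card A)) + real (card A) * ((s * t)\<^sup>2 * D\<^sup>2 * R\<^sup>2 / 8))"
      unfolding Y_def using ws e R A by (intro mult_left_mono uniform_perm_mgf_bound) auto
    also have "\<dots> = exp (- (s * \<delta>) + s\<^sup>2 * K / 8)"
      unfolding s0 power_mult_distrib t by (simp add: mult_exp_exp K_def)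
    also have "- (s * \<delta>) + s\<^sup>2 * K / 8 = - (2 * \<delta>\<^sup>2 / K)"
      using K by (simp add: s_def power2_eq_square field_simps)
    finally show ?thesis .
  qed
  have "{xs. \<delta> \<le> \<bar>Y xs\<bar>} \<subseteq> {xs. \<delta> \<le> 1 * Y xs} \<union> {xs. \<delta> \<le> (- 1) * Y xs}" by auto
  then have "measure_pmf.prob (uniform_perm A) {xs. \<delta> \<le> \<bar>Y xs\<bar>}
      \<le> measure_pmf.prob (uniform_perm A) ({xs. \<delta> \<le> 1 * Y xs} \<union> {xs. \<delta> \<le> (- 1) * Y xs})"
    by (intro measure_pmf.finite_measure_mono) auto
  also have "\<dots> \<le> measure_pmf.prob (uniform_perm A) {xs. \<delta> \<le> 1 * Y xs} + measure_pmf.prob (uniform_perm A) {xs. \<delta> \<le> (- 1) * Y xs}"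
    by (intro measure_Un_le) auto
  also have "\<dots> \<le> 2 * exp (- (2 * \<delta>\<^sup>2 / K))" using one[of 1] one[of "- 1"] by simp
  finally show ?thesis by (simp add: Y_def K_def)
qed

section \<open>Samples from the uniform distribution\<close>

abbreviation uniform01 :: "real measure" where "uniform01 \<equiv> uniform_measure lborel {0..1}"

abbreviation uniform_sample :: "nat \<Rightarrow> (nat \<Rightarrow> real) measure" where
  "uniform_sample n \<equiv> PiM {..<n} (\<lambda>_. uniform01)"

lemma prob_space_uniform01: "prob_space uniform01"
  by (rule prob_space_uniform_measure) auto

lemma prob_space_uniform_sample: "prob_space (uniform_sample n)"
  by (intro prob_space_PiM prob_space_uniform01)

lemma indep_vars_PiM_coordinates:
  assumes "\<And>i. i \<in> I \<Longrightarrow> prob_space (N i)"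
  shows "prob_space.indep_vars (PiM I N) N (\<lambda>i \<omega>. \<omega> i) I"
proof -
  interpret prob_space "PiM I N" using assms by (intro prob_space_PiM) auto
  show ?thesis
  proof (cases "I = {}")
    case True
    show ?thesis unfolding indep_vars_def indep_sets_def by (simp add: True)
  next
    case False
    have "distr (PiM I N) (PiM I N) (\<lambda>x. \<lambda>i\<in>I. x i) = distr (PiM I N) (PiM I N) (\<lambda>x. x)"
      by (intro distr_cong) (auto simp: space_PiM)
    also have "\<dots> = PiM I N" by simp
    also have "\<dots> = PiM I (\<lambda>i. distr (PiM I N) (N i) (\<lambda>x. x i))"
      using assms by (intro PiM_cong) (auto simp: distr_PiM_component)
    finally show ?thesis using False by (subst indep_vars_iff_distr_eq_PiM') auto
  qed
qed

lemma uniform01_integral: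
  fixes f :: "real \<Rightarrow> real"
  assumes [measurable]: "f \<in> borel_measurable borel"
  shows "(\<integral>x. f x \<partial>uniform01) = (\<integral>x. indicator {0..1} x * f x \<partial>lborel)"
proof -
  have "uniform01 = density lborel (\<lambda>x. ennreal (indicator {0..1} x))"
    unfolding uniform_measure_def by (simp add: divide_ennreal_def ennreal_indicator)
  then show ?thesis using integral_density[of f lborel "indicat_real {0..1}"] by simp
qed

lemma uniform01_moments:
  shows "(\<integral>x. x - 1 / 2 \<partial>uniform01) = 0" and "(\<integral>x. (x - 1 / 2)\<^sup>2 \<partial>uniform01) = 1 / 12"
    and "t \<in> {0..1} \<Longrightarrow> measure uniform01 {..t} = t" and "AE x in uniform01. x \<in> {0..1}"
    and "measure uniform01 {a} = 0"
proof -
  have "((\<lambda>x::real. x - 1 / 2) has_integral ((1 - 1/2)\<^sup>2 / 2 - (0 - 1/2)\<^sup>2 / 2)) {0..1}"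
    by (intro fundamental_theorem_of_calculus) (auto intro!: derivative_eq_intros simp: has_real_derivative_iff_has_vector_derivative[symmetric])
  then have "integral {0..1} (\<lambda>x::real. x - 1/2) = 0" by (simp add: integral_unique)
  moreover have "set_integrable lborel {0..1} (\<lambda>x::real. x - 1/2)"
    by (intro borel_integrable_atLeastAtMost') (auto intro!: continuous_intros)
  ultimately show "(\<integral>x. x - 1 / 2 \<partial>uniform01) = 0"
    using set_borel_integral_eq_integral(2)[of "{0..1}" "\<lambda>x::real. x - 1/2"]
    by (subst uniform01_integral) (auto simp: set_lebesgue_integral_def)
  have "((\<lambda>x::real. (x - 1 / 2)\<^sup>2) has_integral ((1 - 1/2) ^ 3 / 3 - (0 - 1/2) ^ 3 / 3)) {0..1}"
    by (intro fundamental_theorem_of_calculus) (auto intro!: derivative_eq_intros simp: has_real_derivative_iff_has_vector_derivative[symmetric])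
  then have "integral {0..1} (\<lambda>x::real. (x - 1/2)\<^sup>2) = 1 / 12"
    by (simp add: integral_unique power3_eq_cube)
  moreover have "set_integrable lborel {0..1} (\<lambda>x::real. (x - 1/2)\<^sup>2)"
    by (intro borel_integrable_atLeastAtMost') (auto intro!: continuous_intros)
  ultimately show "(\<integral>x. (x - 1 / 2)\<^sup>2 \<partial>uniform01) = 1 / 12"
    using set_borel_integral_eq_integral(2)[of "{0..1}" "\<lambda>x::real. (x - 1/2)\<^sup>2"]
    by (subst uniform01_integral) (auto simp: set_lebesgue_integral_def)
  show "measure uniform01 {..t} = t" if "t \<in> {0..1}"
  proof -
    have "{0..1} \<inter> {..t} = {0..t}" using that by auto
    then show ?thesis using that by (subst measure_uniform_measure) auto
  qed
  show "AE x in uniform01. x \<in> {0..1}" by (rule AE_uniform_measureI) auto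
  show "measure uniform01 {a} = 0"
  proof -
    have "measure lborel ({0..1} \<inter> {a}) = 0" by (cases "a \<in> {0..1}") (auto simp: measure_def)
    then show ?thesis by (subst measure_uniform_measure) auto
  qed
qed

lemma bij_betw_rank_at_most:
  fixes f :: "'i \<Rightarrow> real"
  assumes fin: "finite I" and inj: "inj_on f I"
  shows "bij_betw (\<lambda>i. card {m\<in>I. f m \<le> f i}) I {1..card I}"
proof -
  let ?r = "\<lambda>i. card {m\<in>I. f m \<le> f i}"
  have lt: "?r i < ?r j" if "i \<in> I" "j \<in> I" "f i < f j" for i j
  proof (intro psubset_card_mono psubsetI)
    have "j \<in> {m\<in>I. f m \<le> f j}" "j \<notin> {m\<in>I. f m \<le> f i}" using that by auto
    then show "{m\<in>I. f m \<le> f i} \<noteq> {m\<in>I. f m \<le> f j}" by blast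
  qed (use that fin in auto)
  have "inj_on ?r I"
  proof (rule inj_onI)
    fix i j assume "i \<in> I" "j \<in> I" "?r i = ?r j"
    then have "f i = f j" using lt[of i j] lt[of j i]
      by (cases "f i" "f j" rule: linorder_cases) auto
    then show "i = j" using inj \<open>i \<in> I\<close> \<open>j \<in> I\<close> by (auto dest: inj_onD)
  qed
  moreover have sub: "?r ` I \<subseteq> {1..card I}"
    using fin by (auto intro!: card_mono simp: Suc_le_eq card_gt_0_iff)
  ultimately show ?thesis unfolding bij_betw_def
    using card_subset_eq[OF _ sub] by (simp add: card_image)
qed

text \<open>By Fubini's theorem two independent variables agree with probability zero if one of them has
no atoms.\<close>

lemma (in prob_space) AE_inj_on_indep:
  fixes X :: "'i \<Rightarrow> 'a \<Rightarrow> real"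
  assumes fin: "finite I" and ind: "indep_vars (\<lambda>_. borel) X I"
    and atomless: "\<And>i a. i \<in> I \<Longrightarrow> measure (distr M borel (X i)) {a} = 0"
  shows "AE \<omega> in M. inj_on (\<lambda>i. X i \<omega>) I"
proof -
  have rv [measurable]: "X i \<in> borel_measurable M" if "i \<in> I" for i
    using ind that by (simp add: indep_vars_def2)
  have "AE \<omega> in M. X i \<omega> \<noteq> X j \<omega>" if ij: "i \<in> I" "j \<in> I" "i \<noteq> j" for i j
  proof -
    note rv[OF ij(1), measurable] rv[OF ij(2), measurable]
    have "indep_vars (\<lambda>_. borel) X (insert i {j})" using ind by (rule indep_vars_subset) (use ij in auto)
    from indep_vars_sum[OF _ _ this] ij have iv: "indep_var borel (X i) borel (X j)" by simp
    interpret P: prob_space "distr M borel (X i)" by (intro prob_space_distr) simp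
    interpret Q: prob_space "distr M borel (X j)" by (intro prob_space_distr) simp
    interpret PQ: pair_prob_space "distr M borel (X i)" "distr M borel (X j)" ..
    have "AE p in distr M borel (X i) \<Otimes>\<^sub>M distr M borel (X j). fst p \<noteq> snd p"
    proof (rule PQ.AE_pair_measure)
      have "{p \<in> space (borel \<Otimes>\<^sub>M borel). fst p \<noteq> (snd p :: real)} \<in> sets (borel \<Otimes>\<^sub>M borel)" by measurable
      then show "{p \<in> space (distr M borel (X i) \<Otimes>\<^sub>M distr M borel (X j)). fst p \<noteq> snd p} \<in> sets (distr M borel (X i) \<Otimes>\<^sub>M distr M borel (X j))"
        by (simp add: space_pair_measure cong: sets_pair_measure_cong)
      show "AE x in distr M borel (X i). AE y in distr M borel (X j). fst (x, y) \<noteq> snd (x, y)"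
      proof (rule AE_I2)
        fix x
        show "AE y in distr M borel (X j). fst (x, y) \<noteq> snd (x, y)"
          by (rule AE_I[where N="{x}"]) (auto simp: Q.emeasure_eq_measure atomless[OF ij(2)])
      qed
    qed
    also have "distr M borel (X i) \<Otimes>\<^sub>M distr M borel (X j) = distr M (borel \<Otimes>\<^sub>M borel) (\<lambda>\<omega>. (X i \<omega>, X j \<omega>))"
      using iv by (simp add: indep_var_distribution_eq)
    finally show ?thesis by (subst (asm) AE_distr_iff) auto
  qed
  then have "AE \<omega> in M. \<forall>i\<in>I. \<forall>j\<in>I. i \<noteq> j \<longrightarrow> X i \<omega> \<noteq> X j \<omega>"
    using fin by (intro AE_finite_allI) auto
  then show ?thesis by eventually_elim (auto intro!: inj_onI)
qed

lemma uniform_sample_coordinates: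
  shows "prob_space.indep_vars (uniform_sample n) (\<lambda>_. borel) (\<lambda>i \<omega>. \<omega> i) {..<n}"
    and "i < n \<Longrightarrow> distr (uniform_sample n) borel (\<lambda>\<omega>. \<omega> i) = uniform01"
proof -
  have "prob_space.indep_vars (uniform_sample n) (\<lambda>_. uniform01) (\<lambda>i \<omega>. \<omega> i) {..<n}"
    by (intro indep_vars_PiM_coordinates prob_space_uniform01)
  from prob_space.indep_vars_compose2[OF prob_space_uniform_sample this, of "\<lambda>_ x. x" "\<lambda>_. borel"]
  show "prob_space.indep_vars (uniform_sample n) (\<lambda>_. borel) (\<lambda>i \<omega>. \<omega> i) {..<n}" by simp
  assume "i < n"
  then have "distr (uniform_sample n) uniform01 (\<lambda>\<omega>. \<omega> i) = uniform01"
    by (intro distr_PiM_component prob_space_uniform01) auto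
  moreover have "distr (uniform_sample n) borel (\<lambda>\<omega>. \<omega> i) = distr (uniform_sample n) uniform01 (\<lambda>\<omega>. \<omega> i)"
    by (intro distr_cong) auto
  ultimately show "distr (uniform_sample n) borel (\<lambda>\<omega>. \<omega> i) = uniform01" by simp
qed

lemma uniform_sample_coord_measurable [measurable]:
  "i < n \<Longrightarrow> (\<lambda>\<omega>. \<omega> i) \<in> borel_measurable (uniform_sample n)"
  using uniform_sample_coordinates(1)[of n] prob_space.indep_vars_def2[OF prob_space_uniform_sample]
  by auto

lemma AE_uniform_sample:
  "AE \<omega> in uniform_sample n. inj_on \<omega> {..<n} \<and> (\<forall>i<n. \<omega> i \<in> {0..1})"
proof -
  interpret prob_space "uniform_sample n" by (rule prob_space_uniform_sample)
  have "AE \<omega> in uniform_sample n. inj_on \<omega> {..<n}"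
    using AE_inj_on_indep[OF _ uniform_sample_coordinates(1)] uniform_sample_coordinates(2) uniform01_moments(5)
    by simp
  moreover have "AE \<omega> in uniform_sample n. \<forall>i\<in>{..<n}. \<omega> i \<in> {0..1}"
  proof (intro AE_finite_allI)
    fix i assume "i \<in> {..<n}"
    then show "AE \<omega> in uniform_sample n. \<omega> i \<in> {0..1}"
      by (intro AE_PiM_component prob_space_uniform01 uniform01_moments(4))
  qed simp
  ultimately show ?thesis by eventually_elim auto
qed

lemma uniform_sample_permute:
  assumes \<pi>: "\<pi> \<in> permutations_of_set {..<n}" and a [measurable]: "A \<in> sets (uniform_sample n)"
  shows "measure (uniform_sample n) {\<omega>\<in>space (uniform_sample n). (\<lambda>i\<in>{..<n}. \<omega> (\<pi> ! i)) \<in> A} = measure (uniform_sample n) A"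
proof -
  have d: "distinct \<pi>" "set \<pi> = {..<n}" using \<pi> by (auto dest: permutations_of_setD)
  then have l: "length \<pi> = n" using distinct_card by fastforce
  have D: "distr (uniform_sample n) (uniform_sample n) (\<lambda>\<omega>. \<lambda>i\<in>{..<n}. \<omega> (\<pi> ! i)) = uniform_sample n"
  proof (rule distr_PiM_reindex)
    show "inj_on ((!) \<pi>) {..<n}" using inj_on_nth[OF d(1), of "{..<n}"] l by simp
    show "(!) \<pi> \<in> {..<n} \<rightarrow> {..<n}" using d l nth_mem by fastforce
  qed (rule prob_space_uniform01)
  have m: "(\<lambda>\<omega>. \<lambda>i\<in>{..<n}. \<omega> (\<pi> ! i)) \<in> measurable (uniform_sample n) (uniform_sample n)"
    using d l by (intro measurable_restrict measurable_component_singleton) (use nth_mem in fastforce)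
  have "measure (uniform_sample n) A = measure (distr (uniform_sample n) (uniform_sample n) (\<lambda>\<omega>. \<lambda>i\<in>{..<n}. \<omega> (\<pi> ! i))) A"
    by (simp add: D)
  also have "\<dots> = measure (uniform_sample n) ((\<lambda>\<omega>. \<lambda>i\<in>{..<n}. \<omega> (\<pi> ! i)) -` A \<inter> space (uniform_sample n))"
    using m a by (rule measure_distr)
  finally show ?thesis by (simp add: vimage_def Int_def conj_commute)
qed

text \<open>The empirical distribution function is compared with the identity on the grid \<open>k / n\<close> only, which keeps
the event a finite union; by monotonicity the grid controls all points.\<close>

definition empirical_discrepancy :: "nat \<Rightarrow> real \<Rightarrow> (nat \<Rightarrow> real) set" where
  "empirical_discrepancy n h = {\<omega>\<in>space (uniform_sample n).
     \<exists>k\<in>{0..n}. real n * h \<le> \<bar>(\<Sum>i<n. indicator {..real k / real n} (\<omega> i)) - real k\<bar>}"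

lemma empirical_discrepancy_measurable: "empirical_discrepancy n h \<in> sets (uniform_sample n)"
  unfolding empirical_discrepancy_def by measurable

text \<open>Hoeffding's inequality at each of the \<open>n + 1\<close> grid points.\<close>

lemma empirical_discrepancy_bound:
  assumes n: "0 < n" and h: "0 \<le> h"
  shows "measure (uniform_sample n) (empirical_discrepancy n h) \<le> 2 * (real n + 1) * exp (- (2 * real n * h\<^sup>2))"
proof -
  interpret P: prob_space "uniform_sample n" by (rule prob_space_uniform_sample)
  define B where "B k = {\<omega>\<in>space (uniform_sample n). real n * h \<le> \<bar>(\<Sum>i<n. indicator {..real k / real n} (\<omega> i)) - real k\<bar>}" for k
  have Bm: "B k \<in> P.events" for k unfolding B_def by measurable
  have one: "P.prob (B k) \<le> 2 * exp (- (2 * real n * h\<^sup>2))" if k: "k \<in> {0..n}" for k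
  proof -
    let ?t = "real k / real n"
    have t: "?t \<in> {0..1}" using k n by simp
    let ?X = "\<lambda>i \<omega>. indicator {..?t} (\<omega> i) :: real"
    have iv: "P.indep_vars (\<lambda>_. borel) ?X {..<n}"
      using P.indep_vars_compose2[OF uniform_sample_coordinates(1), of "\<lambda>_. indicator {..?t}" "\<lambda>_. borel"] by simp
    have E: "P.expectation (?X i) = ?t" if "i < n" for i
    proof -
      have "P.expectation (?X i) = (\<integral>x. indicator {..?t} x \<partial>distr (uniform_sample n) borel (\<lambda>\<omega>. \<omega> i))"
        using that by (subst integral_distr) auto
      then show ?thesis using that t by (simp add: uniform_sample_coordinates(2) uniform01_moments(3))
    qed
    interpret H: Hoeffding_ineq "uniform_sample n" "{..<n}" ?X "\<lambda>_. 0" "\<lambda>_. 1" "\<Sum>i<n. P.expectation (?X i)"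
      using iv by unfold_locales (auto simp: indicator_def)
    have mu: "(\<Sum>i<n. P.expectation (?X i)) = real k" using n by (simp add: E)
    show ?thesis
      using H.Hoeffding_ineq_abs_ge[of "real n * h"] n h unfolding mu B_def
      by (simp add: power2_eq_square mult_ac)
  qed
  have "empirical_discrepancy n h = (\<Union>k\<in>{0..n}. B k)" unfolding empirical_discrepancy_def B_def by auto
  then have "P.prob (empirical_discrepancy n h) \<le> (\<Sum>k\<in>{0..n}. P.prob (B k))"
    using Bm by (auto intro: P.finite_measure_subadditive_finite)
  also have "\<dots> \<le> (\<Sum>k\<in>{0..n}. 2 * exp (- (2 * real n * h\<^sup>2)))" by (intro sum_mono one)
  finally show ?thesis by (simp add: algebra_simps)
qed

text \<open>By monotonicity the rank of a value lies between the counts at the two neighbouring grid points; the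
additional 1 is the mesh of the grid in units of \<open>1/n\<close>.\<close>

lemma rank_close_of_no_discrepancy:
  assumes \<omega>: "\<omega> \<in> space (uniform_sample n)" "\<omega> \<notin> empirical_discrepancy n h"
    and u: "\<forall>i<n. \<omega> i \<in> {0..1}" and i: "i < n"
  shows "\<bar>real (card {m\<in>{..<n}. \<omega> m \<le> \<omega> i}) - real n * \<omega> i\<bar> \<le> real n * h + 1"
proof -
  have n: "0 < n" using i by simp
  have S: "(\<Sum>i<n. indicator {..t} (\<omega> i)) = real (card {m\<in>{..<n}. \<omega> m \<le> t})" for t
    by (simp add: indicator_def sum.If_cases Int_def)
  have close: "\<bar>real (card {m\<in>{..<n}. \<omega> m \<le> real k / real n}) - real k\<bar> < real n * h" if "k \<le> n" for k
  proof -
    have "\<not> real n * h \<le> \<bar>(\<Sum>i<n. indicator {..real k / real n} (\<omega> i)) - real k\<bar>"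
      using \<omega> that unfolding empirical_discrepancy_def by auto
    then show ?thesis unfolding S by simp
  qed
  define R where "R = card {m\<in>{..<n}. \<omega> m \<le> \<omega> i}"
  define k where "k = nat \<lfloor>real n * \<omega> i\<rfloor>"
  have ui: "0 \<le> \<omega> i" "\<omega> i \<le> 1" using u i by auto
  have k: "real k \<le> real n * \<omega> i" "real n * \<omega> i < real k + 1"
    using ui by (auto simp: k_def)
  have kd: "real k / real n \<le> \<omega> i" "\<omega> i \<le> real (k + 1) / real n"
    using k n by (auto simp: field_simps)
  have kn: "k \<le> n"
  proof -
    have "real n * \<omega> i \<le> real n" using ui by (simp add: mult_left_le)
    then have "real k \<le> real n" using k by linarith
    then show ?thesis by simp
  qed
  have "card {m\<in>{..<n}. \<omega> m \<le> real k / real n} \<le> R"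
    unfolding R_def by (intro card_mono) (auto intro: order_trans[OF _ kd(1)])
  then have lo: "real k - real n * h < real R" using close[OF kn] by linarith
  have hi: "real R < real k + 1 + real n * h"
  proof (cases "k < n")
    case True
    have "R \<le> card {m\<in>{..<n}. \<omega> m \<le> real (k + 1) / real n}"
      unfolding R_def using kd(2) by (intro card_mono) auto
    then show ?thesis using close[of "k + 1"] True by simp
  next
    case False
    have "R \<le> card {..<n}" unfolding R_def by (intro card_mono) auto
    then have "R \<le> n" by simp
    moreover have "0 < real n * h" using close[of n] by linarith
    ultimately show ?thesis using False kn by simp
  qed
  show ?thesis unfolding R_def[symmetric] using lo hi k by linarith
qed

section \<open>Spearman's rho of a random permutation\<close>

text \<open>Positions are counted from 0, so their mean is \<open>(n - 1) / 2\<close>.\<close>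

definition centered_indices :: "nat \<Rightarrow> real list" where
  "centered_indices n = map (\<lambda>i. real i - (real n - 1) / 2) [0..<n]"

definition spearman_sum :: "nat \<Rightarrow> nat list \<Rightarrow> real" where
  "spearman_sum n ys = (\<Sum>(w, y)\<leftarrow>zip (centered_indices n) ys. w * real y)"

definition uniform_score :: "nat \<Rightarrow> (nat \<Rightarrow> real) \<Rightarrow> real" where
  "uniform_score n u = (\<Sum>i<n. (real i - (real n - 1) / 2) * u i)"

text \<open>The standard deviation of \<open>spearman_sum n\<close> under the uniform distribution on permutations.\<close>

definition spearman_sd :: "nat \<Rightarrow> real" where
  "spearman_sd n = real n * (real n + 1) * sqrt (real n - 1) / 12"

text \<open>The standard deviation of \<open>uniform_score n\<close> for independent variables that are uniform on the unit
interval, each of which has variance \<open>1/12\<close>.\<close>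

definition uniform_score_sd :: "nat \<Rightarrow> real" where
  "uniform_score_sd n = sqrt (real n * ((real n)\<^sup>2 - 1)) / 12"

lemma sum_list_zip_centered:
  assumes "length xs = n"
  shows "(\<Sum>(w, x)\<leftarrow>zip (centered_indices n) xs. w * f x) = uniform_score n (\<lambda>i. f (xs ! i))"
proof -
  have "(\<Sum>(w, x)\<leftarrow>zip (centered_indices n) xs. w * f x) = (\<Sum>i<n. centered_indices n ! i * f (xs ! i))"
    using assms by (simp add: sum_list_sum_nth centered_indices_def atLeast0LessThan)
  then show ?thesis by (simp add: uniform_score_def centered_indices_def)
qed

lemma sum_centered: "(\<Sum>i<n. real i - (real n - 1) / 2) = 0"
  by (simp add: sum_subtractf sum_lessThan_real)

lemma uniform_score_measurable [measurable]: "uniform_score n \<in> borel_measurable (uniform_sample n)"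
  unfolding uniform_score_def by measurable

text \<open>A uniform sample is exchangeable, so shuffling its entries by an independent random permutation does
not change its law. Fixing the values and averaging over the permutation isolates the randomness that
ranks and values have in common.\<close>

lemma uniform_sample_average:
  assumes A: "A \<in> sets (uniform_sample n)"
  shows "measure (uniform_sample n) A = (\<integral>\<omega>. measure_pmf.prob (uniform_perm {..<n}) {\<pi>. (\<lambda>i\<in>{..<n}. \<omega> (\<pi> ! i)) \<in> A} \<partial>uniform_sample n)"
    and "(\<lambda>\<omega>. measure_pmf.prob (uniform_perm {..<n}) {\<pi>. (\<lambda>i\<in>{..<n}. \<omega> (\<pi> ! i)) \<in> A}) \<in> borel_measurable (uniform_sample n)"
proof -
  interpret P: prob_space "uniform_sample n" by (rule prob_space_uniform_sample)
  let ?S = "permutations_of_set {..<n}"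
  have S: "finite ?S" "?S \<noteq> {}" by auto
  have m: "(\<lambda>\<omega>. \<lambda>i\<in>{..<n}. \<omega> (\<pi> ! i)) \<in> measurable (uniform_sample n) (uniform_sample n)" if "\<pi> \<in> ?S" for \<pi>
  proof (intro measurable_restrict measurable_component_singleton)
    fix i assume "i \<in> {..<n}"
    moreover have "length \<pi> = n" "set \<pi> = {..<n}"
      using length_finite_permutations_of_set[OF that] permutations_of_setD(1)[OF that] by simp_all
    ultimately show "\<pi> ! i \<in> {..<n}" using nth_mem by blast
  qed
  have ev: "{\<omega>\<in>space (uniform_sample n). (\<lambda>i\<in>{..<n}. \<omega> (\<pi> ! i)) \<in> A} \<in> P.events" if "\<pi> \<in> ?S" for \<pi>
    using measurable_sets[OF m[OF that] A] by (simp add: vimage_def Int_def conj_commute)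
  have eq: "measure_pmf.prob (uniform_perm {..<n}) {\<pi>. (\<lambda>i\<in>{..<n}. \<omega> (\<pi> ! i)) \<in> A}
     = (\<Sum>\<pi>\<in>?S. indicator {\<omega>\<in>space (uniform_sample n). (\<lambda>i\<in>{..<n}. \<omega> (\<pi> ! i)) \<in> A} \<omega>) / card ?S" if "\<omega> \<in> space (uniform_sample n)" for \<omega>
    using that S by (simp add: measure_pmf_of_set indicator_def sum.If_cases Int_def del: card_permutations_of_set)
  show "(\<lambda>\<omega>. measure_pmf.prob (uniform_perm {..<n}) {\<pi>. (\<lambda>i\<in>{..<n}. \<omega> (\<pi> ! i)) \<in> A}) \<in> borel_measurable (uniform_sample n)"
    using ev by (subst measurable_cong[OF eq]) (auto intro!: borel_measurable_divide borel_measurable_sum borel_measurable_indicator)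
  have "(\<integral>\<omega>. measure_pmf.prob (uniform_perm {..<n}) {\<pi>. (\<lambda>i\<in>{..<n}. \<omega> (\<pi> ! i)) \<in> A} \<partial>uniform_sample n)
     = (\<integral>\<omega>. (\<Sum>\<pi>\<in>?S. indicator {\<omega>\<in>space (uniform_sample n). (\<lambda>i\<in>{..<n}. \<omega> (\<pi> ! i)) \<in> A} \<omega>) / card ?S \<partial>uniform_sample n)"
    by (intro Bochner_Integration.integral_cong eq refl)
  also have "\<dots> = (\<Sum>\<pi>\<in>?S. P.prob {\<omega>\<in>space (uniform_sample n). (\<lambda>i\<in>{..<n}. \<omega> (\<pi> ! i)) \<in> A}) / card ?S"
    using ev by (subst integral_divide_zero, subst Bochner_Integration.integral_sum)
       (auto simp: P.emeasure_eq_measure)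
  also have "\<dots> = (\<Sum>\<pi>\<in>?S. P.prob A) / card ?S"
    using uniform_sample_permute[OF _ A] by simp
  also have "\<dots> = P.prob A" using S by (simp del: card_permutations_of_set)
  finally show "P.prob A = (\<integral>\<omega>. measure_pmf.prob (uniform_perm {..<n}) {\<pi>. (\<lambda>i\<in>{..<n}. \<omega> (\<pi> ! i)) \<in> A} \<partial>uniform_sample n)" ..
qed

text \<open>Given the values \<open>\<omega>\<close>, a random order of them has ranks that form a random permutation. The
score of the values and the score of the ranks then differ by a weighted sum of the small numbers
\<open>E i = \<omega> i - c R i\<close> along a random permutation, for which \<open>uniform_perm_tail_bound\<close> is
available.\<close>

lemma spearman_uniform_conditional:
  assumes n: "2 \<le> n" and e: "\<bar>e\<bar> = 1" and \<delta>: "0 \<le> \<delta>"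
    and h: "1 / real n \<le> h" and \<omega>: "\<omega> \<in> space (uniform_sample n)" "\<omega> \<notin> empirical_discrepancy n h"
    "inj_on \<omega> {..<n}" "\<forall>i<n. \<omega> i \<in> {0..1}"
  defines "Q \<equiv> \<lambda>y. measure_pmf.prob (uniform_perm {..<n}) {\<pi>. (\<lambda>i\<in>{..<n}. \<omega> (\<pi> ! i)) \<in> {\<omega>\<in>space (uniform_sample n). y \<le> e * (uniform_score n \<omega> / uniform_score_sd n)}}"
    and "pS \<equiv> \<lambda>y. measure_pmf.prob (uniform_perm {1..n}) {ys. y \<le> e * (spearman_sum n ys / spearman_sd n)}"
    and "r \<equiv> 2 * exp (- (\<delta>\<^sup>2 / (5184 * h\<^sup>2)))"
  shows "Q y \<le> pS (y - \<delta>) + r" and "pS y \<le> Q (y - \<delta>) + r"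
proof -
  \<comment> \<open>This scaling of the ranks makes the two standardizations agree: \<open>spearman_sd n = uniform_score_sd n / c\<close>.
     The two standardized sums then differ by a weighted sum of the \<open>E i\<close> alone.\<close>
  define c where "c = 1 / sqrt (real n * (real n + 1))"
  define R where "R i = card {m\<in>{..<n}. \<omega> m \<le> \<omega> i}" for i
  define E where "E i = \<omega> i - c * real (R i)" for i
  define t where "t = uniform_score_sd n"
  let ?p = "uniform_perm {..<n}"
  define Z where "Z = {\<pi>. \<delta> * t \<le> \<bar>\<Sum>(w, x)\<leftarrow>zip (centered_indices n) \<pi>. w * E x\<bar>}"
  have h0: "0 < h" using n h by (intro less_le_trans[OF _ h]) simp
  have n4: "4 \<le> (real n)\<^sup>2" using power_mono[of 2 "real n" 2] n by simp
  then have n2: "0 < (real n)\<^sup>2 - 1" by simp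
  have t: "0 < t" using n n2 by (simp add: t_def uniform_score_sd_def)
  have bij: "bij_betw R {..<n} {1..n}" unfolding R_def using bij_betw_rank_at_most[OF _ \<omega>(3)] by simp
  have Rn: "1 \<le> R i" "R i \<le> n" if "i < n" for i using bij that by (auto simp: bij_betw_def)
  have mapR: "map_pmf (map R) ?p = uniform_perm {1..n}"
  proof -
    have "map R ` permutations_of_set {..<n} = permutations_of_set {1..n}"
      using permutations_of_set_image_inj[of R "{..<n}"] bij by (simp add: bij_betw_def)
    moreover have "inj_on (map R) (permutations_of_set {..<n})"
    proof (rule inj_onI)
      fix xs ys assume xy: "xs \<in> permutations_of_set {..<n}" "ys \<in> permutations_of_set {..<n}" "map R xs = map R ys"
      have "inj_on R (set xs \<union> set ys)"
        unfolding permutations_of_setD(1)[OF xy(1)] permutations_of_setD(1)[OF xy(2)]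
        using bij by (simp add: bij_betw_def)
      with xy(3) show "xs = ys" by (rule map_inj_on)
    qed
    ultimately show ?thesis by (subst map_pmf_of_set_inj) auto
  qed
  \<comment> \<open>One \<open>h\<close> for the discrepancy, one \<open>1/n \<le> h\<close> for the grid and one for \<open>c\<close> in place of \<open>1/n\<close>.\<close>
  have E: "- (3 * h) \<le> E i \<and> E i \<le> - (3 * h) + 6 * h" if i: "i < n" for i
  proof -
    have a: "\<bar>real (R i) - real n * \<omega> i\<bar> \<le> real n * h + 1"
      unfolding R_def using rank_close_of_no_discrepancy[OF \<omega>(1,2,4) i] .
    have b: "\<bar>real (R i) / real n - \<omega> i\<bar> \<le> h + 1 / real n"
    proof -
      have "real (R i) / real n - \<omega> i = (real (R i) - real n * \<omega> i) / real n"
        using n by (simp add: field_simps)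
      then have "\<bar>real (R i) / real n - \<omega> i\<bar> = \<bar>real (R i) - real n * \<omega> i\<bar> / real n"
        by (simp only: abs_divide abs_of_nat)
      also have "\<dots> \<le> (real n * h + 1) / real n" using a by (intro divide_right_mono) auto
      also have "\<dots> = h + 1 / real n" using n by (simp add: field_simps)
      finally show ?thesis .
    qed
    have c1: "c \<le> 1 / real n" "1 / (real n + 1) \<le> c"
    proof -
      have "real n \<le> sqrt (real n * (real n + 1))"
        by (rule real_le_rsqrt) (simp add: power2_eq_square distrib_left)
      then show "c \<le> 1 / real n" using n unfolding c_def by (intro divide_left_mono mult_pos_pos) auto
      have "sqrt (real n * (real n + 1)) \<le> real n + 1"
        by (rule real_le_lsqrt) (simp_all add: power2_eq_square distrib_left distrib_right)
      then show "1 / (real n + 1) \<le> c" using n unfolding c_def by (intro divide_left_mono mult_pos_pos) auto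
    qed
    have "0 \<le> real (R i) * (1 / real n - c)" using c1 by (intro mult_nonneg_nonneg) auto
    moreover have "real (R i) * (1 / real n - c) \<le> real n * (1 / real n - 1 / (real n + 1))"
      using c1 Rn[OF i] by (intro mult_mono) auto
    moreover have "real n * (1 / real n - 1 / (real n + 1)) \<le> 1 / real n"
    proof -
      have "real n * (1 / real n - 1 / (real n + 1)) = 1 - real n / (real n + 1)"
        using n by (simp add: right_diff_distrib)
      also have "\<dots> = 1 / (real n + 1)" by (simp add: field_simps)
      also have "\<dots> \<le> 1 / real n" using n by (intro divide_left_mono) auto
      finally show ?thesis .
    qed
    ultimately have d: "\<bar>real (R i) / real n - c * real (R i)\<bar> \<le> 1 / real n"
      by (simp add: right_diff_distrib mult_ac)
    have "\<bar>E i\<bar> \<le> h + 1 / real n + 1 / real n" unfolding E_def using b d by linarith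
    then show ?thesis using h by linarith
  qed
  have Zb: "measure_pmf.prob ?p Z \<le> r"
  proof -
    have len: "length (centered_indices n) = n" by (simp add: centered_indices_def)
    have "measure_pmf.prob ?p Z \<le> 2 * exp (- (2 * (\<delta> * t)\<^sup>2 / (card {..<n} * (real n)\<^sup>2 * (6 * h)\<^sup>2)))"
      unfolding Z_def
    proof (rule uniform_perm_tail_bound[where lo = "- real n / 2" and c = "- (3 * h)"])
      show "- real n / 2 \<le> w \<and> w \<le> - real n / 2 + real n" if "w \<in> set (centered_indices n)" for w
        using that by (auto simp: centered_indices_def field_simps)
      show "sum_list (centered_indices n) = 0"
        using sum_centered[of n] by (simp add: centered_indices_def interv_sum_list_conv_sum_set_nat atLeast0LessThan)
      show "0 \<le> \<delta> * t" using \<delta> t by simp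
    qed (use n h0 E in \<open>auto simp: centered_indices_def lessThan_empty_iff\<close>)
    also have "\<dots> \<le> r"
    proof -
      have t2: "t\<^sup>2 = real n * ((real n)\<^sup>2 - 1) / 144"
        using n2 by (simp add: t_def uniform_score_sd_def power_divide)
      have "real n * ((real n)\<^sup>2 / 2) \<le> real n * ((real n)\<^sup>2 - 1)" using n4 by (intro mult_left_mono) auto
      then have "real n * (real n)\<^sup>2 / 288 \<le> t\<^sup>2" unfolding t2 by simp
      then have "\<delta>\<^sup>2 * (real n * (real n)\<^sup>2 / 288) \<le> \<delta>\<^sup>2 * t\<^sup>2" by (intro mult_left_mono) auto
      then have "2 * (\<delta>\<^sup>2 * (real n * (real n)\<^sup>2 / 288)) / (real n * (real n)\<^sup>2 * (6 * h)\<^sup>2) \<le> 2 * (\<delta>\<^sup>2 * t\<^sup>2) / (real n * (real n)\<^sup>2 * (6 * h)\<^sup>2)"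
        by (intro divide_right_mono) (linarith, simp)
      moreover have "2 * (\<delta>\<^sup>2 * (real n * (real n)\<^sup>2 / 288)) / (real n * (real n)\<^sup>2 * (6 * h)\<^sup>2) = \<delta>\<^sup>2 / (5184 * h\<^sup>2)"
        using n h0 by (simp add: power_mult_distrib field_simps)
      ultimately show ?thesis unfolding r_def by (simp add: power_mult_distrib)
    qed
    finally show ?thesis .
  qed
  have key: "\<bar>e * (uniform_score n (\<lambda>i\<in>{..<n}. \<omega> (\<pi> ! i)) / t) - e * (spearman_sum n (map R \<pi>) / spearman_sd n)\<bar> \<le> \<delta>"
    and sp: "(\<lambda>i\<in>{..<n}. \<omega> (\<pi> ! i)) \<in> space (uniform_sample n)"
    if \<pi>: "\<pi> \<in> permutations_of_set {..<n}" "\<pi> \<notin> Z" for \<pi>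
  proof -
    have d: "distinct \<pi>" "set \<pi> = {..<n}" using \<pi> by (auto dest: permutations_of_setD)
    then have l: "length \<pi> = n" using distinct_card by fastforce
    have "\<omega> (\<pi> ! i) \<in> space uniform01" for i by simp
    then show "(\<lambda>i\<in>{..<n}. \<omega> (\<pi> ! i)) \<in> space (uniform_sample n)" by (simp add: space_PiM)
    have ct: "spearman_sd n = t / c"
    proof -
      have "t / c = sqrt (real n * ((real n)\<^sup>2 - 1) * (real n * (real n + 1))) / 12"
        by (simp add: t_def uniform_score_sd_def c_def real_sqrt_mult)
      also have "real n * ((real n)\<^sup>2 - 1) * (real n * (real n + 1)) = (real n * (real n + 1))\<^sup>2 * (real n - 1)"
        by (simp add: power2_eq_square algebra_simps)
      also have "sqrt \<dots> = real n * (real n + 1) * sqrt (real n - 1)" by (simp add: real_sqrt_mult)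
      finally show ?thesis by (simp add: spearman_sd_def)
    qed
    have c0: "c \<noteq> 0" using n by (simp add: c_def)
    have "uniform_score n (\<lambda>i\<in>{..<n}. \<omega> (\<pi> ! i)) = uniform_score n (\<lambda>i. \<omega> (\<pi> ! i))"
      unfolding uniform_score_def by (intro sum.cong) auto
    also have "\<dots> = uniform_score n (\<lambda>i. E (\<pi> ! i)) + c * uniform_score n (\<lambda>i. real (R (\<pi> ! i)))"
      unfolding uniform_score_def E_def sum_distrib_left sum.distrib[symmetric] by (intro sum.cong) (auto simp: algebra_simps)
    also have "uniform_score n (\<lambda>i. real (R (\<pi> ! i))) = spearman_sum n (map R \<pi>)"
      unfolding spearman_sum_def using l by (subst sum_list_zip_centered) (auto simp: uniform_score_def)
    finally have U: "uniform_score n (\<lambda>i\<in>{..<n}. \<omega> (\<pi> ! i)) = uniform_score n (\<lambda>i. E (\<pi> ! i)) + c * spearman_sum n (map R \<pi>)" .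
    have "e * (uniform_score n (\<lambda>i\<in>{..<n}. \<omega> (\<pi> ! i)) / t) - e * (spearman_sum n (map R \<pi>) / spearman_sd n)
      = e * uniform_score n (\<lambda>i. E (\<pi> ! i)) / t"
      unfolding U ct using c0 t by (simp add: field_simps)
    moreover have "\<bar>uniform_score n (\<lambda>i. E (\<pi> ! i))\<bar> < \<delta> * t"
      using \<pi>(2) sum_list_zip_centered[OF l, of E] by (simp add: Z_def)
    ultimately show "\<bar>e * (uniform_score n (\<lambda>i\<in>{..<n}. \<omega> (\<pi> ! i)) / t) - e * (spearman_sum n (map R \<pi>) / spearman_sd n)\<bar> \<le> \<delta>"
      using t e by (simp add: abs_mult field_simps)
  qed
  have pS: "pS y = measure_pmf.prob ?p {\<pi>. y \<le> e * (spearman_sum n (map R \<pi>) / spearman_sd n)}" for y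
    unfolding pS_def mapR[symmetric] by (simp add: vimage_def)
  have mono: "measure_pmf.prob ?p A \<le> measure_pmf.prob ?p B + r" if "\<And>\<pi>. \<pi> \<in> permutations_of_set {..<n} \<Longrightarrow> \<pi> \<notin> Z \<Longrightarrow> \<pi> \<in> A \<Longrightarrow> \<pi> \<in> B" for A B
  proof -
    have "measure_pmf.prob ?p A \<le> measure_pmf.prob ?p (B \<union> Z)"
    proof (rule measure_pmf.finite_measure_mono_AE)
      show "AE \<pi> in ?p. \<pi> \<in> A \<longrightarrow> \<pi> \<in> B \<union> Z"
        unfolding AE_measure_pmf_iff using that by auto
    qed simp
    also have "\<dots> \<le> measure_pmf.prob ?p B + measure_pmf.prob ?p Z" by (intro measure_Un_le) auto
    finally show ?thesis using Zb by linarith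
  qed
  show "Q y \<le> pS (y - \<delta>) + r"
    unfolding Q_def pS
  proof (rule mono)
    fix \<pi> assume "\<pi> \<in> permutations_of_set {..<n}" "\<pi> \<notin> Z"
    from key[OF this] show "\<pi> \<in> {\<pi>. (\<lambda>i\<in>{..<n}. \<omega> (\<pi> ! i)) \<in> {\<omega>\<in>space (uniform_sample n). y \<le> e * (uniform_score n \<omega> / uniform_score_sd n)}} \<Longrightarrow>
       \<pi> \<in> {\<pi>. y - \<delta> \<le> e * (spearman_sum n (map R \<pi>) / spearman_sd n)}"
      unfolding t_def mem_Collect_eq by linarith
  qed
  show "pS y \<le> Q (y - \<delta>) + r"
    unfolding Q_def pS
  proof (rule mono)
    fix \<pi> assume \<pi>: "\<pi> \<in> permutations_of_set {..<n}" "\<pi> \<notin> Z"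
    assume "\<pi> \<in> {\<pi>. y \<le> e * (spearman_sum n (map R \<pi>) / spearman_sd n)}"
    then have y: "y \<le> e * (spearman_sum n (map R \<pi>) / spearman_sd n)" by (rule CollectD)
    have "v - d \<le> a" if "\<bar>a - b\<bar> \<le> d" "v \<le> b" for a b d v :: real
      using that by linarith
    from this[OF key[OF \<pi>] y] have "y - \<delta> \<le> e * (uniform_score n (\<lambda>i\<in>{..<n}. \<omega> (\<pi> ! i)) / uniform_score_sd n)"
      unfolding t_def .
    with sp[OF \<pi>] show "\<pi> \<in> {\<pi>. (\<lambda>i\<in>{..<n}. \<omega> (\<pi> ! i)) \<in> {\<omega>\<in>space (uniform_sample n). y - \<delta> \<le> e * (uniform_score n \<omega> / uniform_score_sd n)}}"
      unfolding mem_Collect_eq by (rule conjI)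
  qed
qed

text \<open>Averaging the conditional comparison over the sample; on the event that the empirical distribution
function is far from the identity the probabilities are bounded by one.\<close>

lemma spearman_uniform_comparison:
  assumes n: "2 \<le> n" and e: "\<bar>e\<bar> = 1" and \<delta>: "0 \<le> \<delta>" and h: "1 / real n \<le> h"
  defines "pW \<equiv> \<lambda>y. measure (uniform_sample n) {\<omega>\<in>space (uniform_sample n). y \<le> e * (uniform_score n \<omega> / uniform_score_sd n)}"
    and "pS \<equiv> \<lambda>y. measure_pmf.prob (uniform_perm {1..n}) {ys. y \<le> e * (spearman_sum n ys / spearman_sd n)}"
    and "r \<equiv> 2 * exp (- (\<delta>\<^sup>2 / (5184 * h\<^sup>2))) + 2 * (real n + 1) * exp (- (2 * real n * h\<^sup>2))"
  shows "pW y \<le> pS (y - \<delta>) + r" and "pS y \<le> pW (y - \<delta>) + r"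
proof -
  interpret P: prob_space "uniform_sample n" by (rule prob_space_uniform_sample)
  define B where "B = empirical_discrepancy n h"
  define q where "q = 2 * exp (- (\<delta>\<^sup>2 / (5184 * h\<^sup>2)))"
  define A where "A y = {\<omega>\<in>space (uniform_sample n). y \<le> e * (uniform_score n \<omega> / uniform_score_sd n)}" for y
  define Q where "Q \<omega> y = measure_pmf.prob (uniform_perm {..<n}) {\<pi>. (\<lambda>i\<in>{..<n}. \<omega> (\<pi> ! i)) \<in> A y}" for \<omega> y
  have A: "A y \<in> P.events" for y unfolding A_def by measurable
  have B: "B \<in> P.events" unfolding B_def by (rule empirical_discrepancy_measurable)
  have "0 \<le> h" using order_trans[OF _ h, of 0] by simp
  then have PB: "P.prob B \<le> 2 * (real n + 1) * exp (- (2 * real n * h\<^sup>2))"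
    unfolding B_def using n by (intro empirical_discrepancy_bound) auto
  have W: "pW y = (\<integral>\<omega>. Q \<omega> y \<partial>uniform_sample n)" for y
    unfolding pW_def Q_def A_def[symmetric] by (rule uniform_sample_average(1)[OF A])
  have Qint: "integrable (uniform_sample n) (\<lambda>\<omega>. Q \<omega> y)" for y
    unfolding Q_def by (rule P.integrable_const_bound[where B=1]) (auto intro: uniform_sample_average(2)[OF A])
  have iB: "integrable (uniform_sample n) (indicator B :: _ \<Rightarrow> real)" using B by (simp add: P.emeasure_eq_measure)
  have q0: "0 \<le> q" by (simp add: q_def)
  have pS01: "0 \<le> pS y" "pS y \<le> 1" for y unfolding pS_def by auto
  have Q01: "0 \<le> Q \<omega> y" "Q \<omega> y \<le> 1" for \<omega> y unfolding Q_def by auto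
  have comp: "AE \<omega> in uniform_sample n. Q \<omega> y \<le> pS (y - \<delta>) + q + indicator B \<omega> \<and> pS y \<le> Q \<omega> (y - \<delta>) + q + indicator B \<omega>" for y
    using AE_uniform_sample AE_space
  proof eventually_elim
    case (elim \<omega>)
    show ?case
    proof (cases "\<omega> \<in> B")
      case True
      then show ?thesis using pS01[of "y - \<delta>"] pS01[of y] Q01[of \<omega> y] Q01[of \<omega> "y - \<delta>"] q0 by simp
    next
      case False
      note g = spearman_uniform_conditional[OF n e \<delta> h elim(2) False[unfolded B_def]]
      show ?thesis using g[of y] elim False unfolding Q_def pS_def q_def A_def by simp
    qed
  qed
  have c1: "integrable (uniform_sample n) (\<lambda>\<omega>. a + indicator B \<omega>)" for a :: real
    using iB by (intro Bochner_Integration.integrable_add) auto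
  have i1: "(\<integral>\<omega>. a + indicator B \<omega> \<partial>uniform_sample n) = a + P.prob B" for a :: real
    using iB B P.prob_space by (subst Bochner_Integration.integral_add) auto
  have "pW y \<le> (\<integral>\<omega>. (pS (y - \<delta>) + q) + indicator B \<omega> \<partial>uniform_sample n)"
    unfolding W using comp[of y] by (intro integral_mono_AE Qint c1) auto
  then show "pW y \<le> pS (y - \<delta>) + r" unfolding i1 r_def q_def[symmetric] using PB by linarith
  have "(\<integral>\<omega>. pS y \<partial>uniform_sample n) \<le> (\<integral>\<omega>. Q \<omega> (y - \<delta>) + (q + indicator B \<omega>) \<partial>uniform_sample n)"
  proof (intro integral_mono_AE)
    show "AE \<omega> in uniform_sample n. pS y \<le> Q \<omega> (y - \<delta>) + (q + indicator B \<omega>)"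
      using comp[of y] by eventually_elim linarith
  qed (intro Qint c1 Bochner_Integration.integrable_add P.integrable_const)+
  also have "(\<integral>\<omega>. Q \<omega> (y - \<delta>) + (q + indicator B \<omega>) \<partial>uniform_sample n) = pW (y - \<delta>) + (q + P.prob B)"
    by (subst Bochner_Integration.integral_add) (auto simp: W i1 intro: Qint c1)
  finally show "pS y \<le> pW (y - \<delta>) + r"
    unfolding r_def q_def[symmetric] using PB P.prob_space by simp
qed

text \<open>Two statistics that differ by less than \<open>\<epsilon> / x\<close> up to negligible probability have the same tail
asymptotics, since the limit \<open>exp (- \<eta>)\<close> is continuous in \<open>\<eta>\<close>.\<close>

lemma tail_limit_perturb:
  fixes pW pS :: "nat \<Rightarrow> real \<Rightarrow> real" and x q :: "nat \<Rightarrow> real"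
  assumes W: "\<And>\<eta>. (\<lambda>n. q n * pW n (x n + \<eta> / x n)) \<longlonglongrightarrow> exp (- \<eta>)"
    and q: "\<forall>\<^sub>F n in sequentially. 0 \<le> q n"
    and upper: "\<And>\<epsilon>. 0 < \<epsilon> \<Longrightarrow> \<forall>\<^sub>F n in sequentially. pS n (x n + \<eta> / x n) \<le> pW n (x n + (\<eta> - \<epsilon>) / x n) + r \<epsilon> n"
    and lower: "\<And>\<epsilon>. 0 < \<epsilon> \<Longrightarrow> \<forall>\<^sub>F n in sequentially. pW n (x n + (\<eta> + \<epsilon>) / x n) \<le> pS n (x n + \<eta> / x n) + r \<epsilon> n"
    and r: "\<And>\<epsilon>. 0 < \<epsilon> \<Longrightarrow> (\<lambda>n. q n * r \<epsilon> n) \<longlonglongrightarrow> 0"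
  shows "(\<lambda>n. q n * pS n (x n + \<eta> / x n)) \<longlonglongrightarrow> exp (- \<eta>)"
proof (rule order_tendstoI)
  fix a assume a: "exp (- \<eta>) < a"
  have "((\<lambda>\<epsilon>. exp (- (\<eta> - \<epsilon>))) \<longlongrightarrow> exp (- (\<eta> - 0))) (at_right 0)" by (intro tendsto_intros)
  then have "\<forall>\<^sub>F \<epsilon> in at_right 0. exp (- (\<eta> - \<epsilon>)) < a" using a by (auto dest: order_tendstoD)
  from eventually_happens'[OF trivial_limit_at_right_real eventually_conj[OF eventually_at_right_less this]]
  obtain \<epsilon> where \<epsilon>: "0 < \<epsilon>" "exp (- (\<eta> - \<epsilon>)) < a" by blast
  have "(\<lambda>n. q n * pW n (x n + (\<eta> - \<epsilon>) / x n) + q n * r \<epsilon> n) \<longlonglongrightarrow> exp (- (\<eta> - \<epsilon>)) + 0"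
    by (intro tendsto_add W r \<epsilon>)
  then have "\<forall>\<^sub>F n in sequentially. q n * pW n (x n + (\<eta> - \<epsilon>) / x n) + q n * r \<epsilon> n < a"
    using \<epsilon> by (intro order_tendstoD) auto
  then show "\<forall>\<^sub>F n in sequentially. q n * pS n (x n + \<eta> / x n) < a"
    using upper[OF \<epsilon>(1)] q
  proof eventually_elim
    case (elim n)
    have "q n * pS n (x n + \<eta> / x n) \<le> q n * (pW n (x n + (\<eta> - \<epsilon>) / x n) + r \<epsilon> n)"
      using elim by (intro mult_left_mono)
    then show ?case using elim by (simp add: distrib_left)
  qed
next
  fix a assume a: "a < exp (- \<eta>)"
  have "((\<lambda>\<epsilon>. exp (- (\<eta> + \<epsilon>))) \<longlongrightarrow> exp (- (\<eta> + 0))) (at_right 0)" by (intro tendsto_intros)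
  then have "\<forall>\<^sub>F \<epsilon> in at_right 0. a < exp (- (\<eta> + \<epsilon>))" using a by (auto dest: order_tendstoD)
  from eventually_happens'[OF trivial_limit_at_right_real eventually_conj[OF eventually_at_right_less this]]
  obtain \<epsilon> where \<epsilon>: "0 < \<epsilon>" "a < exp (- (\<eta> + \<epsilon>))" by blast
  have "(\<lambda>n. q n * pW n (x n + (\<eta> + \<epsilon>) / x n) - q n * r \<epsilon> n) \<longlonglongrightarrow> exp (- (\<eta> + \<epsilon>)) - 0"
    by (intro tendsto_diff W r \<epsilon>)
  then have "\<forall>\<^sub>F n in sequentially. a < q n * pW n (x n + (\<eta> + \<epsilon>) / x n) - q n * r \<epsilon> n"
    using \<epsilon> by (intro order_tendstoD) auto
  then show "\<forall>\<^sub>F n in sequentially. a < q n * pS n (x n + \<eta> / x n)"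
    using lower[OF \<epsilon>(1)] q
  proof eventually_elim
    case (elim n)
    have "q n * pW n (x n + (\<eta> + \<epsilon>) / x n) \<le> q n * (pS n (x n + \<eta> / x n) + r \<epsilon> n)"
      using elim by (intro mult_left_mono)
    then show ?case using elim by (simp add: distrib_left)
  qed
qed

lemma cube_rate_imp_square_rate:
  assumes x: "filterlim x at_top sequentially" and rate: "(\<lambda>n. x n ^ 3 / sqrt (real n)) \<longlonglongrightarrow> 0" and \<kappa>: "0 < \<kappa>"
  shows "\<forall>\<^sub>F n in sequentially. (x n)\<^sup>2 \<le> \<kappa> * real n powr (1 / 3)"
proof -
  have "\<forall>\<^sub>F n in sequentially. x n ^ 3 / sqrt (real n) < \<kappa> powr (3 / 2)"
    using rate \<kappa> by (intro order_tendstoD) auto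
  then show ?thesis using eventually_gt_at_top[of 0] x[unfolded filterlim_at_top_dense, rule_format, of 0]
  proof eventually_elim
    case (elim n)
    have "x n ^ 3 < \<kappa> powr (3 / 2) * sqrt (real n)" using elim by (simp add: field_simps)
    also have "\<dots> = (\<kappa> * real n powr (1 / 3)) powr (3 / 2)"
      using elim \<kappa> by (simp add: powr_mult powr_powr powr_half_sqrt)
    finally have "(x n ^ 3) powr (2 / 3) \<le> ((\<kappa> * real n powr (1 / 3)) powr (3 / 2)) powr (2 / 3)"
      using elim by (intro powr_mono2) auto
    moreover have "(x n ^ 3) powr (2 / 3) = (x n)\<^sup>2"
    proof -
      have "x n ^ 3 = x n powr 3" using powr_realpow[of "x n" 3] elim by simp
      then have "(x n ^ 3) powr (2 / 3) = x n powr 2" by (simp add: powr_powr)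
      also have "\<dots> = (x n)\<^sup>2" using powr_realpow[of "x n" 2] elim by simp
      finally show ?thesis .
    qed
    ultimately show ?case using elim \<kappa> by (simp add: powr_powr)
  qed
qed

lemma std_normal_density_inverse_bound:
  assumes "0 \<le> x" shows "x / std_normal_density x \<le> 3 * exp (x\<^sup>2)"
proof -
  have "x \<le> exp (x\<^sup>2 / 2)"
  proof -
    have "0 \<le> (x - 1)\<^sup>2" by simp
    then have "x \<le> 1 + x\<^sup>2 / 2" by (simp add: power2_diff)
    also have "\<dots> \<le> exp (x\<^sup>2 / 2)" by (rule exp_ge_add_one_self)
    finally show ?thesis .
  qed
  moreover have "sqrt (2 * pi) \<le> 3"
    using pi_less_4 by (intro real_le_lsqrt) auto
  ultimately have "sqrt (2 * pi) * (x * exp (x\<^sup>2 / 2)) \<le> 3 * (exp (x\<^sup>2 / 2) * exp (x\<^sup>2 / 2))"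
    using assms by (intro mult_mono) auto
  also have "exp (x\<^sup>2 / 2) * exp (x\<^sup>2 / 2) = exp (x\<^sup>2)" by (simp add: mult_exp_exp)
  finally show ?thesis by (simp add: std_normal_density_def exp_minus field_simps)
qed

lemma sum_centered_squares: "2 \<le> n \<Longrightarrow> (\<Sum>i<n. ((real i - (real n - 1) / 2) / uniform_score_sd n)\<^sup>2 / 12) = 1"
proof -
  assume n: "2 \<le> n"
  have "4 \<le> (real n)\<^sup>2" using power_mono[of 2 "real n" 2] n by simp
  then have t2: "(uniform_score_sd n)\<^sup>2 = real n * ((real n)\<^sup>2 - 1) / 144" "0 < real n * ((real n)\<^sup>2 - 1) / 144"
    using n by (simp_all add: uniform_score_sd_def power_divide)
  have "(\<Sum>i<n. (real i - (real n - 1) / 2)\<^sup>2) = (\<Sum>i<n. (real i)\<^sup>2 - (real n - 1) * real i + ((real n - 1) / 2)\<^sup>2)"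
    by (intro sum.cong) (auto simp: power2_eq_square algebra_simps)
  also have "\<dots> = real n * (real n - 1) * (2 * real n - 1) / 6 - (real n - 1) * (real n * (real n - 1) / 2) + real n * ((real n - 1) / 2)\<^sup>2"
    by (simp only: sum.distrib sum_subtractf sum_distrib_left[symmetric] sum_lessThan_real sum_lessThan_squares_real) simp
  also have "\<dots> = 12 * (real n * ((real n)\<^sup>2 - 1) / 144)"
    by (simp add: power2_eq_square field_simps)
  finally have "(\<Sum>i<n. (real i - (real n - 1) / 2)\<^sup>2) = 12 * (uniform_score_sd n)\<^sup>2" unfolding t2 .
  moreover have "(uniform_score_sd n)\<^sup>2 \<noteq> 0" using t2 by linarith
  ultimately show ?thesis by (simp add: power_divide sum_divide_distrib[symmetric])
qed

text \<open>The score of a uniform sample is a weighted sum of independent variables, to which \<open>moderate_deviation\<close>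
applies. The comparison with Spearman's sum is used with discrepancy \<open>h = n powr (- (1 / 3))\<close> and
distance \<open>\<epsilon> / x\<close>. Both error terms are then of the form \<open>exp (- 2 u)\<close> with \<open>u = n powr (1 / 3)\<close>,
whereas the reciprocal Gaussian tail is at most of order \<open>exp (x\<^sup>2)\<close> and \<open>x\<^sup>2\<close> is of smaller order
than \<open>u\<close>.\<close>

theorem moderately_gaussian_spearman:
  assumes e: "e = 1 \<or> e = - 1"
  shows "moderately_gaussian (\<lambda>n ys. e * (spearman_sum n ys / spearman_sd n))"
  unfolding moderately_gaussian_def
proof (intro allI impI)
  fix x \<eta> assume x: "filterlim x at_top sequentially" and rate: "(\<lambda>n. x n ^ 3 / sqrt (real n)) \<longlonglongrightarrow> 0"
  have e1: "\<bar>e\<bar> = 1" "e\<^sup>2 = 1" using e by auto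
  have xpos: "\<forall>\<^sub>F n in sequentially. 0 < x n" using x by (simp add: filterlim_at_top_dense)
  define q where "q n = x n / std_normal_density (x n)" for n
  define pW where "pW n y = measure (uniform_sample n) {\<omega>\<in>space (uniform_sample n). y \<le> e * (uniform_score n \<omega> / uniform_score_sd n)}" for n y
  define pS where "pS n y = measure_pmf.prob (uniform_perm {1..n}) {ys. y \<le> e * (spearman_sum n ys / spearman_sd n)}" for n y
  define h where "h n = real n powr (- (1 / 3))" for n
  define r where "r \<epsilon> n = 2 * exp (- ((\<epsilon> / x n)\<^sup>2 / (5184 * (h n)\<^sup>2))) + 2 * (real n + 1) * exp (- (2 * real n * (h n)\<^sup>2))" for \<epsilon> n
  have hn: "\<forall>\<^sub>F n in sequentially. 2 \<le> n \<and> 1 / real n \<le> h n"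
    using eventually_ge_at_top[of 2]
  proof eventually_elim
    case (elim n)
    have "1 / real n = real n powr (- 1)" using elim by (simp add: powr_minus_divide)
    also have "\<dots> \<le> h n" unfolding h_def using elim by (intro powr_mono) auto
    finally show ?case using elim by simp
  qed
  define c where "c n i = e * ((real i - (real n - 1) / 2) / uniform_score_sd n)" for n i
  have W: "(\<lambda>n. q n * pW n (x n + \<eta> / x n)) \<longlonglongrightarrow> exp (- \<eta>)" for \<eta>
  proof -
    have "(\<lambda>n. q n * measure (uniform_sample n) {\<omega>\<in>space (uniform_sample n). x n + \<eta> / x n \<le> (\<Sum>i\<in>{..<n}. c n i * (\<omega> i - 1 / 2))}) \<longlonglongrightarrow> exp (- \<eta>)"
      unfolding q_def
    proof (rule moderate_deviation[where b = "\<lambda>n. real n / uniform_score_sd n"])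
      show "prob_space.indep_vars (uniform_sample n) (\<lambda>_. borel) (\<lambda>i \<omega>. c n i * (\<omega> i - 1 / 2)) {..<n}" for n
        using prob_space.indep_vars_compose2[OF prob_space_uniform_sample uniform_sample_coordinates(1), of n "\<lambda>i u. c n i * (u - 1 / 2)" "\<lambda>_. borel"]
        by simp
      have sd0: "0 \<le> uniform_score_sd n" for n
      proof (cases "n = 0")
        case False
        then have "1 \<le> (real n)\<^sup>2" by (intro one_le_power) simp
        then show ?thesis unfolding uniform_score_sd_def by simp
      qed (simp add: uniform_score_sd_def)
      then show "0 \<le> real n / uniform_score_sd n" for n by simp
      show "AE \<omega> in uniform_sample n. \<bar>c n i * (\<omega> i - 1 / 2)\<bar> \<le> real n / uniform_score_sd n" if i: "i \<in> {..<n}" for n i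
        using AE_uniform_sample[of n]
      proof eventually_elim
        case (elim \<omega>)
        have "\<omega> i \<in> {0..1}" using elim i by auto
        then have "\<bar>\<omega> i - 1 / 2\<bar> \<le> 1" by (auto simp: abs_le_iff)
        moreover have "\<bar>c n i\<bar> \<le> real n / uniform_score_sd n"
        proof -
          have "\<bar>real i - (real n - 1) / 2\<bar> \<le> real n" using i by (auto simp: abs_le_iff field_simps)
          then show ?thesis unfolding c_def using sd0[of n] e1 by (simp add: abs_mult divide_right_mono)
        qed
        ultimately have "\<bar>c n i\<bar> * \<bar>\<omega> i - 1 / 2\<bar> \<le> real n / uniform_score_sd n * 1"
          by (intro mult_mono) (use sd0[of n] in auto)
        then show ?case by (simp add: abs_mult)
      qed
      have E: "(\<integral>\<omega>. f (\<omega> i) \<partial>uniform_sample n) = (\<integral>u. f u \<partial>uniform01)"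
        if "i < n" and [measurable]: "f \<in> borel_measurable borel" for f :: "real \<Rightarrow> real" and i n
        using that by (subst uniform_sample_coordinates(2)[OF that(1), symmetric]) (simp add: integral_distr)
      show "(\<integral>\<omega>. c n i * (\<omega> i - 1 / 2) \<partial>uniform_sample n) = 0" if i: "i \<in> {..<n}" for n i
        using i E[of i n "\<lambda>u. u - 1 / 2"] uniform01_moments(1) by simp
      have v: "(\<integral>\<omega>. (c n i * (\<omega> i - 1 / 2))\<^sup>2 \<partial>uniform_sample n) = ((real i - (real n - 1) / 2) / uniform_score_sd n)\<^sup>2 / 12" if i: "i \<in> {..<n}" for n i
      proof -
        have c2: "(c n i)\<^sup>2 = ((real i - (real n - 1) / 2) / uniform_score_sd n)\<^sup>2"
          unfolding c_def power_mult_distrib e1 by simp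
        have "(\<integral>\<omega>. (\<omega> i - 1 / 2)\<^sup>2 \<partial>uniform_sample n) = 1 / 12"
          using i E[of i n "\<lambda>u. (u - 1 / 2)\<^sup>2"] uniform01_moments(2) by simp
        then show ?thesis unfolding power_mult_distrib[of "c n i"] integral_mult_right_zero c2 by simp
      qed
      show "\<forall>\<^sub>F n in sequentially. (\<Sum>i\<in>{..<n}. \<integral>\<omega>. (c n i * (\<omega> i - 1 / 2))\<^sup>2 \<partial>uniform_sample n) = 1"
        using eventually_ge_at_top[of 2]
      proof eventually_elim
        case (elim n)
        then show ?case using sum_centered_squares[OF elim] by (subst sum.cong[OF refl v]) auto
      qed
      show "(\<lambda>n. real (card {..<n}) * (x n * (real n / uniform_score_sd n)) ^ 3) \<longlonglongrightarrow> 0"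
      proof -
        have "(\<lambda>n. real n * (real n / uniform_score_sd n) ^ 3 * sqrt (real n)) \<longlonglongrightarrow> 1728"
          unfolding uniform_score_sd_def by real_asymp
        from tendsto_mult[OF rate this] have "(\<lambda>n. x n ^ 3 / sqrt (real n) * (real n * (real n / uniform_score_sd n) ^ 3 * sqrt (real n))) \<longlonglongrightarrow> 0" by simp
        moreover have "\<forall>\<^sub>F n in sequentially. x n ^ 3 / sqrt (real n) * (real n * (real n / uniform_score_sd n) ^ 3 * sqrt (real n))
           = real (card {..<n}) * (x n * (real n / uniform_score_sd n)) ^ 3"
          using eventually_gt_at_top[of 0] by eventually_elim (simp add: power_mult_distrib power_divide)
        ultimately show ?thesis by (rule Lim_transform_eventually)
      qed
    qed (use x prob_space_uniform_sample in auto)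
    moreover have "(\<Sum>i\<in>{..<n}. c n i * (\<omega> i - 1 / 2)) = e * (uniform_score n \<omega> / uniform_score_sd n)" for n \<omega>
    proof -
      have "(\<Sum>i\<in>{..<n}. c n i * (\<omega> i - 1 / 2)) = (\<Sum>i<n. e / uniform_score_sd n * ((real i - (real n - 1) / 2) * \<omega> i)
          - e / uniform_score_sd n / 2 * (real i - (real n - 1) / 2))"
      proof (rule sum.cong)
        have "e * (a / s) * (w - 1 / 2) = e / s * (a * w) - e / s / 2 * a" for a s w
          by (simp add: right_diff_distrib)
        then show "c n i * (\<omega> i - 1 / 2) = e / uniform_score_sd n * ((real i - (real n - 1) / 2) * \<omega> i)
          - e / uniform_score_sd n / 2 * (real i - (real n - 1) / 2)" for i
          unfolding c_def by blast
      qed simp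
      also have "\<dots> = e / uniform_score_sd n * uniform_score n \<omega>"
        unfolding sum_subtractf sum_distrib_left[symmetric] by (simp add: uniform_score_def sum_lessThan_real)
      finally show ?thesis by simp
    qed
    ultimately show ?thesis unfolding pW_def by simp
  qed
  show "(\<lambda>n. x n / std_normal_density (x n) * measure_pmf.prob (uniform_perm {1..n}) {ys. x n + \<eta> / x n \<le> e * (spearman_sum n ys / spearman_sd n)}) \<longlonglongrightarrow> exp (- \<eta>)"
    unfolding q_def[symmetric] pS_def[symmetric]
  proof (rule tail_limit_perturb[OF W, where r = r])
    show "\<forall>\<^sub>F n in sequentially. 0 \<le> q n" using xpos by eventually_elim (simp add: q_def)
    fix \<epsilon> :: real assume \<epsilon>: "0 < \<epsilon>"
    show "\<forall>\<^sub>F n in sequentially. pS n (x n + \<eta> / x n) \<le> pW n (x n + (\<eta> - \<epsilon>) / x n) + r \<epsilon> n"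
      using hn xpos
    proof eventually_elim
      case (elim n)
      have eq: "x n + \<eta> / x n - \<epsilon> / x n = x n + (\<eta> - \<epsilon>) / x n" by (simp add: diff_divide_distrib)
      then show ?case using spearman_uniform_comparison(2)[of n e "\<epsilon> / x n" "h n" "x n + \<eta> / x n"] elim e1 \<epsilon>
        unfolding eq pS_def pW_def r_def by simp
    qed
    show "\<forall>\<^sub>F n in sequentially. pW n (x n + (\<eta> + \<epsilon>) / x n) \<le> pS n (x n + \<eta> / x n) + r \<epsilon> n"
      using hn xpos
    proof eventually_elim
      case (elim n)
      have eq: "x n + (\<eta> + \<epsilon>) / x n - \<epsilon> / x n = x n + \<eta> / x n" by (simp add: add_divide_distrib)
      then show ?case using spearman_uniform_comparison(1)[of n e "\<epsilon> / x n" "h n" "x n + (\<eta> + \<epsilon>) / x n"] elim e1 \<epsilon>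
        unfolding eq pS_def pW_def r_def by simp
    qed
    show "(\<lambda>n. q n * r \<epsilon> n) \<longlonglongrightarrow> 0"
    proof (rule tendsto_sandwich[OF _ _ tendsto_const])
      show "\<forall>\<^sub>F n in sequentially. 0 \<le> q n * r \<epsilon> n"
        using xpos by eventually_elim (simp add: q_def r_def)
      \<comment> \<open>With \<open>x\<^sup>2 \<le> \<kappa> u\<close>, the first exponent \<open>(\<epsilon> / x)\<^sup>2 / (5184 h\<^sup>2)\<close> is at least \<open>2 u\<close>, and \<open>q n\<close> is at most \<open>3 exp u\<close>.\<close>
      define \<kappa> where "\<kappa> = min 1 (\<epsilon>\<^sup>2 / 10368)"
      have \<kappa>: "0 < \<kappa>" "\<kappa> \<le> 1" "\<kappa> \<le> \<epsilon>\<^sup>2 / 10368" using \<epsilon> by (auto simp: \<kappa>_def)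
      show "\<forall>\<^sub>F n in sequentially. q n * r \<epsilon> n \<le> 3 * (2 * real n + 4) * exp (- (real n powr (1 / 3)))"
        using cube_rate_imp_square_rate[OF x rate \<kappa>(1)] xpos eventually_gt_at_top[of 0]
      proof eventually_elim
        case (elim n)
        define u where "u = real n powr (1 / 3)"
        note elim = elim[folded u_def]
        have u: "0 < u" using elim by (simp add: u_def)
        have x1: "(x n)\<^sup>2 \<le> u" using elim \<kappa> u mult_right_mono[of \<kappa> 1 u] by linarith
        have hh: "(h n)\<^sup>2 = 1 / u\<^sup>2" unfolding h_def powr_minus u_def by (simp only: power_divide inverse_eq_divide power_one)
        have u3: "real n = u * u\<^sup>2"
        proof -
          have "u * u\<^sup>2 = u ^ 3" by (simp add: power3_eq_cube power2_eq_square)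
          also have "\<dots> = u powr 3" using powr_realpow[OF u, of 3] by simp
          also have "\<dots> = real n" using elim by (simp add: u_def powr_powr)
          finally show ?thesis ..
        qed
        have nh: "2 * real n * (h n)\<^sup>2 = 2 * u"
          unfolding hh using u by (subst u3) (simp add: field_simps)
        have e1: "2 * u \<le> (\<epsilon> / x n)\<^sup>2 / (5184 * (h n)\<^sup>2)"
        proof -
          have "(x n)\<^sup>2 * 10368 \<le> \<epsilon>\<^sup>2 * u"
          proof -
            have "(x n)\<^sup>2 \<le> \<epsilon>\<^sup>2 / 10368 * u" using elim(1) \<kappa>(3) u mult_right_mono[of \<kappa> "\<epsilon>\<^sup>2 / 10368" u] by linarith
            then show ?thesis by simp
          qed
          then have "((x n)\<^sup>2 * 10368) * u \<le> (\<epsilon>\<^sup>2 * u) * u" using u by (intro mult_right_mono) auto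
          then have "2 * u * (5184 * (x n)\<^sup>2) \<le> \<epsilon>\<^sup>2 * u\<^sup>2" by (simp add: power2_eq_square mult_ac)
          then have "2 * u \<le> \<epsilon>\<^sup>2 * u\<^sup>2 / (5184 * (x n)\<^sup>2)" using elim by (simp add: pos_le_divide_eq)
          then show ?thesis unfolding hh by (simp add: power_divide mult_ac)
        qed
        have "r \<epsilon> n \<le> 2 * exp (- (2 * u)) + 2 * (real n + 1) * exp (- (2 * u))"
          unfolding r_def nh using e1 by simp
        also have "\<dots> = (2 * real n + 4) * exp (- (2 * u))" by (simp add: algebra_simps)
        finally have r: "r \<epsilon> n \<le> (2 * real n + 4) * exp (- (2 * u))" .
        have "q n \<le> 3 * exp u"
          using std_normal_density_inverse_bound[of "x n"] elim x1 unfolding q_def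
          by (meson exp_le_cancel_iff less_imp_le mult_left_mono order_trans zero_le_numeral)
        then have "q n * r \<epsilon> n \<le> (3 * exp u) * ((2 * real n + 4) * exp (- (2 * u)))"
          using r elim by (intro mult_mono) (auto simp: r_def)
        also have "\<dots> = 3 * (2 * real n + 4) * (exp u * exp (- (2 * u)))" by simp
        also have "exp u * exp (- (2 * u)) = exp (- u)" by (simp add: mult_exp_exp)
        finally show ?case unfolding u_def .
      qed
      show "(\<lambda>n. 3 * (2 * real n + 4) * exp (- (real n powr (1 / 3)))) \<longlonglongrightarrow> 0" by real_asymp
    qed
  qed
qed

section \<open>Poisson approximation for dissociated events\<close>

lemma (in prob_space) expectation_finite_range:
  fixes W :: "'a \<Rightarrow> nat" and f :: "nat \<Rightarrow> real"
  assumes [measurable]: "W \<in> measurable M (count_space UNIV)" and "B \<in> events"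
    and W: "\<And>\<omega>. \<omega> \<in> space M \<Longrightarrow> W \<omega> \<le> N"
  shows "expectation (\<lambda>\<omega>. indicator B \<omega> * f (W \<omega>)) = (\<Sum>w\<le>N. f w * prob (B \<inter> {\<omega>\<in>space M. W \<omega> = w}))"
    and "integrable M (\<lambda>\<omega>. indicator B \<omega> * f (W \<omega>))"
proof -
  note [measurable] = assms(2)
  have eq: "indicator B \<omega> * f (W \<omega>) = (\<Sum>w\<le>N. f w * indicator (B \<inter> {\<omega>\<in>space M. W \<omega> = w}) \<omega>)" if "\<omega> \<in> space M" for \<omega>
  proof -
    have "(\<Sum>w\<le>N. f w * indicator (B \<inter> {\<omega>\<in>space M. W \<omega> = w}) \<omega>) = (\<Sum>w\<le>N. if w = W \<omega> then indicator B \<omega> * f w else 0)"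
      using that by (intro sum.cong) (auto simp: indicator_def)
    then show ?thesis using W[OF that] by simp
  qed
  have i: "integrable M (\<lambda>\<omega>. f w * indicator (B \<inter> {\<omega>\<in>space M. W \<omega> = w}) \<omega>)" for w
    by (intro integrable_mult_right) (simp add: emeasure_eq_measure)
  have "integrable M (\<lambda>\<omega>. \<Sum>w\<le>N. f w * indicator (B \<inter> {\<omega>\<in>space M. W \<omega> = w}) \<omega>)"
    using i by (intro Bochner_Integration.integrable_sum)
  then show "integrable M (\<lambda>\<omega>. indicator B \<omega> * f (W \<omega>))"
    by (subst Bochner_Integration.integrable_cong[OF refl eq])
  have "expectation (\<lambda>\<omega>. indicator B \<omega> * f (W \<omega>)) = expectation (\<lambda>\<omega>. \<Sum>w\<le>N. f w * indicator (B \<inter> {\<omega>\<in>space M. W \<omega> = w}) \<omega>)"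
    by (intro Bochner_Integration.integral_cong eq refl)
  also have "\<dots> = (\<Sum>w\<le>N. expectation (\<lambda>\<omega>. f w * indicator (B \<inter> {\<omega>\<in>space M. W \<omega> = w}) \<omega>))"
    using i by (intro Bochner_Integration.integral_sum)
  also have "\<dots> = (\<Sum>w\<le>N. f w * prob (B \<inter> {\<omega>\<in>space M. W \<omega> = w}))"
    by (intro sum.cong) auto
  finally show "expectation (\<lambda>\<omega>. indicator B \<omega> * f (W \<omega>)) = (\<Sum>w\<le>N. f w * prob (B \<inter> {\<omega>\<in>space M. W \<omega> = w}))" .
qed

text \<open>Bernoulli's inequality.\<close>

lemma power_diff_bound:
  fixes t :: real assumes "0 \<le> t" "t \<le> 1" "a \<le> b"
  shows "\<bar>t ^ a - t ^ b\<bar> \<le> (1 - t) * real (b - a)"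
proof -
  have 1: "t ^ b = t ^ a * t ^ (b - a)" using assms by (simp flip: power_add)
  have 2: "1 - real (b - a) * (1 - t) \<le> t ^ (b - a)"
    using Bernoulli_inequality[of "t - 1" "b - a"] assms by (simp add: algebra_simps)
  have 3: "0 \<le> 1 - t ^ (b - a)" using assms by (simp add: power_le_one)
  have 4: "0 \<le> t ^ a" "t ^ a \<le> 1" using assms by (auto simp: power_le_one)
  have "t ^ a - t ^ b = t ^ a * (1 - t ^ (b - a))" by (simp add: 1 right_diff_distrib)
  moreover have "0 \<le> t ^ a * (1 - t ^ (b - a))" using 3 4 by simp
  moreover have "t ^ a * (1 - t ^ (b - a)) \<le> 1 * (1 - t ^ (b - a))" using 3 4 by (intro mult_right_mono)
  ultimately show ?thesis using 2 by (simp add: mult.commute)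
qed

text \<open>The generating function \<open>g s = E (1 - s)\<^sup>W\<close> of the number \<open>W\<close> of occurring events has derivative
\<open>- \<Sum>\<alpha>. E (1_\<alpha> (1 - s)\<^sup>W\<^sup>-\<^sup>1)\<close>. Removing the neighbourhood \<open>N \<alpha>\<close> from \<open>W\<close> makes the second factor
independent of the event \<open>\<alpha>\<close>, and costs at most \<open>m p\<^sup>2\<close> before and after factorizing.
So \<open>g\<close> nearly solves \<open>g' = - \<Lambda> g\<close> with \<open>g 0 = 1\<close>, and \<open>g 1\<close>, the probability that no event
occurs, is close to \<open>exp (- \<Lambda>)\<close>.\<close>

theorem (in prob_space) poisson_dissociated_bound:
  fixes A :: "'i \<Rightarrow> 'a set" and N :: "'i \<Rightarrow> 'i set"
  assumes fin: "finite I" and A: "\<And>\<alpha>. \<alpha> \<in> I \<Longrightarrow> A \<alpha> \<in> events"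
    and N: "\<And>\<alpha>. \<alpha> \<in> I \<Longrightarrow> \<alpha> \<in> N \<alpha> \<and> N \<alpha> \<subseteq> I" and m: "\<And>\<alpha>. \<alpha> \<in> I \<Longrightarrow> card (N \<alpha>) \<le> m"
    and p: "\<And>\<alpha>. \<alpha> \<in> I \<Longrightarrow> prob (A \<alpha>) = p"
    and pair: "\<And>\<alpha> \<beta>. \<alpha> \<in> I \<Longrightarrow> \<beta> \<in> N \<alpha> \<Longrightarrow> \<beta> \<noteq> \<alpha> \<Longrightarrow> prob (A \<alpha> \<inter> A \<beta>) = p\<^sup>2"
    and ind: "\<And>\<alpha> k. \<alpha> \<in> I \<Longrightarrow> prob (A \<alpha> \<inter> {\<omega>\<in>space M. card {\<beta>\<in>I - N \<alpha>. \<omega> \<in> A \<beta>} = k})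
        = p * prob {\<omega>\<in>space M. card {\<beta>\<in>I - N \<alpha>. \<omega> \<in> A \<beta>} = k}"
  shows "\<bar>prob {\<omega>\<in>space M. \<forall>\<alpha>\<in>I. \<omega> \<notin> A \<alpha>} - exp (- (real (card I) * p))\<bar> \<le> 2 * real (card I) * real m * p\<^sup>2"
proof -
  define C where "C J \<omega> = card {\<beta>\<in>J. \<omega> \<in> A \<beta>}" for J \<omega>
  have Creal: "real (C J \<omega>) = (\<Sum>\<beta>\<in>J. indicator (A \<beta>) \<omega>)" if "J \<subseteq> I" for J \<omega>
    using finite_subset[OF that fin] by (simp add: C_def indicator_def sum.If_cases Int_def)
  have Cm [measurable]: "C J \<in> measurable M (count_space UNIV)" if J: "J \<subseteq> I" for J
  proof -
    have "(\<lambda>\<omega>. real (C J \<omega>)) \<in> borel_measurable M"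
      using J A by (subst Creal[OF J]) (auto intro!: borel_measurable_sum)
    then have "(\<lambda>\<omega>. nat \<lfloor>real (C J \<omega>)\<rfloor>) \<in> measurable M (count_space UNIV)" by measurable
    then show ?thesis by simp
  qed
  have CN: "C J \<omega> \<le> card I" if "J \<subseteq> I" for J \<omega>
    unfolding C_def using that fin by (intro card_mono) auto
  have p0: "0 \<le> p" if "I \<noteq> {}" using p that measure_nonneg by (metis all_not_in_conv)
  define g where "g s = expectation (\<lambda>\<omega>. (1 - s) ^ C I \<omega>)" for s :: real
  define g' where "g' s = - (\<Sum>\<alpha>\<in>I. expectation (\<lambda>\<omega>. indicator (A \<alpha>) \<omega> * (1 - s) ^ (C I \<omega> - 1)))" for s :: real
  have ge: "g s = (\<Sum>w\<le>card I. (1 - s) ^ w * prob {\<omega>\<in>space M. C I \<omega> = w})" for s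
  proof -
    have "g s = expectation (\<lambda>\<omega>. indicator (space M) \<omega> * (1 - s) ^ C I \<omega>)"
      unfolding g_def by (intro Bochner_Integration.integral_cong) auto
    also have "\<dots> = (\<Sum>w\<le>card I. (1 - s) ^ w * prob (space M \<inter> {\<omega>\<in>space M. C I \<omega> = w}))"
      using Cm CN by (intro expectation_finite_range(1)) auto
    finally show ?thesis by (simp add: Int_absorb1 Collect_subset)
  qed
  have ge': "g' s = (\<Sum>w\<le>card I. - (real w * (1 - s) ^ (w - 1)) * prob {\<omega>\<in>space M. C I \<omega> = w})" for s
  proof -
    have i: "integrable M (\<lambda>\<omega>. indicator (A \<alpha>) \<omega> * (1 - s) ^ (C I \<omega> - 1))" if "\<alpha> \<in> I" for \<alpha>
      using Cm[of I] CN[of I] A[OF that] by (intro expectation_finite_range(2)[where f = "\<lambda>w. (1 - s) ^ (w - 1)"]) auto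
    have "g' s = - expectation (\<lambda>\<omega>. \<Sum>\<alpha>\<in>I. indicator (A \<alpha>) \<omega> * (1 - s) ^ (C I \<omega> - 1))"
      unfolding g'_def using i by (subst Bochner_Integration.integral_sum) auto
    also have "\<dots> = - expectation (\<lambda>\<omega>. indicator (space M) \<omega> * (real (C I \<omega>) * (1 - s) ^ (C I \<omega> - 1)))"
      by (intro arg_cong[where f = uminus] Bochner_Integration.integral_cong refl)
         (simp add: sum_distrib_right[symmetric] Creal)
    also have "\<dots> = - (\<Sum>w\<le>card I. real w * (1 - s) ^ (w - 1) * prob (space M \<inter> {\<omega>\<in>space M. C I \<omega> = w}))"
      using Cm CN by (subst expectation_finite_range(1)[where f = "\<lambda>w. real w * (1 - s) ^ (w - 1)" and N = "card I"]) auto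
    finally show ?thesis by (simp add: Int_absorb1 Collect_subset sum_negf)
  qed
  have deriv: "(g has_real_derivative g' s) (at s)" for s
    unfolding ge[abs_def] ge' by (auto intro!: derivative_eq_intros simp: mult_ac)
  define \<Lambda> where "\<Lambda> = real (card I) * p"
  define B where "B = 2 * real (card I) * real m * p\<^sup>2"
  have step: "\<bar>g' s + \<Lambda> * g s\<bar> \<le> B" if s: "0 \<le> s" "s \<le> 1" for s
  proof -
    have one: "\<bar>expectation (\<lambda>\<omega>. indicator (A \<alpha>) \<omega> * (1 - s) ^ (C I \<omega> - 1)) - p * g s\<bar> \<le> 2 * real m * p\<^sup>2" if \<alpha>: "\<alpha> \<in> I" for \<alpha>
    proof -
      have p0: "0 \<le> p" using \<alpha> p0 by auto
      let ?J = "I - N \<alpha>" and ?V = "N \<alpha> - {\<alpha>}"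
      have fN: "finite (N \<alpha>)" using N[OF \<alpha>] fin finite_subset by blast
      have split: "C I \<omega> = C (N \<alpha>) \<omega> + C ?J \<omega>" for \<omega>
      proof -
        have "{\<beta>\<in>I. \<omega> \<in> A \<beta>} = {\<beta>\<in>N \<alpha>. \<omega> \<in> A \<beta>} \<union> {\<beta>\<in>?J. \<omega> \<in> A \<beta>}" using N[OF \<alpha>] by auto
        then show ?thesis unfolding C_def using fN fin by (subst card_Un_disjoint[symmetric]) auto
      qed
      have splitN: "C (N \<alpha>) \<omega> = Suc (C ?V \<omega>)" if "\<omega> \<in> A \<alpha>" for \<omega>
      proof -
        have "{\<beta>\<in>N \<alpha>. \<omega> \<in> A \<beta>} = insert \<alpha> {\<beta>\<in>?V. \<omega> \<in> A \<beta>}" using N[OF \<alpha>] that by auto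
        then show ?thesis unfolding C_def using fN by simp
      qed
      have V: "?V \<subseteq> I" "?J \<subseteq> I" "N \<alpha> \<subseteq> I" using N[OF \<alpha>] by auto
      note Am = A[OF \<alpha>]
      let ?Z = "\<lambda>\<omega>. (1 - s) ^ C ?J \<omega>"
      have iZ: "integrable M (\<lambda>\<omega>. indicator (A \<alpha>) \<omega> * ?Z \<omega>)" "integrable M (\<lambda>\<omega>. indicator (space M) \<omega> * ?Z \<omega>)"
        using Cm[OF V(2)] CN[OF V(2)] Am by (intro expectation_finite_range(2)[where f = "\<lambda>w. (1 - s) ^ w"]; auto)+
      have iI: "integrable M (\<lambda>\<omega>. indicator (A \<alpha>) \<omega> * (1 - s) ^ (C I \<omega> - 1))" "integrable M (\<lambda>\<omega>. indicator (space M) \<omega> * (1 - s) ^ C I \<omega>)"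
        using Cm[of I] CN[of I] Am by (intro expectation_finite_range(2)[where f = "\<lambda>w. (1 - s) ^ (w - 1)"]; auto)
           (intro expectation_finite_range(2)[where f = "\<lambda>w. (1 - s) ^ w"]; use Cm[of I] CN[of I] in auto)
      have EZ: "expectation (\<lambda>\<omega>. indicator (A \<alpha>) \<omega> * ?Z \<omega>) = p * expectation (\<lambda>\<omega>. indicator (space M) \<omega> * ?Z \<omega>)"
      proof -
        have k: "prob (A \<alpha> \<inter> {\<omega>\<in>space M. C ?J \<omega> = k}) = p * prob (space M \<inter> {\<omega>\<in>space M. C ?J \<omega> = k})" for k
        proof -
          have "space M \<inter> {\<omega>\<in>space M. C ?J \<omega> = k} = {\<omega>\<in>space M. C ?J \<omega> = k}" by auto
          then show ?thesis unfolding C_def by (simp only: ind[OF \<alpha>])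
        qed
        show ?thesis
          unfolding expectation_finite_range(1)[OF Cm[OF V(2)] Am CN[OF V(2)], where f = "\<lambda>w. (1 - s) ^ w"]
            expectation_finite_range(1)[OF Cm[OF V(2)] sets.top CN[OF V(2)], where f = "\<lambda>w. (1 - s) ^ w"] k
          by (simp only: sum_distrib_left mult_ac)
      qed
      \<comment> \<open>Dropping the neighbours from the count matters only if the event occurs together with a neighbour.\<close>
      have a: "\<bar>expectation (\<lambda>\<omega>. indicator (A \<alpha>) \<omega> * (1 - s) ^ (C I \<omega> - 1)) - expectation (\<lambda>\<omega>. indicator (A \<alpha>) \<omega> * ?Z \<omega>)\<bar> \<le> real m * p\<^sup>2"
      proof -
        have ib: "integrable M (\<lambda>\<omega>. \<Sum>\<beta>\<in>?V. indicator (A \<alpha> \<inter> A \<beta>) \<omega> :: real)"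
          using Am A V by (intro Bochner_Integration.integrable_sum) (auto simp: emeasure_eq_measure)
        have "\<bar>expectation (\<lambda>\<omega>. indicator (A \<alpha>) \<omega> * (1 - s) ^ (C I \<omega> - 1)) - expectation (\<lambda>\<omega>. indicator (A \<alpha>) \<omega> * ?Z \<omega>)\<bar>
          = \<bar>expectation (\<lambda>\<omega>. indicator (A \<alpha>) \<omega> * (1 - s) ^ (C I \<omega> - 1) - indicator (A \<alpha>) \<omega> * ?Z \<omega>)\<bar>"
          using iI iZ by (subst Bochner_Integration.integral_diff) auto
        also have "\<dots> \<le> expectation (\<lambda>\<omega>. \<bar>indicator (A \<alpha>) \<omega> * (1 - s) ^ (C I \<omega> - 1) - indicator (A \<alpha>) \<omega> * ?Z \<omega>\<bar>)"
          by (rule integral_abs_bound)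
        also have "\<dots> \<le> expectation (\<lambda>\<omega>. \<Sum>\<beta>\<in>?V. indicator (A \<alpha> \<inter> A \<beta>) \<omega>)"
        proof (intro integral_mono integrable_abs Bochner_Integration.integrable_diff iI iZ ib)
          fix \<omega>
          show "\<bar>indicator (A \<alpha>) \<omega> * (1 - s) ^ (C I \<omega> - 1) - indicator (A \<alpha>) \<omega> * ?Z \<omega>\<bar> \<le> (\<Sum>\<beta>\<in>?V. indicator (A \<alpha> \<inter> A \<beta>) \<omega>)"
          proof (cases "\<omega> \<in> A \<alpha>")
            case True
            have "\<bar>(1 - s) ^ (C ?V \<omega> + C ?J \<omega>) - (1 - s) ^ C ?J \<omega>\<bar> \<le> s * real (C ?V \<omega>)"
              using power_diff_bound[of "1 - s" "C ?J \<omega>" "C ?V \<omega> + C ?J \<omega>"] s by (simp add: abs_minus_commute)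
            also have "\<dots> \<le> 1 * real (C ?V \<omega>)" using s by (intro mult_right_mono) auto
            also have "\<dots> = (\<Sum>\<beta>\<in>?V. indicator (A \<alpha> \<inter> A \<beta>) \<omega>)"
              using True by (simp add: Creal[OF V(1)] indicator_inter_arith)
            finally show ?thesis using True by (simp add: split[of \<omega>] splitN)
          qed (simp add: sum_nonneg)
        qed
        also have "\<dots> = (\<Sum>\<beta>\<in>?V. prob (A \<alpha> \<inter> A \<beta>))"
          using Am A V by (subst Bochner_Integration.integral_sum) (auto simp: emeasure_eq_measure intro!: sum.cong)
        also have "\<dots> = real (card ?V) * p\<^sup>2" using pair[OF \<alpha>] by simp
        also have "\<dots> \<le> real m * p\<^sup>2"
          using m[OF \<alpha>] card_mono[OF fN, of ?V] by (intro mult_right_mono) auto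
        finally show ?thesis .
      qed
      \<comment> \<open>After factorizing, the neighbours, now including \<open>\<alpha>\<close> itself, are put back.\<close>
      have b: "\<bar>expectation (\<lambda>\<omega>. indicator (space M) \<omega> * ?Z \<omega>) - g s\<bar> \<le> real m * p"
      proof -
        have gs: "g s = expectation (\<lambda>\<omega>. indicator (space M) \<omega> * (1 - s) ^ C I \<omega>)"
          unfolding g_def by (intro Bochner_Integration.integral_cong) auto
        have ib: "integrable M (\<lambda>\<omega>. \<Sum>\<beta>\<in>N \<alpha>. indicator (A \<beta>) \<omega> :: real)"
          using A V by (intro Bochner_Integration.integrable_sum) (auto simp: emeasure_eq_measure)
        have "\<bar>expectation (\<lambda>\<omega>. indicator (space M) \<omega> * ?Z \<omega>) - g s\<bar>
          = \<bar>expectation (\<lambda>\<omega>. indicator (space M) \<omega> * ?Z \<omega> - indicator (space M) \<omega> * (1 - s) ^ C I \<omega>)\<bar>"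
          unfolding gs using iI iZ by (subst Bochner_Integration.integral_diff) auto
        also have "\<dots> \<le> expectation (\<lambda>\<omega>. \<bar>indicator (space M) \<omega> * ?Z \<omega> - indicator (space M) \<omega> * (1 - s) ^ C I \<omega>\<bar>)"
          by (rule integral_abs_bound)
        also have "\<dots> \<le> expectation (\<lambda>\<omega>. \<Sum>\<beta>\<in>N \<alpha>. indicator (A \<beta>) \<omega>)"
        proof (intro integral_mono integrable_abs Bochner_Integration.integrable_diff iI iZ ib)
          fix \<omega> assume \<omega>: "\<omega> \<in> space M"
          have "\<bar>(1 - s) ^ C ?J \<omega> - (1 - s) ^ C I \<omega>\<bar> \<le> s * real (C (N \<alpha>) \<omega>)"
            using power_diff_bound[of "1 - s" "C ?J \<omega>" "C I \<omega>"] s split[of \<omega>] by simp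
          also have "\<dots> \<le> 1 * real (C (N \<alpha>) \<omega>)" using s by (intro mult_right_mono) auto
          finally show "\<bar>indicator (space M) \<omega> * ?Z \<omega> - indicator (space M) \<omega> * (1 - s) ^ C I \<omega>\<bar> \<le> (\<Sum>\<beta>\<in>N \<alpha>. indicator (A \<beta>) \<omega>)"
            using \<omega> by (simp add: Creal[OF V(3)])
        qed
        also have "\<dots> = (\<Sum>\<beta>\<in>N \<alpha>. prob (A \<beta>))"
          using A V by (subst Bochner_Integration.integral_sum) (auto simp: emeasure_eq_measure intro!: sum.cong)
        also have "\<dots> = real (card (N \<alpha>)) * p" using p V by (simp add: subset_eq)
        also have "\<dots> \<le> real m * p" using m[OF \<alpha>] p0 by (intro mult_right_mono) auto
        finally show ?thesis .
      qed
      have c: "\<bar>p * x - p * y\<bar> \<le> real m * p\<^sup>2" if "\<bar>x - y\<bar> \<le> real m * p" for x y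
        using mult_left_mono[OF that p0] p0 by (simp add: abs_mult right_diff_distrib[symmetric] power2_eq_square mult_ac)
      from a[unfolded EZ] c[OF b] show ?thesis by linarith
    qed
    have "g' s + \<Lambda> * g s = - (\<Sum>\<alpha>\<in>I. expectation (\<lambda>\<omega>. indicator (A \<alpha>) \<omega> * (1 - s) ^ (C I \<omega> - 1)) - p * g s)"
      unfolding g'_def \<Lambda>_def by (simp add: sum_subtractf)
    then have "\<bar>g' s + \<Lambda> * g s\<bar> \<le> (\<Sum>\<alpha>\<in>I. \<bar>expectation (\<lambda>\<omega>. indicator (A \<alpha>) \<omega> * (1 - s) ^ (C I \<omega> - 1)) - p * g s\<bar>)"
      using sum_abs[of "\<lambda>\<alpha>. expectation (\<lambda>\<omega>. indicator (A \<alpha>) \<omega> * (1 - s) ^ (C I \<omega> - 1)) - p * g s" I] by simp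
    also have "\<dots> \<le> (\<Sum>\<alpha>\<in>I. 2 * real m * p\<^sup>2)" by (intro sum_mono one)
    finally show ?thesis by (simp add: B_def mult_ac)
  qed
  \<comment> \<open>Mean value theorem for \<open>exp (\<Lambda> s) * g s\<close> on the unit interval.\<close>
  have "\<exists>z. 0 < z \<and> z < 1 \<and> exp (\<Lambda> * 1) * g 1 - exp (\<Lambda> * 0) * g 0 = (1 - 0) * (exp (\<Lambda> * z) * (g' z + \<Lambda> * g z))"
    by (rule MVT2) (auto intro!: derivative_eq_intros deriv simp: algebra_simps)
  then obtain z where z: "0 < z" "z < 1" and eq: "exp \<Lambda> * g 1 - g 0 = exp (\<Lambda> * z) * (g' z + \<Lambda> * g z)" by auto
  have \<Lambda>0: "0 \<le> \<Lambda>" using p0 by (cases "I = {}") (auto simp: \<Lambda>_def)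
  have "\<bar>exp \<Lambda> * g 1 - g 0\<bar> \<le> exp \<Lambda> * B"
    unfolding eq abs_mult using z \<Lambda>0 step[of z] by (intro mult_mono) (auto simp: mult_left_le)
  then have "exp (- \<Lambda>) * \<bar>exp \<Lambda> * g 1 - g 0\<bar> \<le> exp (- \<Lambda>) * (exp \<Lambda> * B)" by (intro mult_left_mono) auto
  moreover have "exp (- \<Lambda>) * \<bar>exp \<Lambda> * g 1 - g 0\<bar> = \<bar>g 1 - exp (- \<Lambda>) * g 0\<bar>"
  proof -
    have "exp (- \<Lambda>) * \<bar>exp \<Lambda> * g 1 - g 0\<bar> = \<bar>exp (- \<Lambda>) * (exp \<Lambda> * g 1 - g 0)\<bar>" by (simp add: abs_mult)
    also have "exp (- \<Lambda>) * (exp \<Lambda> * g 1 - g 0) = g 1 - exp (- \<Lambda>) * g 0"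
      by (simp add: right_diff_distrib mult.assoc[symmetric] mult_exp_exp)
    finally show ?thesis .
  qed
  moreover have "exp (- \<Lambda>) * (exp \<Lambda> * B) = B" by (simp add: mult.assoc[symmetric] mult_exp_exp)
  moreover have "g 0 = 1" unfolding g_def by (simp add: prob_space)
  moreover have "g 1 = prob {\<omega>\<in>space M. \<forall>\<alpha>\<in>I. \<omega> \<notin> A \<alpha>}"
  proof -
    have "g 1 = prob {\<omega>\<in>space M. C I \<omega> = 0}" unfolding ge by (simp add: zero_power sum.atMost_shift)
    also have "{\<omega>\<in>space M. C I \<omega> = 0} = {\<omega>\<in>space M. \<forall>\<alpha>\<in>I. \<omega> \<notin> A \<alpha>}"
      using fin by (auto simp: C_def)
    finally show ?thesis .
  qed
  ultimately show ?thesis unfolding \<Lambda>_def B_def by simp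
qed

section \<open>Pairs of independent identically distributed objects\<close>

lemma measurable_count_space_binary:
  fixes f :: "'a \<Rightarrow> 'b :: countable" and g :: "'a \<Rightarrow> 'c :: countable"
  assumes "f \<in> measurable M (count_space UNIV)" "g \<in> measurable M (count_space UNIV)"
  shows "(\<lambda>\<omega>. h (f \<omega>) (g \<omega>)) \<in> measurable M (count_space UNIV)"
proof -
  have "(\<lambda>\<omega>. (f \<omega>, g \<omega>)) \<in> measurable M (count_space UNIV \<Otimes>\<^sub>M count_space UNIV)"
    using assms by (rule measurable_Pair)
  also have "count_space (UNIV :: 'b set) \<Otimes>\<^sub>M count_space (UNIV :: 'c set) = count_space UNIV"
    by (subst pair_measure_countable) auto
  finally have "(\<lambda>p. h (fst p) (snd p)) \<circ> (\<lambda>\<omega>. (f \<omega>, g \<omega>)) \<in> measurable M (count_space UNIV)"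
    by (rule measurable_comp) simp
  then show ?thesis by (simp add: comp_def)
qed

lemma measurable_count_space_Pair:
  fixes f :: "'a \<Rightarrow> 'b :: countable" and g :: "'a \<Rightarrow> 'c :: countable"
  assumes "f \<in> measurable M (count_space UNIV)" "g \<in> measurable M (count_space UNIV)"
  shows "{\<omega>\<in>space M. R (f \<omega>) (g \<omega>)} \<in> sets M"
  using measurable_sets[OF measurable_count_space_binary[OF assms, where h = R], of "{True}"]
  by (simp add: vimage_def Int_def conj_commute)

locale iid_objects = prob_space M for M :: "'a measure" +
  fixes Q :: "nat \<Rightarrow> 'a \<Rightarrow> 'b :: countable" and \<mu> :: "'b pmf" and d :: nat
  assumes indep: "indep_vars (\<lambda>_. count_space UNIV) Q {1..d}"
    and law: "\<And>j. j \<in> {1..d} \<Longrightarrow> distr M (count_space UNIV) (Q j) = measure_pmf \<mu>"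
    and finite_law: "finite (set_pmf \<mu>)"
begin

lemma Q_measurable: "j \<in> {1..d} \<Longrightarrow> Q j \<in> measurable M (count_space UNIV)"
  using indep by (simp add: indep_vars_def2)

lemma prob_Q: "j \<in> {1..d} \<Longrightarrow> prob {\<omega>\<in>space M. Q j \<omega> \<in> S} = measure_pmf.prob \<mu> S"
  unfolding law[symmetric] by (subst measure_distr[OF Q_measurable]) (auto simp: vimage_def Int_def conj_commute)

lemma AE_Q_in_support: "j \<in> {1..d} \<Longrightarrow> AE \<omega> in M. Q j \<omega> \<in> set_pmf \<mu>"
proof -
  assume j: "j \<in> {1..d}"
  have "prob {\<omega>\<in>space M. Q j \<omega> \<in> set_pmf \<mu>} = 1"
    unfolding prob_Q[OF j] by (simp add: measure_pmf.prob_eq_1 AE_measure_pmf_iff)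
  moreover have "{\<omega>\<in>space M. Q j \<omega> \<in> set_pmf \<mu>} \<in> events"
    using measurable_sets[OF Q_measurable[OF j], of "set_pmf \<mu>"] by (simp add: vimage_def Int_def conj_commute)
  ultimately show ?thesis by (simp add: prob_Collect_eq_1)
qed

lemma prob_joint:
  assumes "J \<subseteq> {1..d}" "J \<noteq> {}"
  shows "prob {\<omega>\<in>space M. \<forall>j\<in>J. Q j \<omega> \<in> S j} = (\<Prod>j\<in>J. measure_pmf.prob \<mu> (S j))"
proof -
  have fin: "finite J" using assms finite_subset by blast
  have "prob (\<Inter>j\<in>J. Q j -` S j \<inter> space M) = (\<Prod>j\<in>J. prob (Q j -` S j \<inter> space M))"
    by (rule indep_varsD[OF indep]) (use assms fin in auto)
  moreover have "(\<Inter>j\<in>J. Q j -` S j \<inter> space M) = {\<omega>\<in>space M. \<forall>j\<in>J. Q j \<omega> \<in> S j}" using assms by auto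
  moreover have "prob (Q j -` S j \<inter> space M) = measure_pmf.prob \<mu> (S j)" if "j \<in> J" for j
    using prob_Q[of j "S j"] assms that by (simp add: vimage_def Int_def conj_commute subset_eq)
  ultimately show ?thesis by simp
qed

lemma prob_sum_over_values:
  assumes a: "a \<in> {1..d}" and E: "E \<in> events"
  shows "prob E = (\<Sum>x\<in>set_pmf \<mu>. prob {\<omega>\<in>E. Q a \<omega> = x})"
proof -
  have m: "{\<omega>\<in>E. Q a \<omega> = x} \<in> events" for x
  proof -
    have "Q a -` {x} \<inter> space M \<in> events" using Q_measurable[OF a] by (rule measurable_sets) simp
    then have "E \<inter> (Q a -` {x} \<inter> space M) \<in> events" using E by blast
    also have "E \<inter> (Q a -` {x} \<inter> space M) = {\<omega>\<in>E. Q a \<omega> = x}" using sets.sets_into_space[OF E] by auto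
    finally show ?thesis .
  qed
  have "prob E = prob (\<Union>x\<in>set_pmf \<mu>. {\<omega>\<in>E. Q a \<omega> = x})"
  proof (rule finite_measure_eq_AE)
    show "AE \<omega> in M. (\<omega> \<in> E) = (\<omega> \<in> (\<Union>x\<in>set_pmf \<mu>. {\<omega>\<in>E. Q a \<omega> = x}))"
      using AE_Q_in_support[OF a] by eventually_elim auto
  qed (use E m finite_law in auto)
  also have "\<dots> = (\<Sum>x\<in>set_pmf \<mu>. prob {\<omega>\<in>E. Q a \<omega> = x})"
    using m finite_law by (intro finite_measure_finite_Union) (auto simp: disjoint_family_on_def)
  finally show ?thesis .
qed

lemma sum_pmf_support: "(\<Sum>x\<in>set_pmf \<mu>. pmf \<mu> x) = 1"
  using finite_law by (intro sum_pmf_eq_1) auto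

context
  fixes R :: "'b \<Rightarrow> 'b \<Rightarrow> bool" and p :: real
  assumes sym: "\<And>x y. x \<in> set_pmf \<mu> \<Longrightarrow> y \<in> set_pmf \<mu> \<Longrightarrow> R x y = R y x"
    and section_prob: "\<And>x. x \<in> set_pmf \<mu> \<Longrightarrow> measure_pmf.prob \<mu> {y. R x y} = p"
begin

lemma R_event: "a \<in> {1..d} \<Longrightarrow> b \<in> {1..d} \<Longrightarrow> {\<omega>\<in>space M. R (Q a \<omega>) (Q b \<omega>)} \<in> events"
  by (intro measurable_count_space_Pair Q_measurable)

lemma prob_R:
  assumes "a \<in> {1..d}" "b \<in> {1..d}" "a \<noteq> b"
  shows "prob {\<omega>\<in>space M. R (Q a \<omega>) (Q b \<omega>)} = p"
proof -
  have "prob {\<omega>\<in>space M. R (Q a \<omega>) (Q b \<omega>)} = (\<Sum>x\<in>set_pmf \<mu>. prob {\<omega>\<in>{\<omega>\<in>space M. R (Q a \<omega>) (Q b \<omega>)}. Q a \<omega> = x})"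
    using assms by (intro prob_sum_over_values R_event)
  also have "\<dots> = (\<Sum>x\<in>set_pmf \<mu>. pmf \<mu> x * p)"
  proof (intro sum.cong refl)
    fix x assume x: "x \<in> set_pmf \<mu>"
    have "{\<omega>\<in>{\<omega>\<in>space M. R (Q a \<omega>) (Q b \<omega>)}. Q a \<omega> = x} = {\<omega>\<in>space M. \<forall>j\<in>{a, b}. Q j \<omega> \<in> (if j = a then {x} else {y. R x y})}"
      using assms by auto
    also have "prob \<dots> = (\<Prod>j\<in>{a, b}. measure_pmf.prob \<mu> (if j = a then {x} else {y. R x y}))"
      using assms by (intro prob_joint) auto
    finally show "prob {\<omega>\<in>{\<omega>\<in>space M. R (Q a \<omega>) (Q b \<omega>)}. Q a \<omega> = x} = pmf \<mu> x * p"
      using assms section_prob[OF x] by (simp add: measure_pmf_single)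
  qed
  also have "\<dots> = p" by (simp add: sum_distrib_right[symmetric] sum_pmf_support)
  finally show ?thesis .
qed

text \<open>Two pairs with a common object: given this object, the two relations concern different independent
objects and have conditional probability \<open>p\<close> each, whatever its value.\<close>

lemma prob_R_shared:
  assumes "a \<in> {1..d}" "b \<in> {1..d}" "c \<in> {1..d}" "a \<noteq> b" "a \<noteq> c" "b \<noteq> c"
  shows "prob ({\<omega>\<in>space M. R (Q a \<omega>) (Q b \<omega>)} \<inter> {\<omega>\<in>space M. R (Q a \<omega>) (Q c \<omega>)}) = p\<^sup>2"
proof -
  let ?E = "{\<omega>\<in>space M. R (Q a \<omega>) (Q b \<omega>)} \<inter> {\<omega>\<in>space M. R (Q a \<omega>) (Q c \<omega>)}"
  have "prob ?E = (\<Sum>x\<in>set_pmf \<mu>. prob {\<omega>\<in>?E. Q a \<omega> = x})"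
    using assms by (intro prob_sum_over_values sets.Int R_event)
  also have "\<dots> = (\<Sum>x\<in>set_pmf \<mu>. pmf \<mu> x * p\<^sup>2)"
  proof (intro sum.cong refl)
    fix x assume x: "x \<in> set_pmf \<mu>"
    have "{\<omega>\<in>?E. Q a \<omega> = x} = {\<omega>\<in>space M. \<forall>j\<in>{a, b, c}. Q j \<omega> \<in> (if j = a then {x} else {y. R x y})}"
      using assms by auto
    also have "prob \<dots> = (\<Prod>j\<in>{a, b, c}. measure_pmf.prob \<mu> (if j = a then {x} else {y. R x y}))"
      using assms by (intro prob_joint) auto
    finally show "prob {\<omega>\<in>?E. Q a \<omega> = x} = pmf \<mu> x * p\<^sup>2"
      using assms section_prob[OF x] by (simp add: measure_pmf_single power2_eq_square)
  qed
  also have "\<dots> = p\<^sup>2" by (simp add: sum_distrib_right[symmetric] sum_pmf_support)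
  finally show ?thesis .
qed

lemma prob_R_sym:
  assumes "a \<in> {1..d}" "b \<in> {1..d}" "E \<in> events"
  shows "prob ({\<omega>\<in>space M. R (Q a \<omega>) (Q b \<omega>)} \<inter> E) = prob ({\<omega>\<in>space M. R (Q b \<omega>) (Q a \<omega>)} \<inter> E)"
proof (rule finite_measure_eq_AE)
  show "AE \<omega> in M. (\<omega> \<in> {\<omega>\<in>space M. R (Q a \<omega>) (Q b \<omega>)} \<inter> E) = (\<omega> \<in> {\<omega>\<in>space M. R (Q b \<omega>) (Q a \<omega>)} \<inter> E)"
    using AE_Q_in_support[OF assms(1)] AE_Q_in_support[OF assms(2)] by eventually_elim (auto simp: sym)
qed (use assms R_event in auto)

text \<open>The neighbourhood of a pair consists of the pairs that share an object with it, at most \<open>4 d\<close> of them.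
The events of two such pairs are independent by \<open>prob_R_shared\<close>.\<close>

theorem no_pair_probability:
  "\<bar>prob {\<omega>\<in>space M. \<forall>j k. 1 \<le> j \<longrightarrow> j < k \<longrightarrow> k \<le> d \<longrightarrow> \<not> R (Q j \<omega>) (Q k \<omega>)}
     - exp (- (real d * (real d - 1) / 2 * p))\<bar> \<le> 8 * real d ^ 3 * p\<^sup>2"
proof -
  define I where "I = {(j, k). 1 \<le> j \<and> j < k \<and> k \<le> d}"
  define A where "A \<alpha> = {\<omega>\<in>space M. R (Q (fst \<alpha>) \<omega>) (Q (snd \<alpha>) \<omega>)}" for \<alpha>
  define N where "N \<alpha> = {\<beta>\<in>I. {fst \<beta>, snd \<beta>} \<inter> {fst \<alpha>, snd \<alpha>} \<noteq> {}}" for \<alpha>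
  have sub: "I \<subseteq> {1..d} \<times> {1..d}" by (auto simp: I_def)
  then have fin: "finite I" using finite_subset by blast
  have cI: "real (card I) = real d * (real d - 1) / 2"
  proof -
    have "I = (SIGMA j:{1..d}. {j<..d})" by (auto simp: I_def)
    then have "card I = (\<Sum>j=1..d. card {j<..d})" by simp
    then have "real (card I) = (\<Sum>j=1..d. real d - real j)" by (simp add: of_nat_diff)
    also have "\<dots> = real d * real d - (\<Sum>j=1..d. real j)" by (simp add: sum_subtractf)
    also have "(\<Sum>j=1..d. real j) = real d * (real d + 1) / 2"
      by (induction d) (auto simp: field_simps)
    finally show ?thesis by (simp add: field_simps)
  qed
  have mem: "fst \<alpha> \<in> {1..d}" "snd \<alpha> \<in> {1..d}" "fst \<alpha> \<noteq> snd \<alpha>" "fst \<alpha> < snd \<alpha>" if "\<alpha> \<in> I" for \<alpha>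
    using that by (auto simp: I_def)
  have Aev: "A \<alpha> \<in> events" if "\<alpha> \<in> I" for \<alpha> unfolding A_def using mem[OF that] by (intro R_event)
  have bound: "\<bar>prob {\<omega>\<in>space M. \<forall>\<alpha>\<in>I. \<omega> \<notin> A \<alpha>} - exp (- (real (card I) * p))\<bar> \<le> 2 * real (card I) * real (4 * d) * p\<^sup>2"
  proof (rule poisson_dissociated_bound[OF fin Aev])
    fix \<alpha> assume \<alpha>: "\<alpha> \<in> I"
    show "\<alpha> \<in> N \<alpha> \<and> N \<alpha> \<subseteq> I" using \<alpha> by (auto simp: N_def)
    show "card (N \<alpha>) \<le> 4 * d"
    proof -
      have "N \<alpha> \<subseteq> {fst \<alpha>, snd \<alpha>} \<times> {1..d} \<union> {1..d} \<times> {fst \<alpha>, snd \<alpha>}" using sub by (auto simp: N_def)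
      then have "card (N \<alpha>) \<le> card ({fst \<alpha>, snd \<alpha>} \<times> {1..d} \<union> {1..d} \<times> {fst \<alpha>, snd \<alpha>})"
        by (intro card_mono) auto
      also have "\<dots> \<le> card ({fst \<alpha>, snd \<alpha>} \<times> {1..d}) + card ({1..d} \<times> {fst \<alpha>, snd \<alpha>})" by (rule card_Un_le)
      also have "\<dots> = 4 * d" using mem[OF \<alpha>] by (simp add: card_cartesian_product)
      finally show ?thesis .
    qed
    show "prob (A \<alpha>) = p" unfolding A_def using mem[OF \<alpha>] by (intro prob_R)
    show "prob (A \<alpha> \<inter> A \<beta>) = p\<^sup>2" if \<beta>: "\<beta> \<in> N \<alpha>" "\<beta> \<noteq> \<alpha>" for \<beta>
    proof -
      have \<beta>I: "\<beta> \<in> I" using \<beta> by (simp add: N_def)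
      note ma = mem[OF \<alpha>] and mb = mem[OF \<beta>I]
      let ?R = "\<lambda>a b. {\<omega>\<in>space M. R (Q a \<omega>) (Q b \<omega>)}"
      have sw1: "prob (?R a b \<inter> E) = prob (?R b a \<inter> E)" if "a \<in> {1..d}" "b \<in> {1..d}" "E \<in> events" for a b E
        using that by (rule prob_R_sym)
      have sw2: "prob (E \<inter> ?R a b) = prob (E \<inter> ?R b a)" if "a \<in> {1..d}" "b \<in> {1..d}" "E \<in> events" for a b E
        using prob_R_sym[OF that] by (simp add: Int_commute)
      obtain a b where ab: "\<alpha> = (a, b)" by (cases \<alpha>)
      obtain a' b' where ab': "\<beta> = (a', b')" by (cases \<beta>)
      consider "a' = a" | "a' = b" | "b' = a" | "b' = b" using \<beta> by (auto simp: N_def ab ab')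
      then show ?thesis
      proof cases
        case 1
        then show ?thesis using prob_R_shared[of a b b'] ma mb \<beta> by (auto simp: A_def ab ab')
      next
        case 2
        then have "prob (?R a b \<inter> ?R a' b') = prob (?R b a \<inter> ?R b b')" using ma mb sw1[of a b] R_event by (simp add: ab ab')
        also have "\<dots> = p\<^sup>2" using 2 ma mb by (intro prob_R_shared) (auto simp: ab ab')
        finally show ?thesis by (simp add: A_def ab ab')
      next
        case 3
        then have "prob (?R a b \<inter> ?R a' b') = prob (?R a b \<inter> ?R a a')" using ma mb sw2[of a' b'] R_event by (simp add: ab ab')
        also have "\<dots> = p\<^sup>2" using 3 ma mb by (intro prob_R_shared) (auto simp: ab ab')
        finally show ?thesis by (simp add: A_def ab ab')
      next
        case 4
        then have "prob (?R a b \<inter> ?R a' b') = prob (?R b a \<inter> ?R a' b)" using ma mb sw1[of a b] R_event by (simp add: ab ab')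
        also have "\<dots> = prob (?R b a \<inter> ?R b a')" using 4 ma mb sw2[of a' b] R_event by (simp add: ab ab')
        also have "\<dots> = p\<^sup>2" using 4 ma mb \<beta> by (intro prob_R_shared) (auto simp: ab ab')
        finally show ?thesis by (simp add: A_def ab ab')
      qed
    qed
    fix k
    \<comment> \<open>The event of \<open>\<alpha>\<close> depends on the objects in \<open>?J\<close>, the count of the events outside its neighbourhood on
       those in \<open>?K\<close>.\<close>
    let ?J = "{fst \<alpha>, snd \<alpha>}"
    let ?K = "{1..d} - ?J"
    have iv: "indep_var (PiM ?J (\<lambda>_. count_space UNIV)) (\<lambda>\<omega>. restrict (\<lambda>i. Q i \<omega>) ?J) (PiM ?K (\<lambda>_. count_space UNIV)) (\<lambda>\<omega>. restrict (\<lambda>i. Q i \<omega>) ?K)"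
      using mem[OF \<alpha>] by (intro indep_var_restrict[OF indep]) auto
    define F where "F = {f\<in>space (PiM ?J (\<lambda>_. count_space UNIV)). R (f (fst \<alpha>)) (f (snd \<alpha>))}"
    define G where "G = {f\<in>space (PiM ?K (\<lambda>_. count_space UNIV)). (\<Sum>\<beta>\<in>I - N \<alpha>. of_bool (R (f (fst \<beta>)) (f (snd \<beta>))) :: nat) = k}"
    have out: "fst \<beta> \<in> ?K" "snd \<beta> \<in> ?K" if "\<beta> \<in> I - N \<alpha>" for \<beta>
      using that mem[of \<beta>] by (auto simp: N_def)
    have Fs: "F \<in> sets (PiM ?J (\<lambda>_. count_space UNIV))" unfolding F_def
      by (rule measurable_count_space_Pair[where R = R]) (rule measurable_component_singleton, simp)+
    have Gs: "G \<in> sets (PiM ?K (\<lambda>_. count_space UNIV))"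
    proof -
      have "(\<lambda>f. of_bool (R (f (fst \<beta>)) (f (snd \<beta>))) :: nat) \<in> measurable (PiM ?K (\<lambda>_. count_space UNIV)) (count_space UNIV)" if "\<beta> \<in> I - N \<alpha>" for \<beta>
      proof -
        have "{f\<in>space (PiM ?K (\<lambda>_. count_space UNIV)). R (f (fst \<beta>)) (f (snd \<beta>))} \<in> sets (PiM ?K (\<lambda>_. count_space UNIV))"
          by (rule measurable_count_space_Pair[where R = R]; rule measurable_component_singleton; rule out[OF that])
        then show ?thesis unfolding of_bool_def by (intro measurable_If measurable_const) simp_all
      qed
      then have "(\<lambda>f. \<Sum>\<beta>\<in>I - N \<alpha>. of_bool (R (f (fst \<beta>)) (f (snd \<beta>))) :: nat) \<in> measurable (PiM ?K (\<lambda>_. count_space UNIV)) (count_space UNIV)"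
        by (rule measurable_sum_nat)
      from measurable_sets[OF this, of "{k}"] show ?thesis
        by (simp add: G_def vimage_def Int_def conj_commute)
    qed
    have "prob ((\<lambda>\<omega>. (restrict (\<lambda>i. Q i \<omega>) ?J, restrict (\<lambda>i. Q i \<omega>) ?K)) -` (F \<times> G) \<inter> space M)
       = prob ((\<lambda>\<omega>. restrict (\<lambda>i. Q i \<omega>) ?J) -` F \<inter> space M) * prob ((\<lambda>\<omega>. restrict (\<lambda>i. Q i \<omega>) ?K) -` G \<inter> space M)"
      using iv Fs Gs by (rule indep_varD)
    moreover have "(\<lambda>\<omega>. restrict (\<lambda>i. Q i \<omega>) ?J) -` F \<inter> space M = A \<alpha>"
      by (auto simp: F_def A_def space_PiM)
    moreover have "(\<lambda>\<omega>. restrict (\<lambda>i. Q i \<omega>) ?K) -` G \<inter> space M = {\<omega>\<in>space M. card {\<beta>\<in>I - N \<alpha>. \<omega> \<in> A \<beta>} = k}"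
    proof -
      have "(\<Sum>\<beta>\<in>I - N \<alpha>. of_bool (R (restrict (\<lambda>i. Q i \<omega>) ?K (fst \<beta>)) (restrict (\<lambda>i. Q i \<omega>) ?K (snd \<beta>))) :: nat)
         = card {\<beta>\<in>I - N \<alpha>. \<omega> \<in> A \<beta>}" if "\<omega> \<in> space M" for \<omega>
      proof -
        have "(\<Sum>\<beta>\<in>I - N \<alpha>. of_bool (R (restrict (\<lambda>i. Q i \<omega>) ?K (fst \<beta>)) (restrict (\<lambda>i. Q i \<omega>) ?K (snd \<beta>))) :: nat)
           = (\<Sum>\<beta>\<in>I - N \<alpha>. of_bool (\<omega> \<in> A \<beta>))"
          using out that by (intro sum.cong refl) (simp add: A_def)
        also have "\<dots> = card {\<beta>\<in>I - N \<alpha>. \<omega> \<in> A \<beta>}" using fin by (simp add: of_bool_def sum.If_cases Int_def)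
        finally show ?thesis .
      qed
      then show ?thesis by (auto simp: G_def space_PiM)
    qed
    moreover have "(\<lambda>\<omega>. (restrict (\<lambda>i. Q i \<omega>) ?J, restrict (\<lambda>i. Q i \<omega>) ?K)) -` (F \<times> G) \<inter> space M
       = ((\<lambda>\<omega>. restrict (\<lambda>i. Q i \<omega>) ?J) -` F \<inter> space M) \<inter> ((\<lambda>\<omega>. restrict (\<lambda>i. Q i \<omega>) ?K) -` G \<inter> space M)" by auto
    moreover have "prob (A \<alpha>) = p" unfolding A_def using mem[OF \<alpha>] by (intro prob_R)
    ultimately show "prob (A \<alpha> \<inter> {\<omega>\<in>space M. card {\<beta>\<in>I - N \<alpha>. \<omega> \<in> A \<beta>} = k}) = p * prob {\<omega>\<in>space M. card {\<beta>\<in>I - N \<alpha>. \<omega> \<in> A \<beta>} = k}"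
      by simp
  qed
  have E: "{\<omega>\<in>space M. \<forall>\<alpha>\<in>I. \<omega> \<notin> A \<alpha>} = {\<omega>\<in>space M. \<forall>j k. 1 \<le> j \<longrightarrow> j < k \<longrightarrow> k \<le> d \<longrightarrow> \<not> R (Q j \<omega>) (Q k \<omega>)}"
    by (auto simp: I_def A_def)
  have L: "2 * real (card I) * real (4 * d) * p\<^sup>2 \<le> 8 * real d ^ 3 * p\<^sup>2"
  proof -
    have "card I \<le> card ({1..d} \<times> {1..d})" using sub by (intro card_mono) auto
    then have "card I \<le> d * d" by (simp add: card_cartesian_product)
    then have "real (card I) \<le> real d * real d" by (metis of_nat_le_iff of_nat_mult)
    then have "2 * real (card I) * real (4 * d) * p\<^sup>2 \<le> 2 * (real d * real d) * real (4 * d) * p\<^sup>2"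
      by (intro mult_right_mono mult_left_mono) auto
    then show ?thesis by (simp add: power3_eq_cube mult_ac)
  qed
  show ?thesis using order_trans[OF bound L] unfolding E cI .
qed

end
end

section \<open>Ranks of an independent sample\<close>

text \<open>Tied values share the largest of their ranks.\<close>

definition rank_list :: "nat \<Rightarrow> (nat \<Rightarrow> real) \<Rightarrow> nat list" where
  "rank_list n f = map (\<lambda>i. card {m\<in>{1..n}. f m \<le> f i}) [1..<Suc n]"

lemma length_rank_list [simp]: "length (rank_list n f) = n"
  by (simp add: rank_list_def)

lemma rank_list_measurable:
  assumes f: "\<And>i. i \<in> {1..n} \<Longrightarrow> (\<lambda>\<omega>. f \<omega> i) \<in> borel_measurable M"
  shows "(\<lambda>\<omega>. rank_list n (f \<omega>)) \<in> measurable M (count_space UNIV)"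
proof -
  have r: "(\<lambda>\<omega>. card {m\<in>{1..n}. f \<omega> m \<le> f \<omega> i}) \<in> measurable M (count_space UNIV)" if "i \<in> {1..n}" for i
  proof -
    have A: "(\<lambda>\<omega>. \<Sum>m\<in>{1..n}. if f \<omega> m \<le> f \<omega> i then 1 else 0 :: nat) \<in> measurable M (count_space UNIV)"
    proof (rule measurable_sum_nat)
      fix m assume m: "m \<in> {1..n}"
      show "(\<lambda>\<omega>. if f \<omega> m \<le> f \<omega> i then 1 else 0 :: nat) \<in> measurable M (count_space UNIV)"
        using borel_measurable_le[OF f[OF m] f[OF that]] by (intro measurable_If measurable_const) simp_all
    qed
    have eq: "(\<Sum>m\<in>{1..n}. if f \<omega> m \<le> f \<omega> i then 1 else 0 :: nat) = card {m\<in>{1..n}. f \<omega> m \<le> f \<omega> i}" for \<omega>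
      by (simp only: card_eq_sum sum.inter_filter finite_atLeastAtMost)
    show ?thesis using A unfolding eq .
  qed
  have "(\<lambda>\<omega>. map (\<lambda>i. card {m\<in>{1..n}. f \<omega> m \<le> f \<omega> i}) is) \<in> measurable M (count_space UNIV)" if "set is \<subseteq> {1..n}" for "is"
    using that
  proof (induction "is")
    case (Cons i "is")
    have "(\<lambda>\<omega>. card {m\<in>{1..n}. f \<omega> m \<le> f \<omega> i} # map (\<lambda>i. card {m\<in>{1..n}. f \<omega> m \<le> f \<omega> i}) is) \<in> measurable M (count_space UNIV)"
      by (rule measurable_count_space_binary[where h = "(#)", OF r Cons.IH]) (use Cons.prems in auto)
    then show ?case by (simp only: list.map)
  qed simp
  note L = this
  have "set [1..<Suc n] \<subseteq> {1..n}" by auto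
  from L[OF this] show ?thesis unfolding rank_list_def .
qed

lemma rank_list_permutation:
  assumes "inj_on f {1..n}" shows "rank_list n f \<in> permutations_of_set {1..n}"
proof -
  have b: "bij_betw (\<lambda>i. card {m\<in>{1..n}. f m \<le> f i}) {1..n} {1..n}"
    using bij_betw_rank_at_most[OF _ assms] by simp
  show ?thesis unfolding rank_list_def
  proof (rule permutations_of_setI)
    have s: "set [1..<Suc n] = {1..n}" by auto
    show "set (map (\<lambda>i. card {m\<in>{1..n}. f m \<le> f i}) [1..<Suc n]) = {1..n}"
      using b unfolding set_map s by (simp add: bij_betw_def)
    show "distinct (map (\<lambda>i. card {m\<in>{1..n}. f m \<le> f i}) [1..<Suc n])"
      using b unfolding distinct_map s by (simp add: bij_betw_def)
  qed
qed

lemma rank_list_eq_iff: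
  assumes "length ys = n"
  shows "rank_list n f = ys \<longleftrightarrow> (\<forall>m\<in>{1..n}. card {k\<in>{1..n}. f k \<le> f m} = ys ! (m - 1))"
proof -
  have "rank_list n f = ys \<longleftrightarrow> (\<forall>i<n. card {k\<in>{1..n}. f k \<le> f (Suc i)} = ys ! i)"
    using assms by (simp add: rank_list_def list_eq_iff_nth_eq del: upt_Suc)
  also have "\<dots> \<longleftrightarrow> (\<forall>m\<in>{1..n}. card {k\<in>{1..n}. f k \<le> f m} = ys ! (m - 1))"
  proof safe
    fix m assume "\<forall>i<n. card {k\<in>{1..n}. f k \<le> f (Suc i)} = ys ! i" "m \<in> {1..n}"
    then show "card {k\<in>{1..n}. f k \<le> f m} = ys ! (m - 1)" by (cases m) auto
  next
    fix i assume "\<forall>m\<in>{1..n}. card {k\<in>{1..n}. f k \<le> f m} = ys ! (m - 1)" "i < n"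
    from bspec[OF this(1), of "Suc i"] this(2) show "card {k\<in>{1..n}. f k \<le> f (Suc i)} = ys ! i" by simp
  qed
  finally show ?thesis .
qed

text \<open>Reordering the sample along \<open>ys\<close> turns the rank vector \<open>ys\<close> into the identity.\<close>

lemma rank_list_reindex:
  assumes ys: "ys \<in> permutations_of_set {1..n}"
  obtains \<sigma> where "inj_on \<sigma> {1..n}" "\<sigma> \<in> {1..n} \<rightarrow> {1..n}"
    "\<And>f. rank_list n f = ys \<longleftrightarrow> rank_list n (\<lambda>i\<in>{1..n}. f (\<sigma> i)) = [1..<Suc n]"
proof -
  define \<tau> where "\<tau> m = ys ! (m - 1)" for m
  have len: "length ys = n" using length_finite_permutations_of_set[OF ys] by simp
  have d: "distinct ys" "set ys = {1..n}" using ys by (auto dest: permutations_of_setD)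
  have bij: "bij_betw \<tau> {1..n} {1..n}"
  proof -
    have "bij_betw ((!) ys) {..<n} {1..n}" using d len bij_betw_nth[OF d(1), of "{..<n}" "{1..n}"] by simp
    moreover have "bij_betw (\<lambda>m. m - 1) {1..n} {..<n}"
      by (rule bij_betwI[where g = Suc]) auto
    ultimately have "bij_betw ((!) ys \<circ> (\<lambda>m. m - 1)) {1..n} {1..n}" by (metis bij_betw_trans)
    then show ?thesis by (simp add: \<tau>_def[abs_def] comp_def)
  qed
  define \<sigma> where "\<sigma> = inv_into {1..n} \<tau>"
  have s: "bij_betw \<sigma> {1..n} {1..n}" unfolding \<sigma>_def using bij by (rule bij_betw_inv_into)
  have \<tau>\<sigma>: "\<tau> (\<sigma> i) = i" if "i \<in> {1..n}" for i
    unfolding \<sigma>_def using that bij by (intro f_inv_into_f) (auto simp: bij_betw_def)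
  have \<sigma>in: "\<sigma> i \<in> {1..n}" if "i \<in> {1..n}" for i using s that by (auto simp: bij_betw_def)
  show ?thesis
  proof (rule that[of \<sigma>])
    show "inj_on \<sigma> {1..n}" "\<sigma> \<in> {1..n} \<rightarrow> {1..n}" using s by (auto simp: bij_betw_def)
    fix f
    have "rank_list n f = ys \<longleftrightarrow> (\<forall>m\<in>{1..n}. card {k\<in>{1..n}. f k \<le> f m} = \<tau> m)"
      unfolding \<tau>_def using len by (rule rank_list_eq_iff)
    also have "\<dots> \<longleftrightarrow> (\<forall>m\<in>\<sigma> ` {1..n}. card {k\<in>{1..n}. f k \<le> f m} = \<tau> m)" using s by (simp add: bij_betw_def)
    also have "\<dots> \<longleftrightarrow> (\<forall>i\<in>{1..n}. card {k\<in>{1..n}. f k \<le> f (\<sigma> i)} = i)" using \<tau>\<sigma> by auto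
    also have "\<dots> \<longleftrightarrow> (\<forall>i\<in>{1..n}. card {k\<in>{1..n}. (\<lambda>i\<in>{1..n}. f (\<sigma> i)) k \<le> (\<lambda>i\<in>{1..n}. f (\<sigma> i)) i} = [1..<Suc n] ! (i - 1))"
    proof (intro ball_cong refl)
      fix i assume i: "i \<in> {1..n}"
      have "bij_betw \<sigma> {k\<in>{1..n}. f (\<sigma> k) \<le> f (\<sigma> i)} {k\<in>{1..n}. f k \<le> f (\<sigma> i)}"
        using s by (rule bij_betw_Collect) auto
      then have "card {k\<in>{1..n}. f k \<le> f (\<sigma> i)} = card {k\<in>{1..n}. f (\<sigma> k) \<le> f (\<sigma> i)}"
        by (rule bij_betw_same_card[symmetric])
      also have "{k\<in>{1..n}. f (\<sigma> k) \<le> f (\<sigma> i)} = {k\<in>{1..n}. (\<lambda>i\<in>{1..n}. f (\<sigma> i)) k \<le> (\<lambda>i\<in>{1..n}. f (\<sigma> i)) i}"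
        using i by auto
      finally show "(card {k\<in>{1..n}. f k \<le> f (\<sigma> i)} = i) = (card {k\<in>{1..n}. (\<lambda>i\<in>{1..n}. f (\<sigma> i)) k \<le> (\<lambda>i\<in>{1..n}. f (\<sigma> i)) i} = [1..<Suc n] ! (i - 1))"
        using i by (simp del: upt_Suc)
    qed
    also have "\<dots> \<longleftrightarrow> rank_list n (\<lambda>i\<in>{1..n}. f (\<sigma> i)) = [1..<Suc n]"
      by (rule rank_list_eq_iff[symmetric]) simp
    finally show "rank_list n f = ys \<longleftrightarrow> rank_list n (\<lambda>i\<in>{1..n}. f (\<sigma> i)) = [1..<Suc n]" .
  qed
qed

text \<open>All orders of an exchangeable sample are equally likely, and ties have probability zero.\<close>

lemma (in prob_space) rank_list_uniform:
  fixes Z :: "nat \<Rightarrow> 'a \<Rightarrow> real"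
  assumes ind: "indep_vars (\<lambda>_. borel) Z {1..n}" and n: "0 < n"
    and law: "\<And>i. i \<in> {1..n} \<Longrightarrow> distr M borel (Z i) = \<nu>"
    and atomless: "\<And>a. measure \<nu> {a} = 0"
  shows "distr M (count_space UNIV) (\<lambda>\<omega>. rank_list n (\<lambda>i. Z i \<omega>)) = measure_pmf (uniform_perm {1..n})"
proof -
  have Z [measurable]: "Z i \<in> borel_measurable M" if "i \<in> {1..n}" for i
    using ind that by (simp add: indep_vars_def2)
  let ?Q = "\<lambda>\<omega>. rank_list n (\<lambda>i. Z i \<omega>)"
  have Qm: "?Q \<in> measurable M (count_space UNIV)" by (rule rank_list_measurable) (rule Z)
  interpret N: prob_space \<nu> using law[of 1] n prob_space_distr[OF Z[of 1]] by simp
  have sN: "sets \<nu> = sets borel" using law[of 1] n by auto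
  define D where "D = PiM {1..n} (\<lambda>_. \<nu>)"
  interpret D: prob_space D unfolding D_def by (intro prob_space_PiM N.prob_space_axioms)
  have sD: "sets D = sets (PiM {1..n} (\<lambda>_. borel))" unfolding D_def by (intro sets_PiM_cong) (simp_all add: sN)
  have Dm: "(\<lambda>f. f i) \<in> borel_measurable D" if "i \<in> {1..n}" for i
    using that unfolding measurable_cong_sets[OF sD refl] by (rule measurable_component_singleton)
  have rkm: "rank_list n \<in> measurable D (count_space UNIV)"
    by (rule rank_list_measurable[of n "\<lambda>f. f"]) (rule Dm)
  have dist: "distr M (PiM {1..n} (\<lambda>_. borel)) (\<lambda>\<omega>. \<lambda>i\<in>{1..n}. Z i \<omega>) = D"
  proof -
    have "distr M (PiM {1..n} (\<lambda>_. borel)) (\<lambda>\<omega>. \<lambda>i\<in>{1..n}. Z i \<omega>) = (\<Pi>\<^sub>M i\<in>{1..n}. distr M borel (Z i))"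
      using ind n by (subst (asm) indep_vars_iff_distr_eq_PiM') (auto intro: Z)
    also have "\<dots> = D" unfolding D_def by (intro PiM_cong) (auto simp: law)
    finally show ?thesis .
  qed
  have QD: "prob {\<omega>\<in>space M. ?Q \<omega> = ys} = D.prob {f\<in>space D. rank_list n f = ys}" for ys
  proof -
    have m: "(\<lambda>\<omega>. \<lambda>i\<in>{1..n}. Z i \<omega>) \<in> measurable M (PiM {1..n} (\<lambda>_. borel))"
      by (intro measurable_restrict Z)
    have s: "{f\<in>space D. rank_list n f = ys} \<in> sets D"
      using measurable_sets[OF rkm, of "{ys}"] by (simp add: vimage_def Int_def conj_commute)
    have "D.prob {f\<in>space D. rank_list n f = ys} = prob ((\<lambda>\<omega>. \<lambda>i\<in>{1..n}. Z i \<omega>) -` {f\<in>space D. rank_list n f = ys} \<inter> space M)"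
      using s unfolding sD by (subst (1) dist[symmetric]) (rule measure_distr[OF m])
    also have "(\<lambda>\<omega>. \<lambda>i\<in>{1..n}. Z i \<omega>) -` {f\<in>space D. rank_list n f = ys} \<inter> space M = {\<omega>\<in>space M. ?Q \<omega> = ys}"
    proof -
      have "rank_list n (\<lambda>i\<in>{1..n}. Z i \<omega>) = ?Q \<omega>" for \<omega>
        unfolding rank_list_def by (intro map_cong refl arg_cong[where f = card]) auto
      moreover have "(\<lambda>i\<in>{1..n}. Z i \<omega>) \<in> space D" for \<omega>
        unfolding sets_eq_imp_space_eq[OF sD] by (simp add: space_PiM)
      ultimately show ?thesis by auto
    qed
    finally show ?thesis ..
  qed
  have const: "prob {\<omega>\<in>space M. ?Q \<omega> = ys} = prob {\<omega>\<in>space M. ?Q \<omega> = [1..<Suc n]}" if ys: "ys \<in> permutations_of_set {1..n}" for ys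
  proof -
    obtain \<sigma> where \<sigma>: "inj_on \<sigma> {1..n}" "\<sigma> \<in> {1..n} \<rightarrow> {1..n}"
      "\<And>f. rank_list n f = ys \<longleftrightarrow> rank_list n (\<lambda>i\<in>{1..n}. f (\<sigma> i)) = [1..<Suc n]"
      using rank_list_reindex[OF ys] by blast
    have re: "distr D D (\<lambda>f. \<lambda>i\<in>{1..n}. f (\<sigma> i)) = D"
      unfolding D_def using \<sigma>(1,2) by (intro distr_PiM_reindex N.prob_space_axioms)
    have m: "(\<lambda>f. \<lambda>i\<in>{1..n}. f (\<sigma> i)) \<in> measurable D D"
      unfolding D_def using \<sigma>(2) by (intro measurable_restrict measurable_component_singleton) auto
    have s: "{f\<in>space D. rank_list n f = [1..<Suc n]} \<in> sets D"
      using measurable_sets[OF rkm, of "{[1..<Suc n]}"] by (simp add: vimage_def Int_def conj_commute del: upt_Suc)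
    have "D.prob {f\<in>space D. rank_list n f = [1..<Suc n]} = D.prob ((\<lambda>f. \<lambda>i\<in>{1..n}. f (\<sigma> i)) -` {f\<in>space D. rank_list n f = [1..<Suc n]} \<inter> space D)"
      by (subst (1) re[symmetric]) (rule measure_distr[OF m s])
    also have "(\<lambda>f. \<lambda>i\<in>{1..n}. f (\<sigma> i)) -` {f\<in>space D. rank_list n f = [1..<Suc n]} \<inter> space D = {f\<in>space D. rank_list n f = ys}"
      using measurable_space[OF m] \<sigma>(3) by auto
    finally show ?thesis unfolding QD ..
  qed
  have inj: "AE \<omega> in M. inj_on (\<lambda>i. Z i \<omega>) {1..n}"
    using ind law atomless by (intro AE_inj_on_indep) auto
  have Qs: "{\<omega>\<in>space M. ?Q \<omega> \<in> S} \<in> events" for S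
    using measurable_sets[OF Qm, of S] by (simp add: vimage_def Int_def conj_commute)
  have "AE \<omega> in M. ?Q \<omega> \<in> permutations_of_set {1..n}"
    using inj by eventually_elim (rule rank_list_permutation)
  then have "prob {\<omega>\<in>space M. ?Q \<omega> \<in> permutations_of_set {1..n}} = 1"
    using prob_Collect_eq_1[OF Qs] by blast
  then have "1 = prob {\<omega>\<in>space M. ?Q \<omega> \<in> permutations_of_set {1..n}}" by (rule sym)
  also have "{\<omega>\<in>space M. ?Q \<omega> \<in> permutations_of_set {1..n}} = (\<Union>ys\<in>permutations_of_set {1..n}. {\<omega>\<in>space M. ?Q \<omega> = ys})" by auto
  also have "prob \<dots> = (\<Sum>ys\<in>permutations_of_set {1..n}. prob {\<omega>\<in>space M. ?Q \<omega> = ys})"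
    using Qs[of "{ys}" for ys] by (intro finite_measure_finite_Union) (auto simp: disjoint_family_on_def)
  also have "\<dots> = (\<Sum>ys\<in>permutations_of_set {1..n}. prob {\<omega>\<in>space M. ?Q \<omega> = [1..<Suc n]})"
    by (intro sum.cong const refl)
  also have "\<dots> = fact n * prob {\<omega>\<in>space M. ?Q \<omega> = [1..<Suc n]}" by simp
  finally have c: "prob {\<omega>\<in>space M. ?Q \<omega> = [1..<Suc n]} = 1 / fact n" by (simp add: field_simps del: upt_Suc)
  have p: "prob {\<omega>\<in>space M. ?Q \<omega> = ys} = pmf (uniform_perm {1..n}) ys" for ys
  proof (cases "ys \<in> permutations_of_set {1..n}")
    case True
    then show ?thesis using const[OF True] c by (simp del: upt_Suc)
  next
    case False
    have "prob {\<omega>\<in>space M. ?Q \<omega> = ys} = 0"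
    proof (rule measure_eq_0_null_sets, rule AE_iff_null_sets[THEN iffD2])
      show "{\<omega>\<in>space M. ?Q \<omega> = ys} \<in> events" using Qs[of "{ys}"] by simp
      show "AE \<omega> in M. \<omega> \<notin> {\<omega>\<in>space M. ?Q \<omega> = ys}"
        using inj
      proof eventually_elim
        case (elim \<omega>)
        then show ?case using rank_list_permutation[OF elim] False by blast
      qed
    qed
    then show ?thesis using False by simp
  qed
  show ?thesis
  proof (rule measure_eqI_countable[where A = UNIV])
    fix ys
    have "emeasure (distr M (count_space UNIV) ?Q) {ys} = emeasure M {\<omega>\<in>space M. ?Q \<omega> = ys}"
      using Qm by (subst emeasure_distr) (auto intro!: arg_cong[where f = "emeasure M"])
    then show "emeasure (distr M (count_space UNIV) ?Q) {ys} = emeasure (measure_pmf (uniform_perm {1..n})) {ys}"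
      by (simp add: emeasure_eq_measure p emeasure_pmf_single)
  qed auto
qed

section \<open>Rank columns of a data matrix under independence\<close>

text \<open>Rows are independent by sampling, the entries within a row by the null hypothesis; together this gives
the product formula for all entries.\<close>

lemma (in prob_space) column_entries_independent:
  assumes copies: "independent_copies M d n Y X" and H0: "mutually_indep_components M d X"
    and X: "X \<in> measurable M (vec_space d)" and n: "0 < n" and d: "0 < d"
  shows "indep_vars (\<lambda>_. borel) (\<lambda>p \<omega>. Y (fst p) \<omega> (snd p)) ({1..n} \<times> {1..d})"
    and "i \<in> {1..n} \<Longrightarrow> j \<in> {1..d} \<Longrightarrow> distr M borel (\<lambda>\<omega>. Y i \<omega> j) = distr M borel (\<lambda>\<omega>. X \<omega> j)"
proof -
  have indY: "indep_vars (\<lambda>_. vec_space d) Y {1..n}"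
    and lawY: "\<And>i. i \<in> {1..n} \<Longrightarrow> distr M (vec_space d) (Y i) = distr M (vec_space d) X"
    using copies by (auto simp: independent_copies_def)
  have indX: "indep_vars (\<lambda>_. borel) (\<lambda>j \<omega>. X \<omega> j) {1..d}" using H0 by (simp add: mutually_indep_components_def)
  have Ym: "Y i \<in> measurable M (vec_space d)" if "i \<in> {1..n}" for i using indY that by (simp add: indep_vars_def2)
  have Yc: "(\<lambda>\<omega>. Y i \<omega> j) \<in> borel_measurable M" if "i \<in> {1..n}" "j \<in> {1..d}" for i j
    using measurable_compose[OF Ym[OF that(1)] measurable_component_singleton[OF that(2)]] .
  have Xc: "(\<lambda>\<omega>. X \<omega> j) \<in> borel_measurable M" if "j \<in> {1..d}" for j
    using measurable_compose[OF X measurable_component_singleton[OF that]] .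
  have same: "prob (Y i -` B \<inter> space M) = prob (X -` B \<inter> space M)" if "i \<in> {1..n}" "B \<in> sets (vec_space d)" for i B
    using measure_distr[OF Ym[OF that(1)] that(2)] measure_distr[OF X that(2)] lawY[OF that(1)] by simp
  show law: "distr M borel (\<lambda>\<omega>. Y i \<omega> j) = distr M borel (\<lambda>\<omega>. X \<omega> j)" if ij: "i \<in> {1..n}" "j \<in> {1..d}" for i j
  proof -
    have "distr M borel (\<lambda>\<omega>. Y i \<omega> j) = distr (distr M (vec_space d) (Y i)) borel (\<lambda>f. f j)"
      using Ym[OF ij(1)] measurable_component_singleton[OF ij(2)] by (subst distr_distr) (simp_all add: comp_def)
    also have "\<dots> = distr (distr M (vec_space d) X) borel (\<lambda>f. f j)" by (simp only: lawY[OF ij(1)])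
    also have "\<dots> = distr M borel (\<lambda>\<omega>. X \<omega> j)"
      using X measurable_component_singleton[OF ij(2)] by (subst distr_distr) (simp_all add: comp_def)
    finally show ?thesis .
  qed
  have marg: "prob ((\<lambda>\<omega>. Y i \<omega> j) -` A \<inter> space M) = prob ((\<lambda>\<omega>. X \<omega> j) -` A \<inter> space M)"
    if "i \<in> {1..n}" "j \<in> {1..d}" "A \<in> sets borel" for i j A
    using measure_distr[OF Yc[OF that(1,2)] that(3)] measure_distr[OF Xc[OF that(2)] that(3)] law[OF that(1,2)] by simp
  let ?I = "{1..n} \<times> {1..d}"
  show "indep_vars (\<lambda>_. borel) (\<lambda>p \<omega>. Y (fst p) \<omega> (snd p)) ?I"
  proof (subst indep_vars_finite[where E = "\<lambda>_. sets borel"])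
    show "?I \<noteq> {}" using n d by auto
    show "\<forall>A\<in>(\<Pi> p\<in>?I. sets borel). prob (\<Inter>p\<in>?I. (\<lambda>\<omega>. Y (fst p) \<omega> (snd p)) -` A p \<inter> space M)
       = (\<Prod>p\<in>?I. prob ((\<lambda>\<omega>. Y (fst p) \<omega> (snd p)) -` A p \<inter> space M))"
    proof
      fix A :: "nat \<times> nat \<Rightarrow> real set" assume A: "A \<in> (\<Pi> p\<in>?I. sets borel)"
      define B where "B i = PiE {1..d} (\<lambda>j. A (i, j))" for i
      have As: "A (i, j) \<in> sets borel" if "i \<in> {1..n}" "j \<in> {1..d}" for i j using A that by auto
      have Bs: "B i \<in> sets (vec_space d)" if "i \<in> {1..n}" for i
        unfolding B_def using As[OF that] by (intro sets_PiM_I_finite) auto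
      have row: "prob (Y i -` B i \<inter> space M) = (\<Prod>j\<in>{1..d}. prob ((\<lambda>\<omega>. Y i \<omega> j) -` A (i, j) \<inter> space M))" if i: "i \<in> {1..n}" for i
      proof -
        have "prob (Y i -` B i \<inter> space M) = prob (X -` B i \<inter> space M)" using same i Bs[OF i] .
        also have "X -` B i \<inter> space M = (\<Inter>j\<in>{1..d}. (\<lambda>\<omega>. X \<omega> j) -` A (i, j) \<inter> space M)"
          using measurable_space[OF X] d unfolding B_def by (auto simp: space_PiM PiE_def)
        also have "prob \<dots> = (\<Prod>j\<in>{1..d}. prob ((\<lambda>\<omega>. X \<omega> j) -` A (i, j) \<inter> space M))"
          using As[OF i] d by (intro indep_varsD[OF indX]) auto
        also have "\<dots> = (\<Prod>j\<in>{1..d}. prob ((\<lambda>\<omega>. Y i \<omega> j) -` A (i, j) \<inter> space M))"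
          using marg[OF i] As[OF i] by (intro prod.cong) auto
        finally show ?thesis .
      qed
      have "(\<Inter>p\<in>?I. (\<lambda>\<omega>. Y (fst p) \<omega> (snd p)) -` A p \<inter> space M) = (\<Inter>i\<in>{1..n}. Y i -` B i \<inter> space M)"
      proof -
        have "Y i \<omega> \<in> B i \<longleftrightarrow> (\<forall>j\<in>{1..d}. Y i \<omega> j \<in> A (i, j))" if "i \<in> {1..n}" "\<omega> \<in> space M" for i \<omega>
          using measurable_space[OF Ym[OF that(1)] that(2)] unfolding B_def by (auto simp: space_PiM PiE_def)
        then show ?thesis using n d by force
      qed
      also have "prob \<dots> = (\<Prod>i\<in>{1..n}. prob (Y i -` B i \<inter> space M))"
        using Bs n by (intro indep_varsD[OF indY]) auto
      also have "\<dots> = (\<Prod>i\<in>{1..n}. \<Prod>j\<in>{1..d}. prob ((\<lambda>\<omega>. Y i \<omega> j) -` A (i, j) \<inter> space M))"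
        by (intro prod.cong refl row)
      also have "\<dots> = (\<Prod>p\<in>?I. prob ((\<lambda>\<omega>. Y (fst p) \<omega> (snd p)) -` A p \<inter> space M))"
        by (simp add: prod.cartesian_product case_prod_beta)
      finally show "prob (\<Inter>p\<in>?I. (\<lambda>\<omega>. Y (fst p) \<omega> (snd p)) -` A p \<inter> space M)
       = (\<Prod>p\<in>?I. prob ((\<lambda>\<omega>. Y (fst p) \<omega> (snd p)) -` A p \<inter> space M))" .
    qed
    show "sets borel = sigma_sets (space borel) (sets (borel :: real measure))" by (rule sets.sigma_sets_eq[symmetric])
    show "Int_stable (sets (borel :: real measure))" by (rule sets.Int_stable)
  qed (use Yc in auto)
qed

theorem (in prob_space) rank_lists_iid:
  assumes cont: "continuous_random_vector M d X" and copies: "independent_copies M d n Y X"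
    and H0: "mutually_indep_components M d X" and n: "0 < n" and d: "0 < d"
  shows "iid_objects M (\<lambda>j \<omega>. rank_list n (\<lambda>i. Y i \<omega> j)) (uniform_perm {1..n}) d"
    and "AE \<omega> in M. \<forall>j\<in>{1..d}. inj_on (\<lambda>i. Y i \<omega> j) {1..n}"
proof -
  have X: "X \<in> measurable M (vec_space d)" using cont by (simp add: continuous_random_vector_def)
  note entries = column_entries_independent[OF copies H0 X n d]
  define \<nu> where "\<nu> j = distr M borel (\<lambda>\<omega>. X \<omega> j)" for j
  have Xc: "(\<lambda>\<omega>. X \<omega> j) \<in> borel_measurable M" if "j \<in> {1..d}" for j
    using measurable_compose[OF X measurable_component_singleton[OF that]] .
  have atomless: "measure (\<nu> j) {a} = 0" if j: "j \<in> {1..d}" for j a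
  proof -
    interpret N: prob_space "\<nu> j" unfolding \<nu>_def using Xc[OF j] by (rule prob_space_distr)
    interpret N: finite_borel_measure "\<nu> j" by unfold_locales (simp add: \<nu>_def)
    have "continuous_on UNIV (cdf (\<nu> j))" using cont j by (simp add: continuous_random_vector_def \<nu>_def)
    then have "isCont (cdf (\<nu> j)) a" by (simp add: continuous_on_eq_continuous_at)
    then show ?thesis by (simp add: N.isCont_cdf)
  qed
  have col: "indep_vars (\<lambda>_. borel) (\<lambda>i \<omega>. Y i \<omega> j) {1..n}" if j: "j \<in> {1..d}" for j
  proof -
    have "indep_vars (\<lambda>i. PiM {(i, j)} (\<lambda>_. borel)) (\<lambda>i \<omega>. restrict (\<lambda>p. Y (fst p) \<omega> (snd p)) {(i, j)}) {1..n}"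
      by (rule indep_vars_restrict[OF entries(1)]) (use j in \<open>auto simp: disjoint_family_on_def\<close>)
    from indep_vars_compose2[OF this, of "\<lambda>i f. f (i, j)" "\<lambda>_. borel"] show ?thesis
      by (simp add: measurable_component_singleton)
  qed
  have law: "distr M (count_space UNIV) (\<lambda>\<omega>. rank_list n (\<lambda>i. Y i \<omega> j)) = measure_pmf (uniform_perm {1..n})" if j: "j \<in> {1..d}" for j
    using col[OF j] n entries(2)[OF _ j] atomless[OF j] unfolding \<nu>_def by (rule rank_list_uniform)
  have AEj: "AE \<omega> in M. inj_on (\<lambda>i. Y i \<omega> j) {1..n}" if j: "j \<in> {1..d}" for j
  proof (rule AE_inj_on_indep[OF _ col[OF j]])
    fix i a assume "i \<in> {1..n}"
    then show "measure (distr M borel (\<lambda>\<omega>. Y i \<omega> j)) {a} = 0"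
      using entries(2)[OF _ j] atomless[OF j, of a] by (simp add: \<nu>_def)
  qed simp
  then show "AE \<omega> in M. \<forall>j\<in>{1..d}. inj_on (\<lambda>i. Y i \<omega> j) {1..n}" by (intro AE_finite_allI) auto
  have blocks: "indep_vars (\<lambda>j. PiM ({1..n} \<times> {j}) (\<lambda>_. borel)) (\<lambda>j \<omega>. restrict (\<lambda>p. Y (fst p) \<omega> (snd p)) ({1..n} \<times> {j})) {1..d}"
    by (rule indep_vars_restrict[OF entries(1)]) (auto simp: disjoint_family_on_def)
  have "indep_vars (\<lambda>_. count_space UNIV) (\<lambda>j \<omega>. rank_list n (\<lambda>i. restrict (\<lambda>p. Y (fst p) \<omega> (snd p)) ({1..n} \<times> {j}) (i, j))) {1..d}"
  proof (rule indep_vars_compose2[OF blocks])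
    fix j assume "j \<in> {1..d}"
    show "(\<lambda>f. rank_list n (\<lambda>i. f (i, j))) \<in> measurable (PiM ({1..n} \<times> {j}) (\<lambda>_. borel)) (count_space UNIV)"
      by (rule rank_list_measurable) (rule measurable_component_singleton, simp)
  qed
  moreover have "rank_list n (\<lambda>i. restrict (\<lambda>p. Y (fst p) \<omega> (snd p)) ({1..n} \<times> {j}) (i, j)) = rank_list n (\<lambda>i. Y i \<omega> j)" for j \<omega>
    unfolding rank_list_def by (intro map_cong refl arg_cong[where f = card]) auto
  ultimately have "indep_vars (\<lambda>_. count_space UNIV) (\<lambda>j \<omega>. rank_list n (\<lambda>i. Y i \<omega> j)) {1..d}" by (simp only:)
  then show "iid_objects M (\<lambda>j \<omega>. rank_list n (\<lambda>i. Y i \<omega> j)) (uniform_perm {1..n}) d"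
    using law by unfold_locales auto
qed

section \<open>Covariance and concordance of two rank columns\<close>

definition rank_covariance :: "nat \<Rightarrow> nat list \<Rightarrow> nat list \<Rightarrow> real" where
  "rank_covariance n xs ys = (\<Sum>i<n. (real (xs ! i) - (real n + 1) / 2) * (real (ys ! i) - (real n + 1) / 2))"

text \<open>Twice the number of concordant minus discordant pairs of observations; the full double sum is easier to
relabel than the sum over \<open>i < i'\<close>.\<close>

definition concordance :: "nat \<Rightarrow> nat list \<Rightarrow> nat list \<Rightarrow> real" where
  "concordance n xs ys = (\<Sum>i<n. \<Sum>i'<n. sgn (real (xs ! i') - real (xs ! i)) * sgn (real (ys ! i') - real (ys ! i)))"

lemma rank_covariance_sym: "rank_covariance n xs ys = rank_covariance n ys xs"
  by (simp add: rank_covariance_def mult.commute)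

lemma concordance_sym: "concordance n xs ys = concordance n ys xs"
  by (simp add: concordance_def mult.commute)

lemma sum_permutes_nth:
  assumes "\<sigma> permutes {..<n}" shows "(\<Sum>i<n. g (\<sigma> i)) = (\<Sum>i<n. g i)"
  using sum.permute[OF assms, of g] by (simp add: comp_def)

lemma rank_covariance_permute:
  assumes "\<sigma> permutes {..<n}" "length xs = n" "length ys = n"
  shows "rank_covariance n (permute_list \<sigma> xs) (permute_list \<sigma> ys) = rank_covariance n xs ys"
  unfolding rank_covariance_def using assms
  by (subst sum_permutes_nth[OF assms(1), symmetric]) (simp add: permute_list_nth)

lemma concordance_permute:
  assumes "\<sigma> permutes {..<n}" "length xs = n" "length ys = n"
  shows "concordance n (permute_list \<sigma> xs) (permute_list \<sigma> ys) = concordance n xs ys"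
proof -
  have "concordance n (permute_list \<sigma> xs) (permute_list \<sigma> ys) = (\<Sum>i<n. \<Sum>i'<n. sgn (real (xs ! \<sigma> i') - real (xs ! \<sigma> i)) * sgn (real (ys ! \<sigma> i') - real (ys ! \<sigma> i)))"
    unfolding concordance_def using assms by (intro sum.cong refl) (simp add: permute_list_nth)
  also have "\<dots> = (\<Sum>i<n. \<Sum>i'<n. sgn (real (xs ! i') - real (xs ! \<sigma> i)) * sgn (real (ys ! i') - real (ys ! \<sigma> i)))"
    by (intro sum.cong refl sum_permutes_nth[OF assms(1), of "\<lambda>i'. sgn (real (xs ! i') - real (xs ! \<sigma> i)) * sgn (real (ys ! i') - real (ys ! \<sigma> i))" for i])
  also have "\<dots> = concordance n xs ys"
    unfolding concordance_def
    by (rule sum_permutes_nth[OF assms(1), of "\<lambda>i. \<Sum>i'<n. sgn (real (xs ! i') - real (xs ! i)) * sgn (real (ys ! i') - real (ys ! i))"])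
  finally show ?thesis .
qed

text \<open>A relabelling that sorts \<open>xs\<close> maps the uniform distribution on permutations to itself.\<close>

lemma uniform_perm_section_invariant:
  assumes xs: "xs \<in> permutations_of_set {1..n}"
    and inv: "\<And>\<sigma> xs ys. \<sigma> permutes {..<n} \<Longrightarrow> length xs = n \<Longrightarrow> length ys = n \<Longrightarrow> P (permute_list \<sigma> xs) (permute_list \<sigma> ys) = P xs ys"
  shows "measure_pmf.prob (uniform_perm {1..n}) {ys. P xs ys} = measure_pmf.prob (uniform_perm {1..n}) {ys. P [1..<Suc n] ys}"
proof -
  let ?S = "permutations_of_set {1..n}"
  have lx: "length xs = n" using length_finite_permutations_of_set[OF xs] by simp
  have s: "set [1..<Suc n] = {1..n}" by auto
  have "mset xs = mset [1..<Suc n]"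
    using xs s by (subst set_eq_iff_mset_eq_distinct[symmetric]) (auto dest: permutations_of_setD simp del: upt_Suc)
  then obtain \<sigma> where \<sigma>: "\<sigma> permutes {..<length [1..<Suc n]}" "permute_list \<sigma> [1..<Suc n] = xs"
    by (rule mset_eq_permutation)
  have \<sigma>n: "\<sigma> permutes {..<n}" using \<sigma>(1) unfolding length_upt by simp
  have len: "length ys = n" if "ys \<in> ?S" for ys using length_finite_permutations_of_set[OF that] by simp
  have img: "permute_list \<sigma> ys \<in> ?S" if "ys \<in> ?S" for ys
    using that \<sigma>n len[OF that] by (auto intro!: permutations_of_setI dest: permutations_of_setD)
  have inj: "inj_on (permute_list \<sigma>) ?S"
  proof (rule inj_onI)
    fix a b assume ab: "a \<in> ?S" "b \<in> ?S" "permute_list \<sigma> a = permute_list \<sigma> b"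
    show "a = b"
    proof (rule nth_equalityI)
      fix i assume "i < length a"
      then have i: "i < n" using len ab by simp
      have "inv \<sigma> i < n" using permutes_in_image[OF permutes_inv[OF \<sigma>n], of i] i by simp
      then have "a ! \<sigma> (inv \<sigma> i) = b ! \<sigma> (inv \<sigma> i)"
        using permute_list_nth[of \<sigma> a "inv \<sigma> i"] permute_list_nth[of \<sigma> b "inv \<sigma> i"] ab len \<sigma>n by simp
      then show "a ! i = b ! i" using permutes_inverses(1)[OF \<sigma>n] by simp
    qed (use len ab in simp)
  qed
  have "permute_list \<sigma> ` ?S = ?S"
    using img inj by (intro card_subset_eq) (auto simp: card_image)
  then have "bij_betw (permute_list \<sigma>) ?S ?S" using inj by (simp add: bij_betw_def)
  then have "map_pmf (permute_list \<sigma>) (uniform_perm {1..n}) = uniform_perm {1..n}"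
    by (intro map_pmf_of_set_bij_betw) auto
  then have "measure_pmf.prob (uniform_perm {1..n}) {ys. P xs ys} = measure_pmf.prob (map_pmf (permute_list \<sigma>) (uniform_perm {1..n})) {ys. P xs ys}" by simp
  also have "\<dots> = measure_pmf.prob (uniform_perm {1..n}) {ys. P xs (permute_list \<sigma> ys)}" by (simp add: vimage_def)
  also have "\<dots> = measure_pmf.prob (uniform_perm {1..n}) {ys. P [1..<Suc n] ys}"
  proof (rule measure_pmf.finite_measure_eq_AE)
    show "AE ys in uniform_perm {1..n}. (ys \<in> {ys. P xs (permute_list \<sigma> ys)}) = (ys \<in> {ys. P [1..<Suc n] ys})"
      unfolding AE_measure_pmf_iff using inv[OF \<sigma>n _ len] \<sigma>(2) by (auto simp del: upt_Suc)
  qed auto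
  finally show ?thesis .
qed

lemma rank_covariance_id:
  assumes "length ys = n" shows "rank_covariance n [1..<Suc n] ys = spearman_sum n ys"
proof -
  have "rank_covariance n [1..<Suc n] ys = (\<Sum>i<n. (real i - (real n - 1) / 2) * real (ys ! i) - (real n + 1) / 2 * (real i - (real n - 1) / 2))"
    unfolding rank_covariance_def
  proof (rule sum.cong[OF refl])
    fix i assume "i \<in> {..<n}"
    then have "real ([1..<Suc n] ! i) - (real n + 1) / 2 = real i - (real n - 1) / 2"
      by (simp add: field_simps del: upt_Suc)
    then show "(real ([1..<Suc n] ! i) - (real n + 1) / 2) * (real (ys ! i) - (real n + 1) / 2) =
      (real i - (real n - 1) / 2) * real (ys ! i) - (real n + 1) / 2 * (real i - (real n - 1) / 2)"
      by (simp only:) (simp only: right_diff_distrib mult.commute)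
  qed
  also have "\<dots> = uniform_score n (\<lambda>i. real (ys ! i))"
    unfolding sum_subtractf[of "\<lambda>i. (real i - (real n - 1) / 2) * real (ys ! i)"] sum_distrib_left[symmetric] sum_centered
    by (simp add: uniform_score_def)
  finally show ?thesis unfolding spearman_sum_def sum_list_zip_centered[OF assms] .
qed

lemma sgn_sum_nth: "sgn_sum ys = (\<Sum>i<length ys. \<Sum>i'\<in>{Suc i..<length ys}. sgn (real (ys ! i') - real (ys ! i)))"
proof (induction ys)
  case (Cons y ys)
  have "(\<Sum>i'\<in>{Suc 0..<Suc (length ys)}. sgn (real ((y # ys) ! i') - real y)) = (\<Sum>z\<leftarrow>ys. sgn (real z - real y))"
    by (subst sum.shift_bounds_Suc_ivl) (simp add: sum_list_sum_nth)
  moreover have "(\<Sum>i'\<in>{Suc (Suc i)..<Suc (length ys)}. sgn (real ((y # ys) ! i') - real (ys ! i))) = (\<Sum>i'\<in>{Suc i..<length ys}. sgn (real (ys ! i') - real (ys ! i)))" for i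
    by (subst sum.shift_bounds_Suc_ivl) simp
  ultimately show ?case using Cons.IH by (simp only: length_Cons sum.lessThan_Suc_shift sgn_sum.simps nth_Cons_0 nth_Cons_Suc)
qed simp

lemma sum_symmetric_square:
  fixes g :: "nat \<Rightarrow> nat \<Rightarrow> real"
  assumes sym: "\<And>i i'. g i i' = g i' i" and diag: "\<And>i. g i i = 0"
  shows "(\<Sum>i<n. \<Sum>i'<n. g i i') = 2 * (\<Sum>i<n. \<Sum>i'\<in>{Suc i..<n}. g i i')"
proof (induction n)
  case (Suc n)
  have "(\<Sum>i<Suc n. \<Sum>i'<Suc n. g i i') = (\<Sum>i<n. \<Sum>i'<n. g i i') + 2 * (\<Sum>i<n. g i n)"
    by (simp add: sum.distrib diag sym[of n])
  moreover have "(\<Sum>i<Suc n. \<Sum>i'\<in>{Suc i..<Suc n}. g i i') = (\<Sum>i<n. \<Sum>i'\<in>{Suc i..<n}. g i i') + (\<Sum>i<n. g i n)"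
    by (simp add: sum.distrib)
  ultimately show ?case using Suc.IH by simp
qed simp

lemma concordance_half:
  "concordance n xs ys = 2 * (\<Sum>i<n. \<Sum>i'\<in>{Suc i..<n}. sgn (real (xs ! i') - real (xs ! i)) * sgn (real (ys ! i') - real (ys ! i)))"
  unfolding concordance_def
proof (rule sum_symmetric_square)
  fix i i'
  have "sgn (a - b) * sgn (c - d) = sgn (b - a) * sgn (d - c)" for a b c d :: real
    using sgn_minus[of "a - b"] sgn_minus[of "c - d"] by simp
  then show "sgn (real (xs ! i') - real (xs ! i)) * sgn (real (ys ! i') - real (ys ! i)) = sgn (real (xs ! i) - real (xs ! i')) * sgn (real (ys ! i) - real (ys ! i'))" .
qed simp

lemma concordance_id:
  assumes "length ys = n" shows "concordance n [1..<Suc n] ys = 2 * sgn_sum ys"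
  unfolding concordance_half sgn_sum_nth assms
  by (intro arg_cong[where f = "(*) 2"] sum.cong refl) (simp del: upt_Suc)

text \<open>A data matrix with prescribed rank columns. It is on these representatives that the four statistics are
evaluated; list positions count from 0, observations from 1.\<close>

definition rank_matrix :: "(nat \<Rightarrow> nat list) \<Rightarrow> nat \<Rightarrow> nat \<Rightarrow> real" where
  "rank_matrix Q i j = real (Q j ! (i - 1))"

lemma sum_from_1: "(\<Sum>i=1..n. g i) = (\<Sum>i<n. g (Suc i))"
  by (metis One_nat_def atLeast0LessThan atLeastLessThanSuc_atLeastAtMost sum.shift_bounds_Suc_ivl)

lemma samp_rank_rank_matrix:
  assumes q: "Q j \<in> permutations_of_set {1..n}" and i: "i < n"
  shows "samp_rank n (rank_matrix Q) j (Suc i) = Q j ! i"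
proof -
  have d: "distinct (Q j)" "set (Q j) = {1..n}" "length (Q j) = n"
    using q length_finite_permutations_of_set[OF q] by (auto dest: permutations_of_setD)
  have bij: "bij_betw (\<lambda>m. Q j ! (m - 1)) {1..n} {1..n}"
  proof -
    have "bij_betw ((!) (Q j)) {..<n} {1..n}" using d bij_betw_nth[OF d(1), of "{..<n}" "{1..n}"] by simp
    moreover have "bij_betw (\<lambda>m. m - 1) {1..n} {..<n}"
      by (rule bij_betwI[where g = Suc]) auto
    ultimately have "bij_betw ((!) (Q j) \<circ> (\<lambda>m. m - 1)) {1..n} {1..n}" by (metis bij_betw_trans)
    then show ?thesis by (simp add: comp_def)
  qed
  have r: "Q j ! i \<in> {1..n}" using d i nth_mem by metis
  have "bij_betw (\<lambda>m. Q j ! (m - 1)) {m\<in>{1..n}. Q j ! (m - 1) \<le> Q j ! i} {v\<in>{1..n}. v \<le> Q j ! i}"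
    using bij by (rule bij_betw_Collect) auto
  then have "card {m\<in>{1..n}. Q j ! (m - 1) \<le> Q j ! i} = card {v\<in>{1..n}. v \<le> Q j ! i}" by (rule bij_betw_same_card)
  also have "{v\<in>{1..n}. v \<le> Q j ! i} = {1..Q j ! i}" using r by auto
  finally show ?thesis by (simp add: samp_rank_def rank_matrix_def)
qed

lemma rel_rank_sum_rank_matrix:
  assumes qj: "Q j \<in> permutations_of_set {1..n}" and qk: "Q k \<in> permutations_of_set {1..n}"
  shows "(\<Sum>i=1..n. (real i - (real n + 1) / 2) * (real (rel_rank n (rank_matrix Q) j k i) - (real n + 1) / 2)) = rank_covariance n (Q j) (Q k)"
proof -
  have d: "distinct (Q j)" "set (Q j) = {1..n}" "length (Q j) = n"
    using qj length_finite_permutations_of_set[OF qj] by (auto dest: permutations_of_setD)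
  have rel: "rel_rank n (rank_matrix Q) j k (Q j ! i) = Q k ! i" if i: "i < n" for i
    unfolding rel_rank_def
  proof (rule the_equality)
    show "\<exists>i'\<in>{1..n}. samp_rank n (rank_matrix Q) j i' = Q j ! i \<and> Q k ! i = samp_rank n (rank_matrix Q) k i'"
      using i samp_rank_rank_matrix[of Q j n i, OF qj i] samp_rank_rank_matrix[of Q k n i, OF qk i]
      by (intro bexI[of _ "Suc i"]) auto
    fix r assume "\<exists>i'\<in>{1..n}. samp_rank n (rank_matrix Q) j i' = Q j ! i \<and> r = samp_rank n (rank_matrix Q) k i'"
    then obtain i' where i': "i' \<in> {1..n}" "samp_rank n (rank_matrix Q) j i' = Q j ! i" "r = samp_rank n (rank_matrix Q) k i'" by blast
    then obtain m where m: "i' = Suc m" "m < n" by (cases i') auto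
    have "Q j ! m = Q j ! i" using i'(2) m samp_rank_rank_matrix[of Q j n m, OF qj m(2)] by simp
    then have "m = i" using d i m by (simp add: nth_eq_iff_index_eq)
    then show "r = Q k ! i" using i'(3) m samp_rank_rank_matrix[of Q k n m, OF qk m(2)] by simp
  qed
  have "bij_betw ((!) (Q j)) {..<n} {1..n}" using d bij_betw_nth[OF d(1), of "{..<n}" "{1..n}"] by simp
  from sum.reindex_bij_betw[OF this, of "\<lambda>i. (real i - (real n + 1) / 2) * (real (rel_rank n (rank_matrix Q) j k i) - (real n + 1) / 2)", symmetric]
  have "(\<Sum>i=1..n. (real i - (real n + 1) / 2) * (real (rel_rank n (rank_matrix Q) j k i) - (real n + 1) / 2))
    = (\<Sum>i<n. (real (Q j ! i) - (real n + 1) / 2) * (real (rel_rank n (rank_matrix Q) j k (Q j ! i)) - (real n + 1) / 2))" .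
  also have "\<dots> = rank_covariance n (Q j) (Q k)"
    unfolding rank_covariance_def by (rule sum.cong[OF refl]) (simp add: rel)
  finally show ?thesis .
qed

lemma kendall_tau_rank_matrix:
  "kendall_tau n (rank_matrix Q) j k = concordance n (Q j) (Q k) / (real n * (real n - 1))"
proof -
  let ?g = "\<lambda>i i'. sgn (rank_matrix Q i' j - rank_matrix Q i j) * sgn (rank_matrix Q i' k - rank_matrix Q i k)"
  have "{(i, i'). 1 \<le> i \<and> i < i' \<and> i' \<le> n} = (SIGMA i:{1..n}. {Suc i..n})" by auto
  then have "(\<Sum>(i, i') \<in> {(i, i'). 1 \<le> i \<and> i < i' \<and> i' \<le> n}. ?g i i') = (\<Sum>i=1..n. \<Sum>i'=Suc i..n. ?g i i')"
    by (simp add: sum.Sigma)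
  also have "\<dots> = (\<Sum>i<n. \<Sum>i'=Suc (Suc i)..n. ?g (Suc i) i')" by (rule sum_from_1)
  also have "\<dots> = (\<Sum>i<n. \<Sum>i'\<in>{Suc i..<n}. ?g (Suc i) (Suc i'))"
  proof (rule sum.cong[OF refl])
    fix i
    have "{Suc (Suc i)..n} = {Suc (Suc i)..<Suc n}" by auto
    then show "(\<Sum>i'=Suc (Suc i)..n. ?g (Suc i) i') = (\<Sum>i'\<in>{Suc i..<n}. ?g (Suc i) (Suc i'))"
      by (simp only: sum.shift_bounds_Suc_ivl)
  qed
  also have "\<dots> = concordance n (Q j) (Q k) / 2" unfolding concordance_half by (simp add: rank_matrix_def)
  finally show ?thesis unfolding kendall_tau_def by simp
qed

text \<open>Comparing a rank with all others counts how many are smaller and larger, which is an affine function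
of the rank.\<close>

lemma sum_sgn_permutation:
  assumes q: "xs \<in> permutations_of_set {1..n}" and i: "i < n"
  shows "(\<Sum>i'<n. sgn (real (xs ! i) - real (xs ! i'))) = 2 * (real (xs ! i) - (real n + 1) / 2)"
proof -
  have d: "distinct xs" "set xs = {1..n}" "length xs = n"
    using q length_finite_permutations_of_set[OF q] by (auto dest: permutations_of_setD)
  have r: "xs ! i \<in> {1..n}" using d i nth_mem by metis
  have "bij_betw ((!) xs) {..<n} {1..n}" using d bij_betw_nth[OF d(1), of "{..<n}" "{1..n}"] by simp
  from sum.reindex_bij_betw[OF this, of "\<lambda>v. sgn (real (xs ! i) - real v)"]
  have "(\<Sum>i'<n. sgn (real (xs ! i) - real (xs ! i'))) = (\<Sum>v\<in>{1..n}. sgn (real (xs ! i) - real v))" .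
  also have "\<dots> = (\<Sum>v\<in>{1..n} - {xs ! i}. sgn (real (xs ! i) - real v))"
    by (rule sum.mono_neutral_right) auto
  also have "\<dots> = - (\<Sum>v\<in>{1..n} - {xs ! i}. sgn (real v - real (xs ! i)))"
    unfolding sum_negf[symmetric] by (intro sum.cong refl) (simp add: sgn_minus[symmetric] del: sgn_minus)
  also have "(\<Sum>v\<in>{1..n} - {xs ! i}. sgn (real v - real (xs ! i))) = real (card {1..n}) - 1 - 2 * real (card {z\<in>{1..n}. z < xs ! i})"
    using r by (intro sum_sgn_rank) auto
  also have "{z\<in>{1..n}. z < xs ! i} = {1..<xs ! i}" using r by auto
  also have "real (card {1..<xs ! i}) = real (xs ! i) - 1" using r by (simp add: of_nat_diff)
  finally show ?thesis by (simp add: field_simps)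
qed

text \<open>Summed over all \<open>i'\<close> and \<open>i''\<close> the signs factorize into the centred ranks of both columns, up to the factor 4.
The triples with \<open>i' = i''\<close> that must be taken away again form Kendall's sum, and those with \<open>i = i'\<close> or
\<open>i = i''\<close> vanish.\<close>

lemma spearman_rho_major_rank_matrix:
  assumes qj: "Q j \<in> permutations_of_set {1..n}" and qk: "Q k \<in> permutations_of_set {1..n}"
  shows "spearman_rho_major n (rank_matrix Q) j k = 3 / (real n * (real n - 1) * (real n - 2)) * (4 * rank_covariance n (Q j) (Q k) - concordance n (Q j) (Q k))"
proof -
  define f where "f i i' = sgn (real (Q j ! i) - real (Q j ! i'))" for i i'
  define g where "g i i' = sgn (real (Q k ! i) - real (Q k ! i'))" for i i'
  let ?h = "\<lambda>i i' i''. sgn (rank_matrix Q i j - rank_matrix Q i' j) * sgn (rank_matrix Q i k - rank_matrix Q i'' k)"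
  let ?T = "{(i, i', i''). i \<in> {1..n} \<and> i' \<in> {1..n} \<and> i'' \<in> {1..n} \<and> i \<noteq> i' \<and> i \<noteq> i'' \<and> i' \<noteq> i''}"
  let ?A = "{1..n} \<times> {1..n} \<times> {1..n}"
  have "(\<Sum>(i, i', i'')\<in>?T. ?h i i' i'') = (\<Sum>(i, i', i'')\<in>?A. if i' = i'' then 0 else ?h i i' i'')"
    by (rule sum.mono_neutral_cong_left) (auto split: if_splits)
  also have "\<dots> = (\<Sum>i=1..n. \<Sum>i'=1..n. \<Sum>i''=1..n. if i' = i'' then 0 else ?h i i' i'')"
    by (simp add: sum.cartesian_product)
  also have "\<dots> = (\<Sum>i=1..n. \<Sum>i'=1..n. (\<Sum>i''=1..n. ?h i i' i'') - ?h i i' i')"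
  proof (intro sum.cong refl)
    fix i i' assume i': "i' \<in> {1..n}"
    have "(\<Sum>i''=1..n. if i' = i'' then 0 else ?h i i' i'') = (\<Sum>i''=1..n. ?h i i' i'' - (if i'' = i' then ?h i i' i'' else 0))"
      by (intro sum.cong refl) auto
    also have "\<dots> = (\<Sum>i''=1..n. ?h i i' i'') - ?h i i' i'"
      using i' by (simp add: sum_subtractf sum.delta)
    finally show "(\<Sum>i''=1..n. if i' = i'' then 0 else ?h i i' i'') = (\<Sum>i''=1..n. ?h i i' i'') - ?h i i' i'" .
  qed
  also have "\<dots> = (\<Sum>i<n. \<Sum>i'<n. (\<Sum>i''<n. f i i' * g i i'') - f i i' * g i i')"
    unfolding sum_from_1 rank_matrix_def f_def g_def by simp
  also have "\<dots> = (\<Sum>i<n. (\<Sum>i'<n. f i i') * (\<Sum>i''<n. g i i'')) - (\<Sum>i<n. \<Sum>i'<n. f i i' * g i i')"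
    by (simp add: sum_subtractf sum_product)
  also have "(\<Sum>i<n. (\<Sum>i'<n. f i i') * (\<Sum>i''<n. g i i'')) = 4 * rank_covariance n (Q j) (Q k)"
  proof -
    have "(\<Sum>i<n. (\<Sum>i'<n. f i i') * (\<Sum>i''<n. g i i''))
      = (\<Sum>i<n. 4 * ((real (Q j ! i) - (real n + 1) / 2) * (real (Q k ! i) - (real n + 1) / 2)))"
    proof (rule sum.cong[OF refl])
      fix i assume "i \<in> {..<n}"
      then have i: "i < n" by simp
      have "2 * A * (2 * B) = 4 * (A * B)" for A B :: real by simp
      then show "(\<Sum>i'<n. f i i') * (\<Sum>i''<n. g i i'') = 4 * ((real (Q j ! i) - (real n + 1) / 2) * (real (Q k ! i) - (real n + 1) / 2))"
        unfolding f_def g_def sum_sgn_permutation[OF qj i] sum_sgn_permutation[OF qk i] .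
    qed
    then show ?thesis unfolding rank_covariance_def sum_distrib_left .
  qed
  also have "(\<Sum>i<n. \<Sum>i'<n. f i i' * g i i') = concordance n (Q j) (Q k)"
    unfolding concordance_def f_def g_def by (rule sum.swap)
  finally show ?thesis unfolding spearman_rho_major_def by (simp only:)
qed

section \<open>Statistics that depend on the ranks only\<close>

text \<open>Columns with ties are compared as well, so that such a statistic may be evaluated on the matrix of ranks for
every outcome, without an exceptional set.\<close>

definition rank_based :: "nat \<Rightarrow> ((nat \<Rightarrow> nat \<Rightarrow> real) \<Rightarrow> nat \<Rightarrow> nat \<Rightarrow> real) \<Rightarrow> bool" where
  "rank_based n S \<longleftrightarrow> (\<forall>x x' j k.
     (\<forall>i\<in>{1..n}. \<forall>i'\<in>{1..n}. (x i j \<le> x i' j \<longleftrightarrow> x' i j \<le> x' i' j) \<and> (x i k \<le> x i' k \<longleftrightarrow> x' i k \<le> x' i' k)) \<longrightarrow>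
     S x j k = S x' j k)"

lemma sgn_diff_order:
  fixes a b c d :: real
  assumes "a \<le> b \<longleftrightarrow> c \<le> d" "b \<le> a \<longleftrightarrow> d \<le> c"
  shows "sgn (a - b) = sgn (c - d)"
  using assms by (auto simp: sgn_if)

lemma samp_rank_order:
  assumes "\<forall>i\<in>{1..n}. \<forall>i'\<in>{1..n}. (x i j \<le> x i' j \<longleftrightarrow> x' i j \<le> x' i' j)" "i \<in> {1..n}"
  shows "samp_rank n x j i = samp_rank n x' j i"
  unfolding samp_rank_def using assms by (intro arg_cong[where f = card]) auto

lemma rel_rank_order:
  assumes "\<forall>i\<in>{1..n}. \<forall>i'\<in>{1..n}. (x i j \<le> x i' j \<longleftrightarrow> x' i j \<le> x' i' j) \<and> (x i k \<le> x i' k \<longleftrightarrow> x' i k \<le> x' i' k)"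
  shows "rel_rank n x j k = rel_rank n x' j k"
proof
  fix i
  have "samp_rank n x j i' = samp_rank n x' j i'" "samp_rank n x k i' = samp_rank n x' k i'" if "i' \<in> {1..n}" for i'
    by (rule samp_rank_order[OF _ that], use assms in blast)+
  then have "(\<exists>i'\<in>{1..n}. samp_rank n x j i' = i \<and> r = samp_rank n x k i') \<longleftrightarrow> (\<exists>i'\<in>{1..n}. samp_rank n x' j i' = i \<and> r = samp_rank n x' k i')" for r
    by (intro bex_cong) auto
  then show "rel_rank n x j k i = rel_rank n x' j k i" unfolding rel_rank_def by simp
qed

lemma rank_based_spearman_rho: "rank_based n (spearman_rho n)"
  unfolding rank_based_def
proof (intro allI impI)
  fix x x' :: "nat \<Rightarrow> nat \<Rightarrow> real" and j k
  assume "\<forall>i\<in>{1..n}. \<forall>i'\<in>{1..n}. (x i j \<le> x i' j \<longleftrightarrow> x' i j \<le> x' i' j) \<and> (x i k \<le> x i' k \<longleftrightarrow> x' i k \<le> x' i' k)"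
  then have "rel_rank n x j k = rel_rank n x' j k" by (rule rel_rank_order)
  then show "spearman_rho n x j k = spearman_rho n x' j k" by (simp add: spearman_rho_def)
qed

lemma rank_based_kendall_tau_proj: "rank_based n (kendall_tau_proj n)"
  unfolding rank_based_def
proof (intro allI impI)
  fix x x' :: "nat \<Rightarrow> nat \<Rightarrow> real" and j k
  assume "\<forall>i\<in>{1..n}. \<forall>i'\<in>{1..n}. (x i j \<le> x i' j \<longleftrightarrow> x' i j \<le> x' i' j) \<and> (x i k \<le> x i' k \<longleftrightarrow> x' i k \<le> x' i' k)"
  then have "rel_rank n x j k = rel_rank n x' j k" by (rule rel_rank_order)
  then show "kendall_tau_proj n x j k = kendall_tau_proj n x' j k" by (simp add: kendall_tau_proj_def)
qed

lemma rank_based_kendall_tau: "rank_based n (kendall_tau n)"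
  unfolding rank_based_def kendall_tau_def
proof (intro allI impI arg_cong2[where f = "(*)"] refl sum.cong)
  fix x x' :: "nat \<Rightarrow> nat \<Rightarrow> real" and j k p
  assume h: "\<forall>i\<in>{1..n}. \<forall>i'\<in>{1..n}. (x i j \<le> x i' j \<longleftrightarrow> x' i j \<le> x' i' j) \<and> (x i k \<le> x i' k \<longleftrightarrow> x' i k \<le> x' i' k)"
    and p: "p \<in> {(i, i'). 1 \<le> i \<and> i < i' \<and> i' \<le> n}"
  obtain i i' where p': "p = (i, i')" by (cases p)
  then have "i \<in> {1..n}" "i' \<in> {1..n}" using p by auto
  with h have "sgn (x i' j - x i j) = sgn (x' i' j - x' i j)" "sgn (x i' k - x i k) = sgn (x' i' k - x' i k)"
    by (intro sgn_diff_order; blast)+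
  then show "(case p of (i, i') \<Rightarrow> sgn (x i' j - x i j) * sgn (x i' k - x i k)) = (case p of (i, i') \<Rightarrow> sgn (x' i' j - x' i j) * sgn (x' i' k - x' i k))"
    by (simp add: p')
qed

lemma rank_based_spearman_rho_major: "rank_based n (spearman_rho_major n)"
  unfolding rank_based_def spearman_rho_major_def
proof (intro allI impI arg_cong2[where f = "(*)"] refl sum.cong)
  fix x x' :: "nat \<Rightarrow> nat \<Rightarrow> real" and j k p
  assume h: "\<forall>i\<in>{1..n}. \<forall>i'\<in>{1..n}. (x i j \<le> x i' j \<longleftrightarrow> x' i j \<le> x' i' j) \<and> (x i k \<le> x i' k \<longleftrightarrow> x' i k \<le> x' i' k)"
    and p: "p \<in> {(i, i', i''). i \<in> {1..n} \<and> i' \<in> {1..n} \<and> i'' \<in> {1..n} \<and> i \<noteq> i' \<and> i \<noteq> i'' \<and> i' \<noteq> i''}"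
  obtain i i' i'' where p': "p = (i, i', i'')" by (cases p)
  then have "i \<in> {1..n}" "i' \<in> {1..n}" "i'' \<in> {1..n}" using p by auto
  with h have "sgn (x i j - x i' j) = sgn (x' i j - x' i' j)" "sgn (x i k - x i'' k) = sgn (x' i k - x' i'' k)"
    by (intro sgn_diff_order; blast)+
  then show "(case p of (i, i', i'') \<Rightarrow> sgn (x i j - x i' j) * sgn (x i k - x i'' k)) = (case p of (i, i', i'') \<Rightarrow> sgn (x' i j - x' i' j) * sgn (x' i k - x' i'' k))"
    by (simp add: p')
qed

text \<open>The matrix of ranks orders the observations as the data do.\<close>

lemma rank_based_rank_list:
  assumes S: "rank_based n S" and Q: "Q j = rank_list n (\<lambda>i. x i j)" "Q k = rank_list n (\<lambda>i. x i k)"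
  shows "S x j k = S (rank_matrix Q) j k"
proof -
  have "x i l \<le> x i' l \<longleftrightarrow> rank_matrix Q i l \<le> rank_matrix Q i' l" if l: "Q l = rank_list n (\<lambda>i. x i l)" and i: "i \<in> {1..n}" "i' \<in> {1..n}" for i i' l
  proof -
    have r: "rank_matrix Q a l = real (card {m\<in>{1..n}. x m l \<le> x a l})" if "a \<in> {1..n}" for a
    proof -
      have "[1..<Suc n] ! (a - 1) = a" using that by (subst nth_upt) auto
      moreover have "a - 1 < length [1..<Suc n]" using that by auto
      ultimately show ?thesis unfolding rank_matrix_def l rank_list_def by (simp only: nth_map)
    qed
    have mono: "card {m\<in>{1..n}. x m l \<le> x a l} \<le> card {m\<in>{1..n}. x m l \<le> x b l}" if "x a l \<le> x b l" for a b
      using that by (intro card_mono) auto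
    have strict: "card {m\<in>{1..n}. x m l \<le> x a l} < card {m\<in>{1..n}. x m l \<le> x b l}" if "x a l < x b l" "b \<in> {1..n}" for a b
    proof (intro psubset_card_mono psubsetI)
      have "b \<in> {m\<in>{1..n}. x m l \<le> x b l}" "b \<notin> {m\<in>{1..n}. x m l \<le> x a l}" using that by auto
      then show "{m\<in>{1..n}. x m l \<le> x a l} \<noteq> {m\<in>{1..n}. x m l \<le> x b l}" by blast
    qed (use that in auto)
    show ?thesis unfolding r[OF i(1)] r[OF i(2)] of_nat_le_iff using mono[of i i'] strict[of i' i] i(1)
      by (meson not_le)
  qed
  then show ?thesis using S Q unfolding rank_based_def by blast
qed

section \<open>The threshold\<close>

text \<open>Since \<open>x\<^sup>2\<close> is of the order of \<open>ln d\<close>, the assumed growth of \<open>d\<close> is the condition on \<open>x\<close> for moderate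
deviations. In the Gaussian tail the term \<open>4 ln d\<close> cancels the factor \<open>d\<^sup>2\<close>, and \<open>- ln (ln d)\<close>
produces a factor \<open>sqrt (ln d)\<close> that compensates the denominator \<open>x\<close>.\<close>

lemma threshold_asymptotics:
  fixes d :: "nat \<Rightarrow> nat" and q :: real
  assumes d: "filterlim d at_top sequentially" and rate: "(\<lambda>n. ln (real (d n))) \<in> o(\<lambda>n. real n powr (1 / 3))"
  defines "x \<equiv> \<lambda>n. sqrt (4 * ln (real (d n)) - ln (ln (real (d n))) + q)"
  shows "filterlim x at_top sequentially" and "(\<lambda>n. x n ^ 3 / sqrt (real n)) \<longlonglongrightarrow> 0"
    and "(\<lambda>n. (real (d n))\<^sup>2 * (std_normal_density (x n) / x n)) \<longlonglongrightarrow> exp (- q / 2) / (2 * sqrt (2 * pi))"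
    and "\<forall>\<^sub>F n in sequentially. 0 < 4 * ln (real (d n)) - ln (ln (real (d n))) + q"
proof -
  define L where "L n = ln (real (d n))" for n
  have L: "filterlim L at_top sequentially"
    unfolding L_def by (intro filterlim_compose[OF ln_at_top] filterlim_compose[OF filterlim_real_sequentially] d)
  have Lpos: "\<forall>\<^sub>F n in sequentially. 0 < L n" using L by (simp add: filterlim_at_top_dense)
  have "filterlim (\<lambda>t::real. 4 * t - ln t + q) at_top at_top" by real_asymp
  from filterlim_compose[OF this L] have y: "filterlim (\<lambda>n. 4 * L n - ln (L n) + q) at_top sequentially" .
  then have ypos: "\<forall>\<^sub>F n in sequentially. 0 < 4 * L n - ln (L n) + q" by (simp add: filterlim_at_top_dense)
  then show "\<forall>\<^sub>F n in sequentially. 0 < 4 * ln (real (d n)) - ln (ln (real (d n))) + q" unfolding L_def .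
  show x_top: "filterlim x at_top sequentially"
    unfolding x_def L_def[symmetric] by (rule filterlim_compose[OF sqrt_at_top y])
  show "(\<lambda>n. x n ^ 3 / sqrt (real n)) \<longlonglongrightarrow> 0"
  proof -
    have "((\<lambda>t::real. (4 * t - ln t + q) / t) \<longlongrightarrow> 4) at_top" by real_asymp
    from filterlim_compose[OF this L] have a: "(\<lambda>n. (4 * L n - ln (L n) + q) / L n) \<longlonglongrightarrow> 4" .
    have b: "(\<lambda>n. L n / real n powr (1 / 3)) \<longlonglongrightarrow> 0"
      using smalloD_tendsto[OF rate] unfolding L_def .
    have "(\<lambda>n. ((4 * L n - ln (L n) + q) / L n * (L n / real n powr (1 / 3))) powr (3 / 2)) \<longlonglongrightarrow> 0 powr (3 / 2)"
    proof (rule tendsto_powr2)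
      show "(\<lambda>n. (4 * L n - ln (L n) + q) / L n * (L n / real n powr (1 / 3))) \<longlonglongrightarrow> 0" using tendsto_mult[OF a b] by simp
      show "\<forall>\<^sub>F n in sequentially. 0 \<le> (4 * L n - ln (L n) + q) / L n * (L n / real n powr (1 / 3))"
        using ypos Lpos by eventually_elim simp
    qed auto
    then have lim: "(\<lambda>n. ((4 * L n - ln (L n) + q) / L n * (L n / real n powr (1 / 3))) powr (3 / 2)) \<longlonglongrightarrow> 0" by simp
    have eq: "\<forall>\<^sub>F n in sequentially. ((4 * L n - ln (L n) + q) / L n * (L n / real n powr (1 / 3))) powr (3 / 2) = x n ^ 3 / sqrt (real n)"
      using ypos Lpos eventually_gt_at_top[of 0]
    proof eventually_elim
      case (elim n)
      define y where "y = 4 * L n - ln (L n) + q"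
      have y: "0 < y" using elim by (simp add: y_def)
      have "(y / L n * (L n / real n powr (1 / 3))) = y / real n powr (1 / 3)" using elim by simp
      then have "(y / L n * (L n / real n powr (1 / 3))) powr (3 / 2) = y powr (3 / 2) / (real n powr (1 / 3)) powr (3 / 2)"
        using y elim by (simp add: powr_divide)
      also have "(real n powr (1 / 3)) powr (3 / 2) = real n powr (1 / 2)" by (simp add: powr_powr)
      also have "real n powr (1 / 2) = sqrt (real n)" by (simp add: powr_half_sqrt)
      also have "y powr (3 / 2) = (y powr (1 / 2)) powr 3" by (simp add: powr_powr)
      also have "\<dots> = sqrt y ^ 3" using y powr_realpow[of "sqrt y" 3] by (simp add: powr_half_sqrt)
      finally show ?case unfolding y_def x_def L_def .
    qed
    show ?thesis by (rule Lim_transform_eventually[OF lim eq])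
  qed
  show "(\<lambda>n. (real (d n))\<^sup>2 * (std_normal_density (x n) / x n)) \<longlonglongrightarrow> exp (- q / 2) / (2 * sqrt (2 * pi))"
  proof -
    have "((\<lambda>t::real. t / (4 * t - ln t + q)) \<longlongrightarrow> 1 / 4) at_top" by real_asymp
    from tendsto_real_sqrt[OF this]
    have "((\<lambda>t::real. sqrt t / sqrt (4 * t - ln t + q)) \<longlongrightarrow> 1 / 2) at_top" by (simp add: real_sqrt_divide)
    from tendsto_mult[OF tendsto_const filterlim_compose[OF this L], of "exp (- q / 2) / sqrt (2 * pi)"]
    have lim: "(\<lambda>n. exp (- q / 2) / sqrt (2 * pi) * (sqrt (L n) / sqrt (4 * L n - ln (L n) + q))) \<longlonglongrightarrow> exp (- q / 2) / (2 * sqrt (2 * pi))"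
      by (simp add: mult.commute)
    have eq: "\<forall>\<^sub>F n in sequentially. exp (- q / 2) / sqrt (2 * pi) * (sqrt (L n) / sqrt (4 * L n - ln (L n) + q)) = (real (d n))\<^sup>2 * (std_normal_density (x n) / x n)"
      using ypos Lpos
    proof eventually_elim
      case (elim n)
      define y where "y = 4 * L n - ln (L n) + q"
      have y: "0 < y" using elim by (simp add: y_def)
      have "d n \<noteq> 0" by (rule notI) (use elim in \<open>simp add: L_def\<close>)
      then have "real (d n) = exp (L n)" by (simp add: L_def)
      then have d2: "(real (d n))\<^sup>2 = exp (2 * L n)" by (simp add: exp_double)
      have xy: "x n = sqrt y" by (simp add: x_def y_def L_def)
      have x2: "(x n)\<^sup>2 = y" using y by (simp add: xy)
      have sL: "exp (ln (L n) / 2) = sqrt (L n)" using elim ln_sqrt[of "L n", symmetric] by simp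
      have lin: "2 * l + - (4 * l - u + q) / 2 = u / 2 + - q / 2" for l u :: real by (simp add: field_simps)
      have "exp (2 * L n) * exp (- y / 2) = exp (ln (L n) / 2) * exp (- q / 2)"
        unfolding mult_exp_exp unfolding y_def by (rule arg_cong[where f = exp], rule lin)
      then have "exp (2 * L n) * exp (- y / 2) = sqrt (L n) * exp (- q / 2)" unfolding sL .
      then have "(real (d n))\<^sup>2 * (std_normal_density (x n) / x n) = 1 / sqrt (2 * pi) * (sqrt (L n) * exp (- q / 2)) / x n"
        unfolding std_normal_density_def x2 d2 by simp
      then show ?case unfolding xy y_def by simp
    qed
    show ?thesis by (rule Lim_transform_eventually[OF lim eq])
  qed
qed

lemma exp_q_level:
  assumes "0 < \<alpha>" "\<alpha> < 1"
  shows "exp (- q_level \<alpha> / 2) = sqrt (8 * pi) * ln (inverse (1 - \<alpha>))"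
proof -
  have "1 < inverse (1 - \<alpha>)" using assms by (simp add: one_less_inverse_iff)
  then have l: "0 < ln (inverse (1 - \<alpha>))" by (rule ln_gt_zero)
  have s: "ln (sqrt (8 * pi)) = ln (8 * pi) / 2" by (rule ln_sqrt) simp
  have h: "- (- a - 2 * b) / 2 = a / 2 + b" for a b :: real by simp
  have "- q_level \<alpha> / 2 = ln (sqrt (8 * pi)) + ln (ln (inverse (1 - \<alpha>)))"
    unfolding q_level_def s by (rule h)
  then have "exp (- q_level \<alpha> / 2) = exp (ln (sqrt (8 * pi))) * exp (ln (ln (inverse (1 - \<alpha>))))" by (simp add: exp_add)
  then show ?thesis using l by simp
qed

lemma max_sq_threshold:
  assumes A: "0 \<le> A" and d: "2 \<le> d"
  shows "y \<le> A * max_sq d r \<longleftrightarrow> (\<exists>j k. 1 \<le> j \<and> j < k \<and> k \<le> d \<and> y \<le> A * (r j k)\<^sup>2)"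
proof -
  let ?S = "{(r j k)\<^sup>2 | j k. 1 \<le> j \<and> j < k \<and> k \<le> d}"
  have "?S \<subseteq> (\<lambda>p. (r (fst p) (snd p))\<^sup>2) ` ({1..d} \<times> {1..d})" by force
  then have fin: "finite ?S" by (rule finite_subset) auto
  have "(r 1 2)\<^sup>2 \<in> ?S" using d by (intro CollectI exI[of _ "1::nat"] exI[of _ "2::nat"]) simp
  then have ne: "?S \<noteq> {}" by blast
  show ?thesis
  proof
    assume y: "y \<le> A * max_sq d r"
    have "max_sq d r \<in> ?S" unfolding max_sq_def using fin ne by (rule Max_in)
    then obtain j k where "max_sq d r = (r j k)\<^sup>2" "1 \<le> j" "j < k" "k \<le> d" by (elim CollectE exE conjE)
    then show "\<exists>j k. 1 \<le> j \<and> j < k \<and> k \<le> d \<and> y \<le> A * (r j k)\<^sup>2"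
      using y by metis
  next
    assume "\<exists>j k. 1 \<le> j \<and> j < k \<and> k \<le> d \<and> y \<le> A * (r j k)\<^sup>2"
    then obtain j k where jk: "1 \<le> j" "j < k" "k \<le> d" "y \<le> A * (r j k)\<^sup>2" by blast
    have "(r j k)\<^sup>2 \<le> max_sq d r" unfolding max_sq_def using jk fin by (intro Max_ge) auto
    then have "A * (r j k)\<^sup>2 \<le> A * max_sq d r" using A by (intro mult_left_mono)
    then show "y \<le> A * max_sq d r" using jk by linarith
  qed
qed

section \<open>Asymptotic level of a maximum test\<close>

text \<open>Up to a null event, the test accepts exactly when no pair of rank columns satisfies \<open>x \<le> \<bar>s\<bar>\<close>, so its level follows from
\<open>no_pair_probability\<close> and the limit of \<open>d\<^sup>2 p\<close>.\<close>

theorem max_test_level: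
  fixes \<alpha> :: real and d :: "nat \<Rightarrow> nat" and M :: "nat \<Rightarrow> 'a measure"
    and X :: "nat \<Rightarrow> 'a \<Rightarrow> nat \<Rightarrow> real" and Y :: "nat \<Rightarrow> nat \<Rightarrow> 'a \<Rightarrow> nat \<Rightarrow> real"
    and S :: "nat \<Rightarrow> (nat \<Rightarrow> nat \<Rightarrow> real) \<Rightarrow> nat \<Rightarrow> nat \<Rightarrow> real" and A :: "nat \<Rightarrow> real"
    and s :: "nat \<Rightarrow> nat list \<Rightarrow> nat list \<Rightarrow> real"
  assumes \<alpha>: "0 < \<alpha>" "\<alpha> < 1"
    and d: "filterlim d at_top sequentially" and rate: "(\<lambda>n. ln (real (d n))) \<in> o(\<lambda>n. real n powr (1 / 3))"
    and ps: "\<And>n. prob_space (M n)"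
    and cont: "\<And>n. continuous_random_vector (M n) (d n) (X n)"
    and copies: "\<And>n. independent_copies (M n) (d n) n (Y n) (X n)"
    and H0: "\<And>n. mutually_indep_components (M n) (d n) (X n)"
    and S: "\<And>n. rank_based n (S n)" and A: "\<forall>\<^sub>F n in sequentially. 0 \<le> A n"
    and link: "\<forall>\<^sub>F n in sequentially. \<forall>Q j k. Q j \<in> permutations_of_set {1..n} \<longrightarrow> Q k \<in> permutations_of_set {1..n} \<longrightarrow>
       A n * (S n (rank_matrix Q) j k)\<^sup>2 = (s n (Q j) (Q k))\<^sup>2"
    and sym: "\<And>n xs ys. s n xs ys = s n ys xs"
    and inv: "\<And>n \<sigma> xs ys. \<sigma> permutes {..<n} \<Longrightarrow> length xs = n \<Longrightarrow> length ys = n \<Longrightarrow>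
       s n (permute_list \<sigma> xs) (permute_list \<sigma> ys) = s n xs ys"
    and gauss: "moderately_gaussian (\<lambda>n ys. s n [1..<Suc n] ys)" "moderately_gaussian (\<lambda>n ys. - s n [1..<Suc n] ys)"
  shows "(\<lambda>n. measure (M n) {\<omega> \<in> space (M n).
     q_level \<alpha> \<le> A n * max_sq (d n) (S n (\<lambda>i. Y n i \<omega>)) - 4 * ln (real (d n)) + ln (ln (real (d n)))}) \<longlonglongrightarrow> \<alpha>"
proof -
  define x where "x n = sqrt (4 * ln (real (d n)) - ln (ln (real (d n))) + q_level \<alpha>)" for n
  note thr = threshold_asymptotics[OF d rate, of "q_level \<alpha>", folded x_def]
  have xpos: "\<forall>\<^sub>F n in sequentially. 0 < x n" using thr(1) by (simp add: filterlim_at_top_dense)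
  define p where "p n = measure_pmf.prob (uniform_perm {1..n}) {ys. x n \<le> \<bar>s n [1..<Suc n] ys\<bar>}" for n
  have ptail: "(\<lambda>n. x n / std_normal_density (x n) * p n) \<longlonglongrightarrow> 2"
  proof -
    let ?q = "\<lambda>n. x n / std_normal_density (x n)"
    have g: "(\<lambda>n. ?q n * measure_pmf.prob (uniform_perm {1..n}) {ys. x n \<le> s n [1..<Suc n] ys}) \<longlonglongrightarrow> 1"
      "(\<lambda>n. ?q n * measure_pmf.prob (uniform_perm {1..n}) {ys. x n \<le> - s n [1..<Suc n] ys}) \<longlonglongrightarrow> 1"
      using gauss[unfolded moderately_gaussian_def, rule_format, OF thr(1,2), of 0] by (simp_all del: upt_Suc)
    have "\<forall>\<^sub>F n in sequentially. ?q n * measure_pmf.prob (uniform_perm {1..n}) {ys. x n \<le> s n [1..<Suc n] ys}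
        + ?q n * measure_pmf.prob (uniform_perm {1..n}) {ys. x n \<le> - s n [1..<Suc n] ys} = ?q n * p n"
      using xpos
    proof eventually_elim
      case (elim n)
      have "{ys. x n \<le> \<bar>s n [1..<Suc n] ys\<bar>} = {ys. x n \<le> s n [1..<Suc n] ys} \<union> {ys. x n \<le> - s n [1..<Suc n] ys}" by auto
      moreover have "{ys. x n \<le> s n [1..<Suc n] ys} \<inter> {ys. x n \<le> - s n [1..<Suc n] ys} = {}" using elim by auto
      ultimately have "p n = measure_pmf.prob (uniform_perm {1..n}) {ys. x n \<le> s n [1..<Suc n] ys} + measure_pmf.prob (uniform_perm {1..n}) {ys. x n \<le> - s n [1..<Suc n] ys}"
        unfolding p_def by (simp add: measure_pmf.finite_measure_Union del: upt_Suc)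
      then show ?case by (simp only: distrib_left)
    qed
    from Lim_transform_eventually[OF tendsto_add[OF g] this] show ?thesis by simp
  qed
  define c where "c = ln (inverse (1 - \<alpha>))"
  have d2p: "(\<lambda>n. (real (d n))\<^sup>2 * p n) \<longlonglongrightarrow> 2 * c"
  proof -
    have l: "(\<lambda>n. ((real (d n))\<^sup>2 * (std_normal_density (x n) / x n)) * (x n / std_normal_density (x n) * p n)) \<longlonglongrightarrow> exp (- q_level \<alpha> / 2) / (2 * sqrt (2 * pi)) * 2"
      by (intro tendsto_mult thr(3) ptail)
    have c: "exp (- q_level \<alpha> / 2) / (2 * sqrt (2 * pi)) * 2 = 2 * c"
    proof -
      have "sqrt (8 * pi) = 2 * sqrt (2 * pi)" using real_sqrt_mult[of 4 "2 * pi"] by simp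
      then show ?thesis unfolding exp_q_level[OF \<alpha>] c_def by simp
    qed
    have ev: "\<forall>\<^sub>F n in sequentially. ((real (d n))\<^sup>2 * (std_normal_density (x n) / x n)) * (x n / std_normal_density (x n) * p n) = (real (d n))\<^sup>2 * p n"
      using xpos
    proof eventually_elim
      case (elim n)
      have "0 < std_normal_density (x n)" by (rule normal_density_pos) simp
      then show ?case using elim by simp
    qed
    show ?thesis using Lim_transform_eventually[OF l ev] unfolding c .
  qed
  have dinv: "(\<lambda>n. 1 / real (d n)) \<longlonglongrightarrow> 0"
    by (rule filterlim_compose[OF lim_1_over_n d])
  have d2: "\<forall>\<^sub>F n in sequentially. 2 \<le> d n" using d by (simp add: filterlim_at_top)
  have lam: "(\<lambda>n. real (d n) * (real (d n) - 1) / 2 * p n) \<longlonglongrightarrow> c"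
  proof -
    have l: "(\<lambda>n. (1 - 1 / real (d n)) / 2 * ((real (d n))\<^sup>2 * p n)) \<longlonglongrightarrow> (1 - 0) / 2 * (2 * c)"
      by (intro tendsto_intros dinv d2p) auto
    have ev: "\<forall>\<^sub>F n in sequentially. (1 - 1 / real (d n)) / 2 * ((real (d n))\<^sup>2 * p n) = real (d n) * (real (d n) - 1) / 2 * p n"
      using d2 by eventually_elim (simp add: field_simps power2_eq_square)
    show ?thesis using Lim_transform_eventually[OF l ev] by simp
  qed
  have err: "(\<lambda>n. 8 * real (d n) ^ 3 * (p n)\<^sup>2) \<longlonglongrightarrow> 0"
  proof -
    have l: "(\<lambda>n. 8 * ((real (d n))\<^sup>2 * p n)\<^sup>2 * (1 / real (d n))) \<longlonglongrightarrow> 8 * (2 * c)\<^sup>2 * 0"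
      by (intro tendsto_intros dinv d2p)
    have ev: "\<forall>\<^sub>F n in sequentially. 8 * ((real (d n))\<^sup>2 * p n)\<^sup>2 * (1 / real (d n)) = 8 * real (d n) ^ 3 * (p n)\<^sup>2"
      using d2 by eventually_elim (simp add: field_simps power2_eq_square power3_eq_cube)
    show ?thesis using Lim_transform_eventually[OF l ev] by simp
  qed
  define N where "N n = measure (M n) {\<omega>\<in>space (M n). \<forall>j k. 1 \<le> j \<longrightarrow> j < k \<longrightarrow> k \<le> d n \<longrightarrow>
     \<not> x n \<le> \<bar>s n (rank_list n (\<lambda>i. Y n i \<omega> j)) (rank_list n (\<lambda>i. Y n i \<omega> k))\<bar>}" for n
  have main: "\<forall>\<^sub>F n in sequentially. \<bar>N n - exp (- (real (d n) * (real (d n) - 1) / 2 * p n))\<bar> \<le> 8 * real (d n) ^ 3 * (p n)\<^sup>2 \<and>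
      measure (M n) {\<omega> \<in> space (M n). q_level \<alpha> \<le> A n * max_sq (d n) (S n (\<lambda>i. Y n i \<omega>)) - 4 * ln (real (d n)) + ln (ln (real (d n)))} = 1 - N n"
    using d2 A link thr(4) eventually_gt_at_top[of 0]
  proof eventually_elim
    case (elim n)
    interpret prob_space "M n" by (rule ps)
    have dn: "0 < d n" using elim(1) by simp
    define Q where "Q j \<omega> = rank_list n (\<lambda>i. Y n i \<omega> j)" for j \<omega>
    interpret iid_objects "M n" Q "uniform_perm {1..n}" "d n"
      unfolding Q_def[abs_def] by (rule rank_lists_iid(1)[OF cont copies H0 elim(5) dn])
    have AEinj: "AE \<omega> in M n. \<forall>j\<in>{1..d n}. inj_on (\<lambda>i. Y n i \<omega> j) {1..n}"
      by (rule rank_lists_iid(2)[OF cont copies H0 elim(5) dn])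
    define R where "R a b \<longleftrightarrow> x n \<le> \<bar>s n a b\<bar>" for a b
    have Rsym: "R a b = R b a" for a b unfolding R_def by (simp add: sym)
    have Rsec: "measure_pmf.prob (uniform_perm {1..n}) {ys. R xs ys} = p n" if "xs \<in> set_pmf (uniform_perm {1..n})" for xs
      unfolding p_def R_def
      by (rule uniform_perm_section_invariant) (use that inv in auto)
    let ?N = "{\<omega>\<in>space (M n). \<forall>j k. 1 \<le> j \<longrightarrow> j < k \<longrightarrow> k \<le> d n \<longrightarrow> \<not> R (Q j \<omega>) (Q k \<omega>)}"
    have bound: "\<bar>prob ?N - exp (- (real (d n) * (real (d n) - 1) / 2 * p n))\<bar> \<le> 8 * real (d n) ^ 3 * (p n)\<^sup>2"
      by (rule no_pair_probability) (use Rsym Rsec in auto)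
    have NN: "N n = prob ?N" unfolding N_def Q_def R_def ..
    \<comment> \<open>The test statistic as a function of the list of rank columns, a countable type, which settles
       measurability.\<close>
    define F where "F L = A n * max_sq (d n) (S n (rank_matrix (\<lambda>j. L ! (j - 1)))) - 4 * ln (real (d n)) + ln (ln (real (d n)))" for L :: "nat list list"
    define QL where "QL \<omega> = map (\<lambda>j. Q j \<omega>) [1..<Suc (d n)]" for \<omega>
    have QLnth: "QL \<omega> ! (j - 1) = Q j \<omega>" if "j \<in> {1..d n}" for j \<omega>
    proof -
      have "[1..<Suc (d n)] ! (j - 1) = j" using that by (subst nth_upt) auto
      moreover have "j - 1 < length [1..<Suc (d n)]" using that by auto
      ultimately show ?thesis unfolding QL_def by (simp only: nth_map)
    qed
    have Seq: "S n (\<lambda>i. Y n i \<omega>) j k = S n (rank_matrix (\<lambda>j. QL \<omega> ! (j - 1))) j k" if "j \<in> {1..d n}" "k \<in> {1..d n}" for j k \<omega>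
      by (rule rank_based_rank_list[OF S]) (use that QLnth in \<open>auto simp: Q_def\<close>)
    have Teq: "A n * max_sq (d n) (S n (\<lambda>i. Y n i \<omega>)) - 4 * ln (real (d n)) + ln (ln (real (d n))) = F (QL \<omega>)" for \<omega>
    proof -
      have h: "(v = (S n (\<lambda>i. Y n i \<omega>) j k)\<^sup>2 \<and> 1 \<le> j \<and> j < k \<and> k \<le> d n)
          = (v = (S n (rank_matrix (\<lambda>j. QL \<omega> ! (j - 1))) j k)\<^sup>2 \<and> 1 \<le> j \<and> j < k \<and> k \<le> d n)" for v j k
      proof (cases "1 \<le> j \<and> j < k \<and> k \<le> d n")
        case True
        then have "j \<in> {1..d n}" "k \<in> {1..d n}" by auto
        from Seq[OF this] show ?thesis by (simp only:)
      qed blast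
      have "{(S n (\<lambda>i. Y n i \<omega>) j k)\<^sup>2 | j k. 1 \<le> j \<and> j < k \<and> k \<le> d n} = {(S n (rank_matrix (\<lambda>j. QL \<omega> ! (j - 1))) j k)\<^sup>2 | j k. 1 \<le> j \<and> j < k \<and> k \<le> d n}"
        by (rule Collect_cong, rule ex_cong1, rule ex_cong1, rule h)
      then show ?thesis unfolding F_def max_sq_def by simp
    qed
    have QLm: "QL \<in> measurable (M n) (count_space UNIV)"
    proof -
      have "(\<lambda>\<omega>. map (\<lambda>j. Q j \<omega>) js) \<in> measurable (M n) (count_space UNIV)" if "set js \<subseteq> {1..d n}" for js
        using that
      proof (induction js)
        case (Cons j js)
        have "(\<lambda>\<omega>. Q j \<omega> # map (\<lambda>j. Q j \<omega>) js) \<in> measurable (M n) (count_space UNIV)"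
          by (rule measurable_count_space_binary[where h = "(#)", OF Q_measurable Cons.IH]) (use Cons.prems in auto)
        then show ?case by (simp only: list.map)
      qed simp
      note L = this
      have "set [1..<Suc (d n)] \<subseteq> {1..d n}" by auto
      from L[OF this] show ?thesis unfolding QL_def[abs_def] .
    qed
    have Lev: "{\<omega>\<in>space (M n). P (QL \<omega>)} \<in> events" for P
    proof -
      have "QL -` {L. P L} \<inter> space (M n) \<in> events" by (rule measurable_sets[OF QLm]) simp
      moreover have "QL -` {L. P L} \<inter> space (M n) = {\<omega>\<in>space (M n). P (QL \<omega>)}" by blast
      ultimately show ?thesis by (simp only:)
    qed
    note Tev = Lev[of "\<lambda>L. q_level \<alpha> \<le> F L"]
    have Nev: "?N \<in> events"
    proof -
      define G where "G L \<longleftrightarrow> (\<forall>j k. 1 \<le> j \<longrightarrow> j < k \<longrightarrow> k \<le> d n \<longrightarrow> \<not> R (L ! (j - 1)) (L ! (k - 1)))" for L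
      have "R (QL \<omega> ! (j - 1)) (QL \<omega> ! (k - 1)) = R (Q j \<omega>) (Q k \<omega>)" if "1 \<le> j" "j < k" "k \<le> d n" for j k \<omega>
      proof -
        have "j \<in> {1..d n}" "k \<in> {1..d n}" using that by auto
        then show ?thesis by (simp only: QLnth)
      qed
      then have "G (QL \<omega>) \<longleftrightarrow> (\<forall>j k. 1 \<le> j \<longrightarrow> j < k \<longrightarrow> k \<le> d n \<longrightarrow> \<not> R (Q j \<omega>) (Q k \<omega>))" for \<omega>
        unfolding G_def by blast
      then have "?N = {\<omega>\<in>space (M n). G (QL \<omega>)}" by (simp only:)
      then show ?thesis using Lev[of G] by (simp only:)
    qed
    have "prob {\<omega>\<in>space (M n). q_level \<alpha> \<le> F (QL \<omega>)} = prob (space (M n) - ?N)"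
    proof (rule finite_measure_eq_AE)
      show "AE \<omega> in M n. (\<omega> \<in> {\<omega>\<in>space (M n). q_level \<alpha> \<le> F (QL \<omega>)}) = (\<omega> \<in> space (M n) - ?N)"
        using AEinj AE_space
      proof eventually_elim
        case inj: (elim \<omega>)
        define y where "y = 4 * ln (real (d n)) - ln (ln (real (d n))) + q_level \<alpha>"
        have y: "0 < y" using elim(4) by (simp add: y_def)
        have xy: "x n = sqrt y" by (simp add: x_def y_def)
        have pair: "y \<le> A n * (S n (rank_matrix (\<lambda>j. QL \<omega> ! (j - 1))) j k)\<^sup>2 \<longleftrightarrow> R (Q j \<omega>) (Q k \<omega>)" if jk: "1 \<le> j" "j < k" "k \<le> d n" for j k
        proof -
          have jk': "j \<in> {1..d n}" "k \<in> {1..d n}" using jk by auto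
          have "Q j \<omega> \<in> permutations_of_set {1..n}" "Q k \<omega> \<in> permutations_of_set {1..n}"
            unfolding Q_def using inj jk' by (auto intro!: rank_list_permutation simp del: One_nat_def)
          then have "A n * (S n (rank_matrix (\<lambda>j. QL \<omega> ! (j - 1))) j k)\<^sup>2 = (s n (Q j \<omega>) (Q k \<omega>))\<^sup>2"
            using elim(3)[rule_format, of "\<lambda>j. QL \<omega> ! (j - 1)" j k] QLnth[OF jk'(1)] QLnth[OF jk'(2)] by simp
          moreover have "y \<le> t\<^sup>2 \<longleftrightarrow> x n \<le> \<bar>t\<bar>" for t
          proof -
            have "y \<le> t\<^sup>2 \<longleftrightarrow> sqrt y \<le> sqrt (t\<^sup>2)" by (simp only: real_sqrt_le_iff)
            then show ?thesis by (simp only: xy real_sqrt_abs)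
          qed
          ultimately show ?thesis unfolding R_def by simp
        qed
        have "q_level \<alpha> \<le> F (QL \<omega>) \<longleftrightarrow> y \<le> A n * max_sq (d n) (S n (rank_matrix (\<lambda>j. QL \<omega> ! (j - 1))))"
          unfolding F_def y_def by linarith
        also have "\<dots> \<longleftrightarrow> (\<exists>j k. 1 \<le> j \<and> j < k \<and> k \<le> d n \<and> y \<le> A n * (S n (rank_matrix (\<lambda>j. QL \<omega> ! (j - 1))) j k)\<^sup>2)"
          by (rule max_sq_threshold[OF elim(2,1)])
        also have "\<dots> \<longleftrightarrow> (\<exists>j k. 1 \<le> j \<and> j < k \<and> k \<le> d n \<and> R (Q j \<omega>) (Q k \<omega>))" using pair by blast
        finally show ?case using inj(2) by blast
      qed
    qed (rule Tev, rule sets.compl_sets[OF Nev])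
    also have "\<dots> = 1 - N n" unfolding NN by (rule prob_compl[OF Nev])
    finally show ?case using bound unfolding Teq NN by simp
  qed
  have N1: "N \<longlonglongrightarrow> exp (- c)"
  proof -
    have e: "(\<lambda>n. exp (- (real (d n) * (real (d n) - 1) / 2 * p n))) \<longlonglongrightarrow> exp (- c)"
      by (intro tendsto_exp tendsto_minus lam)
    have "(\<lambda>n. N n - exp (- (real (d n) * (real (d n) - 1) / 2 * p n))) \<longlonglongrightarrow> 0"
      by (rule Lim_null_comparison[OF _ err]) (use main in \<open>auto elim: eventually_mono\<close>)
    from tendsto_add[OF this e] show ?thesis by simp
  qed
  have "exp (- c) = 1 - \<alpha>"
    using \<alpha> by (simp add: c_def ln_inverse)
  then have "(\<lambda>n. 1 - N n) \<longlonglongrightarrow> 1 - (1 - \<alpha>)" using tendsto_diff[OF tendsto_const[of 1] N1] by simp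
  then have lim: "(\<lambda>n. 1 - N n) \<longlonglongrightarrow> \<alpha>" by simp
  have "\<forall>\<^sub>F n in sequentially. 1 - N n = measure (M n) {\<omega> \<in> space (M n). q_level \<alpha> \<le> A n * max_sq (d n) (S n (\<lambda>i. Y n i \<omega>)) - 4 * ln (real (d n)) + ln (ln (real (d n)))}"
    using main by eventually_elim simp
  from Lim_transform_eventually[OF lim this] show ?thesis .
qed

section \<open>The four statistics\<close>

lemma prob_uniform_perm_mono:
  fixes n :: nat
  assumes "\<And>ys. ys \<in> permutations_of_set {1..n} \<Longrightarrow> P ys \<Longrightarrow> P' ys"
  shows "measure_pmf.prob (uniform_perm {1..n}) {ys. P ys} \<le> measure_pmf.prob (uniform_perm {1..n}) {ys. P' ys}"
proof (rule measure_pmf.finite_measure_mono_AE)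
  have set: "set_pmf (uniform_perm {1..n}) = permutations_of_set {1..n}" by simp
  show "AE ys in measure_pmf (uniform_perm {1..n}). ys \<in> {ys. P ys} \<longrightarrow> ys \<in> {ys. P' ys}"
    unfolding AE_measure_pmf_iff using assms set by blast
qed simp

text \<open>A deterministic perturbation of order \<open>1 / sqrt n\<close> is small compared with \<open>1/x\<close>, because \<open>x\<close> is of
smaller order than \<open>sqrt n\<close>.\<close>

lemma moderately_gaussian_perturb:
  assumes s: "moderately_gaussian s"
    and close: "\<And>n ys. ys \<in> permutations_of_set {1..n} \<Longrightarrow> \<bar>s' n ys - s n ys\<bar> \<le> D n"
    and D: "\<forall>\<^sub>F n in sequentially. sqrt (real n) * D n \<le> C"
  shows "moderately_gaussian s'"
  unfolding moderately_gaussian_def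
proof (intro allI impI)
  fix x :: "nat \<Rightarrow> real" and \<eta> :: real
  assume x: "filterlim x at_top sequentially" and rate: "(\<lambda>n. x n ^ 3 / sqrt (real n)) \<longlonglongrightarrow> 0"
  have small: "\<forall>\<^sub>F n in sequentially. 0 < x n \<and> D n \<le> \<epsilon> / x n" if "0 < \<epsilon>" for \<epsilon>
  proof -
    have "(\<lambda>n. x n ^ 3 / sqrt (real n) * \<bar>C\<bar>) \<longlonglongrightarrow> 0" using tendsto_mult_right[OF rate, of "\<bar>C\<bar>"] by simp
    then have "\<forall>\<^sub>F n in sequentially. x n ^ 3 / sqrt (real n) * \<bar>C\<bar> < \<epsilon>" using that by (rule order_tendstoD(2))
    moreover have "\<forall>\<^sub>F n in sequentially. 1 \<le> x n" using x by (simp add: filterlim_at_top)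
    ultimately show ?thesis using D eventually_gt_at_top[of 0]
    proof eventually_elim
      case (elim n)
      have r: "0 < sqrt (real n)" using elim by simp
      have "sqrt (real n) * D n \<le> \<bar>C\<bar>" using elim by linarith
      then have "D n \<le> \<bar>C\<bar> / sqrt (real n)" using r by (simp add: pos_le_divide_eq mult.commute)
      moreover have "\<bar>C\<bar> / sqrt (real n) * x n \<le> \<bar>C\<bar> / sqrt (real n) * x n ^ 3"
        using elim r self_le_power[of "x n" 3] by (intro mult_left_mono) auto
      moreover have "D n * x n \<le> \<bar>C\<bar> / sqrt (real n) * x n" if "D n \<le> \<bar>C\<bar> / sqrt (real n)"
        using that elim by (intro mult_right_mono) auto
      moreover have "\<bar>C\<bar> / sqrt (real n) * x n ^ 3 = x n ^ 3 / sqrt (real n) * \<bar>C\<bar>" by simp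
      ultimately have "D n * x n \<le> x n ^ 3 / sqrt (real n) * \<bar>C\<bar>" by linarith
      then have "D n * x n \<le> \<epsilon>" using elim by linarith
      then show ?case using elim by (simp add: pos_le_divide_eq)
    qed
  qed
  let ?p = "\<lambda>s n t. measure_pmf.prob (uniform_perm {1..n}) {ys. t \<le> s n ys}"
  let ?q = "\<lambda>n. x n / std_normal_density (x n)"
  show "(\<lambda>n. ?q n * ?p s' n (x n + \<eta> / x n)) \<longlonglongrightarrow> exp (- \<eta>)"
  proof (rule tail_limit_perturb[where pW = "?p s" and pS = "?p s'" and r = "\<lambda>_ _. 0"])
    show "(\<lambda>n. ?q n * ?p s n (x n + \<eta> / x n)) \<longlonglongrightarrow> exp (- \<eta>)" for \<eta>
      using s x rate unfolding moderately_gaussian_def by blast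
    show "\<forall>\<^sub>F n in sequentially. 0 \<le> ?q n"
      using small[OF zero_less_one]
    proof eventually_elim
      case (elim n)
      have "0 < std_normal_density (x n)" by (rule normal_density_pos) simp
      then show ?case using elim by (intro divide_nonneg_pos) auto
    qed
    fix \<epsilon> :: real assume \<epsilon>: "0 < \<epsilon>"
    show "\<forall>\<^sub>F n in sequentially. ?p s' n (x n + \<eta> / x n) \<le> ?p s n (x n + (\<eta> - \<epsilon>) / x n) + 0"
      using small[OF \<epsilon>]
    proof eventually_elim
      case (elim n)
      show ?case unfolding add_0_right
      proof (rule prob_uniform_perm_mono)
        fix ys assume "ys \<in> permutations_of_set {1..n}" "x n + \<eta> / x n \<le> s' n ys"
        with close[of ys n] elim show "x n + (\<eta> - \<epsilon>) / x n \<le> s n ys" unfolding diff_divide_distrib by linarith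
      qed
    qed
    show "\<forall>\<^sub>F n in sequentially. ?p s n (x n + (\<eta> + \<epsilon>) / x n) \<le> ?p s' n (x n + \<eta> / x n) + 0"
      using small[OF \<epsilon>]
    proof eventually_elim
      case (elim n)
      show ?case unfolding add_0_right
      proof (rule prob_uniform_perm_mono)
        fix ys assume "ys \<in> permutations_of_set {1..n}" "x n + (\<eta> + \<epsilon>) / x n \<le> s n ys"
        with close[of ys n] elim show "x n + \<eta> / x n \<le> s' n ys" unfolding add_divide_distrib by linarith
      qed
    qed
  qed simp
qed

lemma moderately_gaussian_rank_covariance:
  assumes "e = 1 \<or> e = - 1"
  shows "moderately_gaussian (\<lambda>n ys. e * (rank_covariance n [1..<Suc n] ys / spearman_sd n))"
proof (rule moderately_gaussian_perturb[OF moderately_gaussian_spearman[OF assms], where D = "\<lambda>_. 0" and C = 0])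
  fix n :: nat and ys assume "ys \<in> permutations_of_set {1..n}"
  then have "length ys = n" using length_finite_permutations_of_set[of ys "{1..n}"] by simp
  then show "\<bar>e * (rank_covariance n [1..<Suc n] ys / spearman_sd n) - e * (spearman_sum n ys / spearman_sd n)\<bar> \<le> 0"
    by (simp only: rank_covariance_id)
qed simp

lemma moderately_gaussian_concordance:
  assumes "e = 1 \<or> e = - 1"
  shows "moderately_gaussian (\<lambda>n ys. e * (concordance n [1..<Suc n] ys / 2 / kendall_sd n))"
proof (rule moderately_gaussian_perturb[OF moderately_gaussian_kendall[OF assms], where D = "\<lambda>_. 0" and C = 0])
  fix n :: nat and ys assume "ys \<in> permutations_of_set {1..n}"
  then have "length ys = n" using length_finite_permutations_of_set[of ys "{1..n}"] by simp
  then show "\<bar>e * (concordance n [1..<Suc n] ys / 2 / kendall_sd n) - e * (sgn_sum ys / kendall_sd n)\<bar> \<le> 0"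
    by (simp only: concordance_id)
qed simp

lemma rank_covariance_bound:
  assumes xs: "xs \<in> permutations_of_set {1..n}" and ys: "ys \<in> permutations_of_set {1..n}"
  shows "\<bar>rank_covariance n xs ys\<bar> \<le> real n ^ 3 / 4"
proof -
  have c: "\<bar>real (zs ! i) - (real n + 1) / 2\<bar> \<le> real n / 2" if "zs \<in> permutations_of_set {1..n}" "i < n" for zs i
  proof -
    have "set zs = {1..n}" "length zs = n"
      using that length_finite_permutations_of_set[OF that(1)] by (auto dest: permutations_of_setD)
    then have "zs ! i \<in> {1..n}" using that(2) nth_mem by metis
    then have "1 \<le> real (zs ! i)" "real (zs ! i) \<le> real n" by auto
    then show ?thesis by (simp add: abs_le_iff field_simps)
  qed
  have "\<bar>rank_covariance n xs ys\<bar> \<le> (\<Sum>i<n. \<bar>(real (xs ! i) - (real n + 1) / 2) * (real (ys ! i) - (real n + 1) / 2)\<bar>)"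
    unfolding rank_covariance_def by (rule sum_abs)
  also have "\<dots> \<le> (\<Sum>i<n. real n / 2 * (real n / 2))"
    unfolding abs_mult using c[OF xs] c[OF ys] by (intro sum_mono mult_mono) auto
  also have "\<dots> = real n ^ 3 / 4" by (simp add: power3_eq_cube)
  finally show ?thesis .
qed

lemma concordance_bound: "\<bar>concordance n xs ys\<bar> \<le> (real n)\<^sup>2"
proof -
  have "\<bar>concordance n xs ys\<bar> \<le> (\<Sum>i<n. \<bar>\<Sum>i'<n. sgn (real (xs ! i') - real (xs ! i)) * sgn (real (ys ! i') - real (ys ! i))\<bar>)"
    unfolding concordance_def by (rule sum_abs)
  also have "\<dots> \<le> (\<Sum>i<n. \<Sum>i'<n. \<bar>sgn (real (xs ! i') - real (xs ! i)) * sgn (real (ys ! i') - real (ys ! i))\<bar>)"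
    by (intro sum_mono sum_abs)
  also have "\<dots> \<le> (\<Sum>i<n. \<Sum>i'<n. 1)"
    by (intro sum_mono) (auto simp: abs_mult abs_sgn_eq)
  also have "\<dots> = (real n)\<^sup>2" by (simp add: power2_eq_square)
  finally show ?thesis .
qed

text \<open>The factor that standardizes \<open>4 * rank_covariance - concordance\<close>.\<close>

definition major_weight :: "nat \<Rightarrow> real" where
  "major_weight n = 3 / sqrt (real n * (real n - 1) * (real n - 2) * ((real n)\<^sup>2 - 3))"

text \<open>Standardized, the leading part \<open>4 major_weight\<close> times the covariance differs from Spearman's rho by a relative
error of order \<open>1/n\<close>, while the covariance is at most of order \<open>sqrt n\<close> standard deviations; the
concordance is at most \<open>n\<^sup>2\<close>, against a standardization of order \<open>n\<close> to the power \<open>5/2\<close>. Both corrections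
are of order \<open>1 / sqrt n\<close>.\<close>

lemma moderately_gaussian_rho_major:
  assumes e: "e = 1 \<or> e = - 1"
  shows "moderately_gaussian (\<lambda>n ys. e * (major_weight n * (4 * rank_covariance n [1..<Suc n] ys - concordance n [1..<Suc n] ys)))"
proof (rule moderately_gaussian_perturb[OF moderately_gaussian_rank_covariance[OF e]])
  define D where "D n = \<bar>4 * major_weight n - 1 / spearman_sd n\<bar> * (real n ^ 3 / 4) + \<bar>major_weight n\<bar> * (real n)\<^sup>2" for n
  fix n :: nat and ys assume ys: "ys \<in> permutations_of_set {1..n}"
  have id: "[1..<Suc n] \<in> permutations_of_set {1..n}" by (rule permutations_of_setI) auto
  have e1: "\<bar>e\<bar> = 1" using e by auto
  define cv where "cv = rank_covariance n [1..<Suc n] ys"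
  define cc where "cc = concordance n [1..<Suc n] ys"
  have "\<bar>e * (major_weight n * (4 * cv - cc)) - e * (cv / spearman_sd n)\<bar> = \<bar>(4 * major_weight n - 1 / spearman_sd n) * cv - major_weight n * cc\<bar>"
    unfolding right_diff_distrib[symmetric] abs_mult e1 by (simp add: algebra_simps)
  also have "\<dots> \<le> \<bar>4 * major_weight n - 1 / spearman_sd n\<bar> * \<bar>cv\<bar> + \<bar>major_weight n\<bar> * \<bar>cc\<bar>"
    unfolding abs_mult[symmetric] by (rule abs_triangle_ineq4)
  also have "\<dots> \<le> D n"
    unfolding D_def cv_def cc_def
    by (intro add_mono mult_left_mono rank_covariance_bound[OF id ys] concordance_bound) auto
  finally show "\<bar>e * (major_weight n * (4 * rank_covariance n [1..<Suc n] ys - concordance n [1..<Suc n] ys)) - e * (rank_covariance n [1..<Suc n] ys / spearman_sd n)\<bar>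
     \<le> \<bar>4 * major_weight n - 1 / spearman_sd n\<bar> * (real n ^ 3 / 4) + \<bar>major_weight n\<bar> * (real n)\<^sup>2"
    unfolding cv_def cc_def D_def .
next
  \<comment> \<open>The covariance contributes \<open>24 / 4 = 6\<close> to this limit, the concordance 3.\<close>
  have "((\<lambda>t::real. sqrt t * (\<bar>4 * (3 / sqrt (t * (t - 1) * (t - 2) * (t\<^sup>2 - 3))) - 1 / (t * (t + 1) * sqrt (t - 1) / 12)\<bar> * (t ^ 3 / 4)
      + \<bar>3 / sqrt (t * (t - 1) * (t - 2) * (t\<^sup>2 - 3))\<bar> * t\<^sup>2)) \<longlongrightarrow> 9) at_top"
    by real_asymp
  from filterlim_compose[OF this filterlim_real_sequentially]
  have "(\<lambda>n. sqrt (real n) * (\<bar>4 * major_weight n - 1 / spearman_sd n\<bar> * (real n ^ 3 / 4) + \<bar>major_weight n\<bar> * (real n)\<^sup>2)) \<longlonglongrightarrow> 9"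
    unfolding major_weight_def spearman_sd_def .
  from order_tendstoD(2)[OF this, of 10]
  show "\<forall>\<^sub>F n in sequentially. sqrt (real n) * (\<bar>4 * major_weight n - 1 / spearman_sd n\<bar> * (real n ^ 3 / 4) + \<bar>major_weight n\<bar> * (real n)\<^sup>2) \<le> 10"
    by (auto elim: eventually_mono)
qed

lemma standardize_square:
  fixes A \<kappa> \<sigma> t :: real
  assumes "A * \<kappa>\<^sup>2 = 1 / \<sigma>\<^sup>2"
  shows "A * (\<kappa> * t)\<^sup>2 = (t / \<sigma>)\<^sup>2"
  unfolding power_mult_distrib power_divide mult.assoc[symmetric] assms by simp

text \<open>The normalizing factors of the four tests turn the squared statistics into squares of standardized sums.\<close>

lemma normalizations:
  fixes m :: real
  assumes m: "3 \<le> m"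
  shows "(m - 1) * (12 / (m * (m\<^sup>2 - 1)))\<^sup>2 = 1 / (m * (m + 1) * sqrt (m - 1) / 12)\<^sup>2"
    and "9 * m * (m - 1) / (2 * (2 * m + 5)) * (1 / (m * (m - 1)))\<^sup>2 = 1 / (2 * sqrt (m * (m - 1) * (2 * m + 5) / 18))\<^sup>2"
    and "m * (m - 1) * (m - 2) / (m\<^sup>2 - 3) * (3 / (m * (m - 1) * (m - 2)))\<^sup>2 = (3 / sqrt (m * (m - 1) * (m - 2) * (m\<^sup>2 - 3)))\<^sup>2"
    and "9 * m\<^sup>2 * (m - 1) / (4 * (m + 1)\<^sup>2) * (8 / (m\<^sup>2 * (m - 1)))\<^sup>2 = 1 / (m * (m + 1) * sqrt (m - 1) / 12)\<^sup>2"
proof -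
  have pos: "m \<noteq> 0" "m - 1 \<noteq> 0" "m + 1 \<noteq> 0" "m - 2 \<noteq> 0" "2 * m + 5 \<noteq> 0" using m by auto
  have "3\<^sup>2 \<le> m\<^sup>2" using m by (intro power_mono) auto
  then have q: "0 < m\<^sup>2 - 3" by simp
  have f: "m\<^sup>2 - 1 = (m - 1) * (m + 1)" by (simp add: power2_eq_square algebra_simps)
  have r1: "(sqrt (m - 1))\<^sup>2 = m - 1" and r2: "(sqrt (m * (m - 1) * (2 * m + 5) / 18))\<^sup>2 = m * (m - 1) * (2 * m + 5) / 18"
    and r3: "(sqrt (m * (m - 1) * (m - 2) * (m\<^sup>2 - 3)))\<^sup>2 = m * (m - 1) * (m - 2) * (m\<^sup>2 - 3)"
    using m q by simp_all
  have a1: "u * (12 / (m * (u * v)))\<^sup>2 = 1 / (m\<^sup>2 * v\<^sup>2 * u / 12\<^sup>2)" if "u \<noteq> 0" "v \<noteq> 0" for u v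
    using that pos(1) by (simp add: field_simps power2_eq_square)
  show "(m - 1) * (12 / (m * (m\<^sup>2 - 1)))\<^sup>2 = 1 / (m * (m + 1) * sqrt (m - 1) / 12)\<^sup>2"
    unfolding power_divide[of _ 12] power_mult_distrib r1 f by (rule a1) (use pos in auto)
  have a2: "9 * m * u / (2 * v) * (1 / (m * u))\<^sup>2 = 1 / (2\<^sup>2 * (m * u * v / 18))" if "u \<noteq> 0" "v \<noteq> 0" for u v
    using that pos(1) by (simp add: field_simps power2_eq_square)
  show "9 * m * (m - 1) / (2 * (2 * m + 5)) * (1 / (m * (m - 1)))\<^sup>2 = 1 / (2 * sqrt (m * (m - 1) * (2 * m + 5) / 18))\<^sup>2"
    unfolding power_mult_distrib[of 2] r2 by (rule a2) (use pos in auto)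
  have a3: "w / v * (3 / w)\<^sup>2 = 3\<^sup>2 / (w * v)" if "w \<noteq> 0" "v \<noteq> 0" for w v :: real
    using that by (simp add: field_simps power2_eq_square)
  show "m * (m - 1) * (m - 2) / (m\<^sup>2 - 3) * (3 / (m * (m - 1) * (m - 2)))\<^sup>2 = (3 / sqrt (m * (m - 1) * (m - 2) * (m\<^sup>2 - 3)))\<^sup>2"
    unfolding power_divide[of 3 "sqrt _"] r3 by (rule a3) (use pos q in auto)
  have a4: "9 * m\<^sup>2 * u / (4 * v\<^sup>2) * (8 / (m\<^sup>2 * u))\<^sup>2 = 1 / (m\<^sup>2 * v\<^sup>2 * u / 12\<^sup>2)" if "u \<noteq> 0" "v \<noteq> 0" for u v
    using that pos(1) by (simp add: field_simps power2_eq_square)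
  show "9 * m\<^sup>2 * (m - 1) / (4 * (m + 1)\<^sup>2) * (8 / (m\<^sup>2 * (m - 1)))\<^sup>2 = 1 / (m * (m + 1) * sqrt (m - 1) / 12)\<^sup>2"
    unfolding power_divide[of _ 12] power_mult_distrib[of _ "sqrt _"] power_mult_distrib[of m "m + 1"] r1 by (rule a4) (use pos in auto)
qed

theorem corollary2:
  fixes \<alpha> :: real
    and d :: "nat \<Rightarrow> nat"
    and M :: "nat \<Rightarrow> 'a measure"
    and X :: "nat \<Rightarrow> 'a \<Rightarrow> nat \<Rightarrow> real"
    and Y :: "nat \<Rightarrow> nat \<Rightarrow> 'a \<Rightarrow> nat \<Rightarrow> real"
  assumes "0 < \<alpha>" and "\<alpha> < 1"
    and "filterlim d at_top sequentially"
    and "(\<lambda>n. ln (real (d n))) \<in> o(\<lambda>n. real n powr (1 / 3))"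
    and "\<And>n. prob_space (M n)"
    and "\<And>n. continuous_random_vector (M n) (d n) (X n)"
    and "\<And>n. independent_copies (M n) (d n) n (Y n) (X n)"
    and H0: "\<And>n. mutually_indep_components (M n) (d n) (X n)"
  shows "((\<lambda>n. measure (M n) {\<omega> \<in> space (M n). T_rho \<alpha> n (d n) (\<lambda>i. Y n i \<omega>) = 1}) \<longlonglongrightarrow> \<alpha>) \<and>
         ((\<lambda>n. measure (M n) {\<omega> \<in> space (M n). T_tau \<alpha> n (d n) (\<lambda>i. Y n i \<omega>) = 1}) \<longlonglongrightarrow> \<alpha>) \<and>
         ((\<lambda>n. measure (M n) {\<omega> \<in> space (M n). T_rho_major \<alpha> n (d n) (\<lambda>i. Y n i \<omega>) = 1}) \<longlonglongrightarrow> \<alpha>) \<and>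
         ((\<lambda>n. measure (M n) {\<omega> \<in> space (M n). T_tau_proj \<alpha> n (d n) (\<lambda>i. Y n i \<omega>) = 1}) \<longlonglongrightarrow> \<alpha>)"
proof (intro conjI)
  note level = max_test_level[OF assms(1-7) H0]
  have n3: "\<forall>\<^sub>F n in sequentially. 3 \<le> real n"
    using filterlim_real_sequentially by (simp add: filterlim_at_top)
  have nsq: "3 \<le> (real n)\<^sup>2" if "3 \<le> real n" for n
    using power_mono[of 3 "real n" 2] that by simp
  have one: "of_bool P = (1::real) \<longleftrightarrow> P" for P by simp
  show "(\<lambda>n. measure (M n) {\<omega> \<in> space (M n). T_rho \<alpha> n (d n) (\<lambda>i. Y n i \<omega>) = 1}) \<longlonglongrightarrow> \<alpha>"
    unfolding T_rho_def one
  proof (rule level[where s = "\<lambda>n xs ys. rank_covariance n xs ys / spearman_sd n", OF rank_based_spearman_rho])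
    show "\<forall>\<^sub>F n in sequentially. 0 \<le> real n - 1" using n3 by eventually_elim simp
    show "\<forall>\<^sub>F n in sequentially. \<forall>Q j k. Q j \<in> permutations_of_set {1..n} \<longrightarrow> Q k \<in> permutations_of_set {1..n} \<longrightarrow>
       (real n - 1) * (spearman_rho n (rank_matrix Q) j k)\<^sup>2 = (rank_covariance n (Q j) (Q k) / spearman_sd n)\<^sup>2"
      using n3
    proof eventually_elim
      case (elim n)
      show ?case
      proof (intro allI impI)
        fix Q :: "nat \<Rightarrow> nat list" and j k
        assume Q: "Q j \<in> permutations_of_set {1..n}" "Q k \<in> permutations_of_set {1..n}"
        show "(real n - 1) * (spearman_rho n (rank_matrix Q) j k)\<^sup>2 = (rank_covariance n (Q j) (Q k) / spearman_sd n)\<^sup>2"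
          unfolding spearman_rho_def rel_rank_sum_rank_matrix[OF Q] spearman_sd_def
          by (rule standardize_square[OF normalizations(1)[OF elim]])
      qed
    qed
    show "moderately_gaussian (\<lambda>n ys. rank_covariance n [1..<Suc n] ys / spearman_sd n)"
      "moderately_gaussian (\<lambda>n ys. - (rank_covariance n [1..<Suc n] ys / spearman_sd n))"
      using moderately_gaussian_rank_covariance[of 1] moderately_gaussian_rank_covariance[of "- 1"] by (simp_all del: upt_Suc)
  qed (simp_all add: rank_covariance_permute, simp add: rank_covariance_sym)
  show "(\<lambda>n. measure (M n) {\<omega> \<in> space (M n). T_tau_proj \<alpha> n (d n) (\<lambda>i. Y n i \<omega>) = 1}) \<longlonglongrightarrow> \<alpha>"
    unfolding T_tau_proj_def one
  proof (rule level[where s = "\<lambda>n xs ys. rank_covariance n xs ys / spearman_sd n", OF rank_based_kendall_tau_proj])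
    show "\<forall>\<^sub>F n in sequentially. 0 \<le> 9 * (real n)\<^sup>2 * (real n - 1) / (4 * (real n + 1)\<^sup>2)" using n3 by eventually_elim simp
    show "\<forall>\<^sub>F n in sequentially. \<forall>Q j k. Q j \<in> permutations_of_set {1..n} \<longrightarrow> Q k \<in> permutations_of_set {1..n} \<longrightarrow>
       9 * (real n)\<^sup>2 * (real n - 1) / (4 * (real n + 1)\<^sup>2) * (kendall_tau_proj n (rank_matrix Q) j k)\<^sup>2 = (rank_covariance n (Q j) (Q k) / spearman_sd n)\<^sup>2"
      using n3
    proof eventually_elim
      case (elim n)
      show ?case
      proof (intro allI impI)
        fix Q :: "nat \<Rightarrow> nat list" and j k
        assume Q: "Q j \<in> permutations_of_set {1..n}" "Q k \<in> permutations_of_set {1..n}"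
        show "9 * (real n)\<^sup>2 * (real n - 1) / (4 * (real n + 1)\<^sup>2) * (kendall_tau_proj n (rank_matrix Q) j k)\<^sup>2 = (rank_covariance n (Q j) (Q k) / spearman_sd n)\<^sup>2"
          unfolding kendall_tau_proj_def rel_rank_sum_rank_matrix[OF Q] spearman_sd_def
          by (rule standardize_square[OF normalizations(4)[OF elim]])
      qed
    qed
    show "moderately_gaussian (\<lambda>n ys. rank_covariance n [1..<Suc n] ys / spearman_sd n)"
      "moderately_gaussian (\<lambda>n ys. - (rank_covariance n [1..<Suc n] ys / spearman_sd n))"
      using moderately_gaussian_rank_covariance[of 1] moderately_gaussian_rank_covariance[of "- 1"] by (simp_all del: upt_Suc)
  qed (simp_all add: rank_covariance_permute, simp add: rank_covariance_sym)
  show "(\<lambda>n. measure (M n) {\<omega> \<in> space (M n). T_tau \<alpha> n (d n) (\<lambda>i. Y n i \<omega>) = 1}) \<longlonglongrightarrow> \<alpha>"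
    unfolding T_tau_def one
  proof (rule level[where s = "\<lambda>n xs ys. concordance n xs ys / 2 / kendall_sd n", OF rank_based_kendall_tau])
    show "\<forall>\<^sub>F n in sequentially. 0 \<le> 9 * real n * (real n - 1) / (2 * (2 * real n + 5))" using n3 by eventually_elim simp
    show "\<forall>\<^sub>F n in sequentially. \<forall>Q j k. Q j \<in> permutations_of_set {1..n} \<longrightarrow> Q k \<in> permutations_of_set {1..n} \<longrightarrow>
       9 * real n * (real n - 1) / (2 * (2 * real n + 5)) * (kendall_tau n (rank_matrix Q) j k)\<^sup>2 = (concordance n (Q j) (Q k) / 2 / kendall_sd n)\<^sup>2"
      using n3
    proof eventually_elim
      case (elim n)
      have k: "kendall_tau n (rank_matrix Q) j k = 1 / (real n * (real n - 1)) * concordance n (Q j) (Q k)" for Q j k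
        unfolding kendall_tau_rank_matrix by simp
      show ?case
        unfolding k standardize_square[OF normalizations(2)[OF elim]] kendall_sd_def divide_divide_eq_left by blast
    qed
    show "moderately_gaussian (\<lambda>n ys. concordance n [1..<Suc n] ys / 2 / kendall_sd n)"
      "moderately_gaussian (\<lambda>n ys. - (concordance n [1..<Suc n] ys / 2 / kendall_sd n))"
      using moderately_gaussian_concordance[of 1] moderately_gaussian_concordance[of "- 1"] by (simp_all del: upt_Suc)
  qed (simp_all add: concordance_permute, simp add: concordance_sym)
  let ?s = "\<lambda>n xs ys. major_weight n * (4 * rank_covariance n xs ys - concordance n xs ys)"
  show "(\<lambda>n. measure (M n) {\<omega> \<in> space (M n). T_rho_major \<alpha> n (d n) (\<lambda>i. Y n i \<omega>) = 1}) \<longlonglongrightarrow> \<alpha>"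
    unfolding T_rho_major_def one
  proof (rule level[where s = ?s, OF rank_based_spearman_rho_major])
    show "\<forall>\<^sub>F n in sequentially. 0 \<le> real n * (real n - 1) * (real n - 2) / ((real n)\<^sup>2 - 3)"
      using n3 by eventually_elim (use nsq in auto)
    show "\<forall>\<^sub>F n in sequentially. \<forall>Q j k. Q j \<in> permutations_of_set {1..n} \<longrightarrow> Q k \<in> permutations_of_set {1..n} \<longrightarrow>
       real n * (real n - 1) * (real n - 2) / ((real n)\<^sup>2 - 3) * (spearman_rho_major n (rank_matrix Q) j k)\<^sup>2 = (?s n (Q j) (Q k))\<^sup>2"
      using n3
    proof eventually_elim
      case (elim n)
      have w: "real n * (real n - 1) * (real n - 2) / ((real n)\<^sup>2 - 3) * (3 / (real n * (real n - 1) * (real n - 2)) * t)\<^sup>2 = (major_weight n * t)\<^sup>2" for t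
      proof -
        have "A * (\<kappa> * t)\<^sup>2 = (\<kappa>' * t)\<^sup>2" if "A * \<kappa>\<^sup>2 = \<kappa>'\<^sup>2" for A \<kappa> \<kappa>' :: real
          unfolding power_mult_distrib mult.assoc[symmetric] that ..
        from this[OF normalizations(3)[OF elim]] show ?thesis unfolding major_weight_def .
      qed
      show ?case
      proof (intro allI impI)
        fix Q :: "nat \<Rightarrow> nat list" and j k
        assume Q: "Q j \<in> permutations_of_set {1..n}" "Q k \<in> permutations_of_set {1..n}"
        show "real n * (real n - 1) * (real n - 2) / ((real n)\<^sup>2 - 3) * (spearman_rho_major n (rank_matrix Q) j k)\<^sup>2 = (?s n (Q j) (Q k))\<^sup>2"
          unfolding spearman_rho_major_rank_matrix[OF Q] by (rule w)
      qed
    qed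
    show "moderately_gaussian (\<lambda>n ys. ?s n [1..<Suc n] ys)" "moderately_gaussian (\<lambda>n ys. - ?s n [1..<Suc n] ys)"
      using moderately_gaussian_rho_major[of 1] moderately_gaussian_rho_major[of "- 1"] by (simp_all del: upt_Suc)
  qed (simp_all add: concordance_permute rank_covariance_permute, simp add: concordance_sym rank_covariance_sym)
qed

end
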